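(* Let $F:M^m\times[0,T)\to\mathbb{R}^n$ be a smooth mean curvature flow, and suppose that the normal bundle of $F_0=F(\cdot,0)$ is flat. If there exist a point $p\in M$ and normal vectors $\nu,\xi$ to $F_0$ at $p$ such that $$\mathcal{C}(\nu,\xi)=\sum_{k}\big[(\nabla_{e_k}S)^\nu,(\nabla_{e_k}S)^\xi\big]\neq0,$$ where $\{e_k\}$ is an orthonormal basis of $T_pM$ with respect to the metric induced by $F_0$ and $S$ is the shape operator of $F_0$, then the normal bundle of $F_t=F(\cdot,t)$ is not flat for all sufficiently small $t>0$.
   Context: For an immersion $F:M^m\to\mathbb{R}^n$, let $g$ be the induced metric, $\nabla$ its Levi-Civita connection, $D$ the Euclidean connection, and $(\cdot)^\top,(\cdot)^\perp$ the tangential and normal projections. The normal connection is $\nabla^\perp_X\nu=(D_X\nu)^\perp$, with curvature $R^\perp(X,Y)\nu=\nabla^\perp_X\nabla^\perp_Y\nu-\nabla^\perp_Y\nabla^\perp_X\nu-\nabla^\perp_{[X,Y]}\nu$. The normal bundle is flat if $R^\perp\equiv0$. The second fundamental form is $A(X,Y)=(D_XY)^\perp$, and the mean curvature vector is $H=\mathrm{tr}_gA$. A smooth mean curvature flow is a smooth family of immersions $F:M\times[0,T)\to\mathbb{R}^n$ with $\frac{dF}{dt}(\cdot,t)=H(\cdot,t)$. For a normal field $\nu$, the shape operator is the self-adjoint endomorphism $S^\nu(X)=-(D_X\nu)^\top$ of $TM$. Its covariant derivative is $(\nabla_XS)^\nu=\nabla_XS^\nu-S^{\nabla^\perp_X\nu}$,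 where $(\nabla_XS^\nu)(Y)=\nabla_X(S^\nu(Y))-S^\nu(\nabla_XY)$. This is tensorial in $X$ and $\nu$, so $\mathcal{C}(\nu,\xi)$ is a well-defined endomorphism of $T_pM$, independent of the choice of $\{e_k\}$. The bracket $[\cdot,\cdot]$ is the commutator of endomorphisms. *)

theory Defs
  imports "HOL-Analysis.Analysis"
begin

section \<open>Smooth maps\<close>

primrec Ck_on :: "nat \<Rightarrow> 'a::euclidean_space set \<Rightarrow> ('a \<Rightarrow> 'b::euclidean_space) \<Rightarrow> bool" where
  "Ck_on 0 W g \<longleftrightarrow> continuous_on W g"
| "Ck_on (Suc k) W g \<longleftrightarrow>
     (\<forall>x\<in>W. g differentiable (at x)) \<and> (\<forall>v. Ck_on k W (\<lambda>x. frechet_derivative g (at x) v))"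

text \<open>Smoothness on an arbitrary subset of Euclidean space means local smooth extendability.
  For open sets this is ordinary smoothness; for a product with a half-open time interval it is
  smoothness up to the initial time.\<close>

definition smooth_on :: "'a::euclidean_space set \<Rightarrow> ('a \<Rightarrow> 'b::euclidean_space) \<Rightarrow> bool" where
  "smooth_on B f \<longleftrightarrow>
     (\<forall>x\<in>B. \<exists>W g. open W \<and> x \<in> W \<and> (\<forall>k. Ck_on k W g) \<and> (\<forall>y\<in>W \<inter> B. g y = f y))"

section \<open>Smooth manifolds\<close>

type_synonym ('a, 'm) chart = "'a set \<times> ('a \<Rightarrow> real ^ 'm)"

definition chart_on :: "'a topology \<Rightarrow> ('a, 'm::finite) chart \<Rightarrow> bool" where
  "chart_on X c \<longleftrightarrow> (case c of (U, \<phi>) \<Rightarrow>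
     openin X U \<and> open (\<phi> ` U) \<and>
     homeomorphic_map (subtopology X U) (top_of_set (\<phi> ` U)) \<phi>)"

definition smooth_manifold :: "'a topology \<Rightarrow> ('a, 'm::finite) chart set \<Rightarrow> bool" where
  "smooth_manifold X \<A> \<longleftrightarrow>
     Hausdorff_space X \<and> second_countable X \<and>
     (\<forall>c\<in>\<A>. chart_on X c) \<and> (\<Union>c\<in>\<A>. fst c) = topspace X \<and>
     (\<forall>(U, \<phi>)\<in>\<A>. \<forall>(V, \<psi>)\<in>\<A>. smooth_on (\<phi> ` (U \<inter> V)) (\<lambda>x. \<psi> (inv_into U \<phi> x)))"

definition chart_image :: "('a, 'm::finite) chart \<Rightarrow> (real ^ 'm) set" where
  "chart_image c = snd c ` fst c"

definition in_chart :: "('a, 'm::finite) chart \<Rightarrow> ('a \<Rightarrow> 'b) \<Rightarrow> real ^ 'm \<Rightarrow> 'b" where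
  "in_chart c f = (\<lambda>x. f (inv_into (fst c) (snd c) x))"

section \<open>Geometry of an immersion in a chart\<close>

text \<open>Throughout this section \<open>f\<close> is the coordinate expression of an immersion. Tangent vectors of
  the manifold at \<open>x\<close> are their coordinate vectors in \<open>real ^ 'm\<close>, tangent vector fields are
  \<open>real ^ 'm\<close>-valued maps, and fields along the immersion (in particular normal fields) are
  \<open>real ^ 'n\<close>-valued maps.\<close>

definition dir_deriv ::
    "(real ^ 'm::finite \<Rightarrow> real ^ 'm) \<Rightarrow> (real ^ 'm \<Rightarrow> 'b::real_normed_vector) \<Rightarrow> real ^ 'm \<Rightarrow> 'b" where
  "dir_deriv X h = (\<lambda>x. frechet_derivative h (at x) (X x))"

definition lie_bracket ::
    "(real ^ 'm::finite \<Rightarrow> real ^ 'm) \<Rightarrow> (real ^ 'm \<Rightarrow> real ^ 'm) \<Rightarrow> real ^ 'm \<Rightarrow> real ^ 'm" where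
  "lie_bracket X Y = (\<lambda>x. dir_deriv X Y x - dir_deriv Y X x)"

definition push :: "(real ^ 'm::finite \<Rightarrow> real ^ 'n::finite) \<Rightarrow> real ^ 'm \<Rightarrow> real ^ 'm \<Rightarrow> real ^ 'n" where
  "push f x v = frechet_derivative f (at x) v"

definition induced_metric ::
    "(real ^ 'm::finite \<Rightarrow> real ^ 'n::finite) \<Rightarrow> real ^ 'm \<Rightarrow> real ^ 'm \<Rightarrow> real ^ 'm \<Rightarrow> real" where
  "induced_metric f x v w = push f x v \<bullet> push f x w"

text \<open>The tangential part of an ambient vector is recorded by its coordinate vector.\<close>

definition tang :: "(real ^ 'm::finite \<Rightarrow> real ^ 'n::finite) \<Rightarrow> real ^ 'm \<Rightarrow> real ^ 'n \<Rightarrow> real ^ 'm" where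
  "tang f x u = (THE w. \<forall>v. (u - push f x w) \<bullet> push f x v = 0)"

definition nor :: "(real ^ 'm::finite \<Rightarrow> real ^ 'n::finite) \<Rightarrow> real ^ 'm \<Rightarrow> real ^ 'n \<Rightarrow> real ^ 'n" where
  "nor f x u = u - push f x (tang f x u)"

definition normal_at :: "(real ^ 'm::finite \<Rightarrow> real ^ 'n::finite) \<Rightarrow> real ^ 'm \<Rightarrow> real ^ 'n \<Rightarrow> bool" where
  "normal_at f x \<nu> \<longleftrightarrow> (\<forall>v. \<nu> \<bullet> push f x v = 0)"

text \<open>Levi-Civita connection of a metric: \<open>\<nabla>\<^sub>X Y = D\<^sub>X Y + \<Gamma>(X, Y)\<close> with the Christoffel symbols
  \<open>\<Gamma>\<close> of the metric, the index being raised by solving for \<open>z\<close>.\<close>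

definition christoffel ::
    "(real ^ 'm::finite \<Rightarrow> real ^ 'm \<Rightarrow> real ^ 'm \<Rightarrow> real) \<Rightarrow> real ^ 'm \<Rightarrow> real ^ 'm \<Rightarrow> real ^ 'm \<Rightarrow> real ^ 'm" where
  "christoffel g x v w = (THE z. \<forall>u. g x z u =
     (frechet_derivative (\<lambda>y. g y w u) (at x) v
      + frechet_derivative (\<lambda>y. g y v u) (at x) w
      - frechet_derivative (\<lambda>y. g y v w) (at x) u) / 2)"

definition levi_civita ::
    "(real ^ 'm::finite \<Rightarrow> real ^ 'm \<Rightarrow> real ^ 'm \<Rightarrow> real)
      \<Rightarrow> (real ^ 'm \<Rightarrow> real ^ 'm) \<Rightarrow> (real ^ 'm \<Rightarrow> real ^ 'm) \<Rightarrow> real ^ 'm \<Rightarrow> real ^ 'm" where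
  "levi_civita g X Y = (\<lambda>x. dir_deriv X Y x + christoffel g x (X x) (Y x))"

definition normal_conn ::
    "(real ^ 'm::finite \<Rightarrow> real ^ 'n::finite)
      \<Rightarrow> (real ^ 'm \<Rightarrow> real ^ 'm) \<Rightarrow> (real ^ 'm \<Rightarrow> real ^ 'n) \<Rightarrow> real ^ 'm \<Rightarrow> real ^ 'n" where
  "normal_conn f X N = (\<lambda>x. nor f x (dir_deriv X N x))"

definition normal_curv ::
    "(real ^ 'm::finite \<Rightarrow> real ^ 'n::finite) \<Rightarrow> (real ^ 'm \<Rightarrow> real ^ 'm)
      \<Rightarrow> (real ^ 'm \<Rightarrow> real ^ 'm) \<Rightarrow> (real ^ 'm \<Rightarrow> real ^ 'n) \<Rightarrow> real ^ 'm \<Rightarrow> real ^ 'n" where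
  "normal_curv f X Y N = (\<lambda>x. normal_conn f X (normal_conn f Y N) x
     - normal_conn f Y (normal_conn f X N) x - normal_conn f (lie_bracket X Y) N x)"

definition flat_normal_on :: "(real ^ 'm::finite) set \<Rightarrow> (real ^ 'm \<Rightarrow> real ^ 'n::finite) \<Rightarrow> bool" where
  "flat_normal_on \<Omega> f \<longleftrightarrow>
     (\<forall>X Y N. smooth_on \<Omega> X \<and> smooth_on \<Omega> Y \<and> smooth_on \<Omega> N \<and> (\<forall>x\<in>\<Omega>. normal_at f x (N x))
        \<longrightarrow> (\<forall>x\<in>\<Omega>. normal_curv f X Y N x = 0))"

definition second_ff ::
    "(real ^ 'm::finite \<Rightarrow> real ^ 'n::finite)
      \<Rightarrow> (real ^ 'm \<Rightarrow> real ^ 'm) \<Rightarrow> (real ^ 'm \<Rightarrow> real ^ 'm) \<Rightarrow> real ^ 'm \<Rightarrow> real ^ 'n" where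
  "second_ff f X Y = (\<lambda>x. nor f x (dir_deriv X (\<lambda>y. push f y (Y y)) x))"

definition gram :: "(real ^ 'm::finite \<Rightarrow> real ^ 'n::finite) \<Rightarrow> real ^ 'm \<Rightarrow> real ^ 'm ^ 'm" where
  "gram f x = (\<chi> i j. induced_metric f x (axis i 1) (axis j 1))"

text \<open>\<open>H = tr\<^sub>g A = g\<^sup>i\<^sup>j A(\<partial>\<^sub>i, \<partial>\<^sub>j)\<close>\<close>

definition mean_curv :: "(real ^ 'm::finite \<Rightarrow> real ^ 'n::finite) \<Rightarrow> real ^ 'm \<Rightarrow> real ^ 'n" where
  "mean_curv f x = (\<Sum>i\<in>UNIV. \<Sum>j\<in>UNIV.
     (matrix_inv (gram f x) $ i $ j) *\<^sub>R second_ff f (\<lambda>_. axis i 1) (\<lambda>_. axis j 1) x)"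

definition shape_op ::
    "(real ^ 'm::finite \<Rightarrow> real ^ 'n::finite)
      \<Rightarrow> (real ^ 'm \<Rightarrow> real ^ 'n) \<Rightarrow> (real ^ 'm \<Rightarrow> real ^ 'm) \<Rightarrow> real ^ 'm \<Rightarrow> real ^ 'm" where
  "shape_op f N X = (\<lambda>x. - tang f x (dir_deriv X N x))"

text \<open>\<open>nabla_shape f X N Y = ((\<nabla>\<^sub>X S)\<^sup>N)(Y) = (\<nabla>\<^sub>X S\<^sup>N)(Y) - S\<^bsup>\<nabla>\<^sup>\<bottom>\<^sub>X N\<^esup>(Y)\<close>\<close>

definition nabla_shape ::
    "(real ^ 'm::finite \<Rightarrow> real ^ 'n::finite) \<Rightarrow> (real ^ 'm \<Rightarrow> real ^ 'm)
      \<Rightarrow> (real ^ 'm \<Rightarrow> real ^ 'n) \<Rightarrow> (real ^ 'm \<Rightarrow> real ^ 'm) \<Rightarrow> real ^ 'm \<Rightarrow> real ^ 'm" where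
  "nabla_shape f X N Y = (\<lambda>x.
     (levi_civita (induced_metric f) X (shape_op f N Y) x
       - shape_op f N (levi_civita (induced_metric f) X Y) x)
     - shape_op f (normal_conn f X N) Y x)"

text \<open>By tensoriality the value at a point depends only on the vectors there. It is computed with
  the following extensions: \<open>v\<close> and \<open>w\<close> are extended by constant coordinates, and the normal
  vector \<open>\<nu>\<close> by its normal projections at neighbouring points.\<close>

definition nabla_shape_at ::
    "(real ^ 'm::finite \<Rightarrow> real ^ 'n::finite) \<Rightarrow> real ^ 'm \<Rightarrow> real ^ 'm \<Rightarrow> real ^ 'n \<Rightarrow> real ^ 'm \<Rightarrow> real ^ 'm" where
  "nabla_shape_at f x v \<nu> w = nabla_shape f (\<lambda>_. v) (\<lambda>y. nor f y \<nu>) (\<lambda>_. w) x"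

definition commutator :: "('v \<Rightarrow> 'v::ab_group_add) \<Rightarrow> ('v \<Rightarrow> 'v) \<Rightarrow> 'v \<Rightarrow> 'v" where
  "commutator P Q = (\<lambda>w. P (Q w) - Q (P w))"

definition orthonormal_at ::
    "(real ^ 'm::finite \<Rightarrow> real ^ 'n::finite) \<Rightarrow> real ^ 'm \<Rightarrow> ('m \<Rightarrow> real ^ 'm) \<Rightarrow> bool" where
  "orthonormal_at f x e \<longleftrightarrow> (\<forall>i j. induced_metric f x (e i) (e j) = (if i = j then 1 else 0))"

definition C_endo ::
    "(real ^ 'm::finite \<Rightarrow> real ^ 'n::finite) \<Rightarrow> real ^ 'm \<Rightarrow> ('m \<Rightarrow> real ^ 'm)
      \<Rightarrow> real ^ 'n \<Rightarrow> real ^ 'n \<Rightarrow> real ^ 'm \<Rightarrow> real ^ 'm" where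
  "C_endo f x e \<nu> \<xi> = (\<lambda>w. \<Sum>k\<in>UNIV.
     commutator (nabla_shape_at f x (e k) \<nu>) (nabla_shape_at f x (e k) \<xi>) w)"

section \<open>Mean curvature flow\<close>

definition time_interval :: "ereal \<Rightarrow> real set" where
  "time_interval T = {t. 0 \<le> t \<and> ereal t < T}"

definition immersion :: "('a, 'm::finite) chart set \<Rightarrow> ('a \<Rightarrow> real ^ 'n::finite) \<Rightarrow> bool" where
  "immersion \<A> f \<longleftrightarrow> (\<forall>c\<in>\<A>. smooth_on (chart_image c) (in_chart c f) \<and>
     (\<forall>x\<in>chart_image c. inj (push (in_chart c f) x)))"

definition flat_normal_bundle :: "('a, 'm::finite) chart set \<Rightarrow> ('a \<Rightarrow> real ^ 'n::finite) \<Rightarrow> bool" where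
  "flat_normal_bundle \<A> f \<longleftrightarrow> (\<forall>c\<in>\<A>. flat_normal_on (chart_image c) (in_chart c f))"

definition mean_curvature_flow ::
    "('a, 'm::finite) chart set \<Rightarrow> ereal \<Rightarrow> ('a \<Rightarrow> real \<Rightarrow> real ^ 'n::finite) \<Rightarrow> bool" where
  "mean_curvature_flow \<A> T F \<longleftrightarrow>
     (\<forall>c\<in>\<A>. smooth_on (chart_image c \<times> time_interval T) (\<lambda>(x, t). in_chart c F x t)) \<and>
     (\<forall>t\<in>time_interval T. immersion \<A> (\<lambda>p. F p t)) \<and>
     (\<forall>c\<in>\<A>. \<forall>p\<in>fst c. \<forall>t\<in>time_interval T.
        (F p has_vector_derivative mean_curv (in_chart c (\<lambda>q. F q t)) (snd c p))
          (at t within time_interval T))"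

end

theory Submission
  imports Defs
begin

text \<open>
  Let \<open>G(x, t)\<close> extend the flow smoothly and let \<open>X\<^sub>i\<close> be the coordinate fields of the graph
  representation of \<open>F\<^sub>0\<close> over its tangent plane at the point. They commute with each other and with
  \<open>\<partial>\<^sub>t\<close>, and at the point all tangential parts of \<open>X\<^sub>i X\<^sub>j G\<close> and \<open>X\<^sub>k X\<^sub>i X\<^sub>j G\<close> vanish.
  For a constant vector \<open>\<nu>\<close> of the ambient space let \<open>A\<^sup>\<nu>\<close> be the second fundamental form paired with
  \<open>\<nu>\<close>. By the Ricci equation the normal bundle is flat iff \<open>E(\<nu>, \<xi>) = A\<^sup>\<nu> A\<^sup>\<xi> - A\<^sup>\<xi> A\<^sup>\<nu>\<close>
  (index raised with the metric) vanishes for all \<open>\<nu>\<close> and \<open>\<xi>\<close>. At \<open>t = 0\<close> both \<open>\<partial>\<^sub>t A\<^sup>\<nu>\<close> and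
  \<open>\<Sum>\<^sub>k X\<^sub>k X\<^sub>k A\<^sup>\<nu>\<close> equal the same fourth order term plus polynomials in the commuting matrices
  \<open>A\<^sup>\<eta>\<close>, which drop out of the commutators. Since \<open>E\<close> vanishes identically at \<open>t = 0\<close>, so does
  \<open>\<Sum>\<^sub>k X\<^sub>k X\<^sub>k E\<close>, and subtracting gives
  \<open>\<partial>\<^sub>t E = -2 \<Sum>\<^sub>k [X\<^sub>k A\<^sup>\<nu>, X\<^sub>k A\<^sup>\<xi>]\<close> at the point, which is \<open>-2 \<C>(\<nu>, \<xi>)\<close>.
  Hence \<open>E\<close> becomes nonzero immediately if \<open>\<C>(\<nu>, \<xi>) \<noteq> 0\<close>.
\<close>

section \<open>Calculus of smooth maps\<close>

text \<open>Two choices turn covariant evolution equations into plain differentiation. The frame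
  commutes, so fourth derivatives of the immersion may be permuted freely, which stands in for the
  Codazzi equation and its curvature corrections. Such a frame cannot be orthonormal in general, but
  in graph coordinates its Gram matrix at time zero is the identity to first order at the point, so
  second derivatives of the metric only add products of second derivatives of \<open>G\<close>. A
  constant \<nu> avoids evolving normal fields: if it is normal at the point, the first derivative
  of its projection is tangential there and invisible to the normal vectors it is paired with. The
  factor -2 is a Leibniz cross term. With L the common fourth order term, the sum of the second
  frame derivatives of \<open>E\<close> is [L(\<nu>), A(\<xi>)] + [A(\<nu>), L(\<xi>)] plus twice
  the sum of the brackets of first derivatives. It is zero, while the time derivative consists of
  the first two brackets alone. Flow equation and initial flatness are used on the slice at time
  zero and are differentiated only along it.\<close>

lemma differentiable_transform_open:
  assumes "open W" "x \<in> W" "\<And>y. y \<in> W \<Longrightarrow> f y = g y" "f differentiable (at x)"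
  shows "g differentiable (at x)"
  using assms has_derivative_transform_within_open[of f _ x UNIV W g]
  unfolding differentiable_def by auto

lemma frechet_derivative_cong_open:
  assumes "open W" "x \<in> W" "\<And>y. y \<in> W \<Longrightarrow> f y = g y"
  shows "frechet_derivative f (at x) = frechet_derivative g (at x)"
proof -
  have "(f has_derivative f') (at x) \<longleftrightarrow> (g has_derivative f') (at x)" for f'
    using assms has_derivative_transform_within_open[of f f' x UNIV W g]
      has_derivative_transform_within_open[of g f' x UNIV W f] by auto
  then show ?thesis unfolding frechet_derivative_def by simp
qed

lemma frechet_derivative_eqI:
  "(f has_derivative f') (at x) \<Longrightarrow> frechet_derivative f (at x) v = f' v"
  by (metis frechet_derivative_at)

lemma Ck_on_cong:
  assumes "open W" "\<And>y. y \<in> W \<Longrightarrow> f y = g y"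
  shows "Ck_on k W f \<longleftrightarrow> Ck_on k W g"
  using assms(2)
proof (induction k arbitrary: f g)
  case 0
  then show ?case by (simp cong: continuous_on_cong)
next
  case (Suc k)
  have "f differentiable (at x) \<longleftrightarrow> g differentiable (at x)" if "x \<in> W" for x
    using differentiable_transform_open[OF assms(1) that, of f g]
      differentiable_transform_open[OF assms(1) that, of g f] Suc.prems by auto
  moreover have "Ck_on k W (\<lambda>x. frechet_derivative f (at x) v) \<longleftrightarrow>
      Ck_on k W (\<lambda>x. frechet_derivative g (at x) v)" for v
    by (rule Suc.IH) (metis frechet_derivative_cong_open[OF assms(1)] Suc.prems)
  ultimately show ?case by simp
qed

lemma Ck_on_subset: "Ck_on k W f \<Longrightarrow> V \<subseteq> W \<Longrightarrow> Ck_on k V f"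
  by (induction k arbitrary: f) (auto intro: continuous_on_subset)

lemma Ck_on_SucD: "Ck_on (Suc k) W f \<Longrightarrow> Ck_on k W f"
proof (induction k arbitrary: f)
  case 0
  then show ?case
    by (auto intro!: continuous_at_imp_continuous_on differentiable_imp_continuous_within)
next
  case (Suc k)
  then show ?case by (metis Ck_on.simps(2))
qed

text \<open>\<open>Ck_on\<close> takes its derivatives in the full space (\<open>at x\<close>), so
  each stage of the recursion is decided by neighbourhoods of single points.\<close>

lemma Ck_on_local:
  assumes "\<And>x. x \<in> W \<Longrightarrow> \<exists>V. open V \<and> x \<in> V \<and> Ck_on k V f"
  shows "Ck_on k W f"
  using assms
proof (induction k arbitrary: f)
  case 0
  then show ?case
    by (auto intro!: continuous_at_imp_continuous_on) (meson continuous_on_eq_continuous_at)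
next
  case (Suc k)
  show ?case
    unfolding Ck_on.simps
  proof (intro conjI allI ballI)
    show "f differentiable (at x)" if "x \<in> W" for x
      using Suc.prems[OF that] by auto
    show "Ck_on k W (\<lambda>x. frechet_derivative f (at x) v)" for v
    proof (rule Suc.IH)
      fix x assume "x \<in> W"
      then obtain V where "open V" "x \<in> V" "Ck_on (Suc k) V f" using Suc.prems by blast
      then show "\<exists>V. open V \<and> x \<in> V \<and> Ck_on k V (\<lambda>x. frechet_derivative f (at x) v)"
        by auto
    qed
  qed
qed

lemma Ck_on_const: "Ck_on k W (\<lambda>x. c)"
  by (induction k arbitrary: c) auto

lemma Ck_on_add:
  assumes "open W" "Ck_on k W f" "Ck_on k W g"
  shows "Ck_on k W (\<lambda>x. f x + g x)"
  using assms(2,3)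
proof (induction k arbitrary: f g)
  case 0
  then show ?case by (auto intro: continuous_intros)
next
  case (Suc k)
  have "frechet_derivative (\<lambda>x. f x + g x) (at x) v
      = frechet_derivative f (at x) v + frechet_derivative g (at x) v" if "x \<in> W" for x v
    using Suc.prems that
    by (intro frechet_derivative_eqI has_derivative_add) (auto simp: frechet_derivative_works)
  then have "Ck_on k W (\<lambda>x. frechet_derivative (\<lambda>x. f x + g x) (at x) v)" for v
    by (subst Ck_on_cong[OF assms(1), of _ "\<lambda>x. frechet_derivative f (at x) v + frechet_derivative g (at x) v"])
      (use Suc in auto)
  then show ?case using Suc.prems by auto
qed

lemma frechet_derivative_bilinear:
  assumes "bounded_bilinear B" "f differentiable (at x)" "g differentiable (at x)"
  shows "frechet_derivative (\<lambda>x. B (f x) (g x)) (at x) v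
      = B (frechet_derivative f (at x) v) (g x) + B (f x) (frechet_derivative g (at x) v)"
proof -
  have "((\<lambda>x. B (f x) (g x)) has_derivative (\<lambda>v. B (f x) (frechet_derivative g (at x) v) +
     B (frechet_derivative f (at x) v) (g x))) (at x)"
    by (rule bounded_bilinear.FDERIV[OF assms(1)]) (use assms in \<open>auto simp: frechet_derivative_works\<close>)
  from frechet_derivative_eqI[OF this] show ?thesis by simp
qed

lemma Ck_on_bilinear:
  assumes "open W" "bounded_bilinear B" "Ck_on k W f" "Ck_on k W g"
  shows "Ck_on k W (\<lambda>x. B (f x) (g x))"
  using assms(3,4)
proof (induction k arbitrary: f g)
  case 0
  then show ?case by (auto intro: bounded_bilinear.continuous_on[OF assms(2)])
next
  case (Suc k)
  have d: "f differentiable (at x)" "g differentiable (at x)" if "x \<in> W" for x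
    using Suc.prems that by auto
  have "Ck_on k W (\<lambda>x. B (frechet_derivative f (at x) v) (g x) + B (f x) (frechet_derivative g (at x) v))" for v
    by (intro Ck_on_add assms(1) Suc.IH Ck_on_SucD[OF Suc.prems(1)] Ck_on_SucD[OF Suc.prems(2)])
      (use Suc.prems in auto)
  then have "Ck_on k W (\<lambda>x. frechet_derivative (\<lambda>x. B (f x) (g x)) (at x) v)" for v
    by (subst Ck_on_cong[OF assms(1)]) (use frechet_derivative_bilinear[OF assms(2) d] in auto)
  moreover have "(\<lambda>x. B (f x) (g x)) differentiable (at x)" if "x \<in> W" for x
    by (rule differentiableI[OF bounded_bilinear.FDERIV[OF assms(2)]])
      (use d[OF that] in \<open>auto simp: frechet_derivative_works\<close>)
  ultimately show ?case by simp
qed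

lemma Ck_on_linear:
  assumes "open W" "bounded_linear L" "Ck_on k W f"
  shows "Ck_on k W (\<lambda>x. L (f x))"
  using assms(3)
proof (induction k arbitrary: f)
  case 0
  then show ?case by (auto intro: bounded_linear.continuous_on[OF assms(2)])
next
  case (Suc k)
  have d: "((\<lambda>x. L (f x)) has_derivative (\<lambda>v. L (frechet_derivative f (at x) v))) (at x)" if "x \<in> W" for x
    by (rule bounded_linear.has_derivative[OF assms(2)]) (use Suc.prems that in \<open>auto simp: frechet_derivative_works\<close>)
  have "Ck_on k W (\<lambda>x. frechet_derivative (\<lambda>x. L (f x)) (at x) v)" for v
    by (subst Ck_on_cong[OF assms(1), of _ "\<lambda>x. L (frechet_derivative f (at x) v)"])
      (use Suc frechet_derivative_eqI[OF d] in auto)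
  then show ?case using d by (auto simp: differentiable_def)
qed

lemma Ck_on_inverse:
  fixes f :: "'a::euclidean_space \<Rightarrow> real"
  assumes "open W" "Ck_on k W f" "\<And>x. x \<in> W \<Longrightarrow> f x \<noteq> 0"
  shows "Ck_on k W (\<lambda>x. inverse (f x))"
  using assms(2)
proof (induction k)
  case 0
  then show ?case using assms(3) by (auto intro: continuous_intros)
next
  case (Suc k)
  have d: "((\<lambda>x. inverse (f x)) has_derivative
      (\<lambda>v. - (inverse (f x) * frechet_derivative f (at x) v * inverse (f x)))) (at x)" if "x \<in> W" for x
    using Suc.prems that assms(3)[OF that]
    by (intro Deriv.has_derivative_inverse) (auto simp: frechet_derivative_works)
  have i: "Ck_on k W (\<lambda>x. inverse (f x))"
    using Suc Ck_on_SucD by blast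
  have "Ck_on k W (\<lambda>x. - (inverse (f x) * frechet_derivative f (at x) v * inverse (f x)))" for v
    by (intro Ck_on_linear[OF assms(1) bounded_linear_minus[OF bounded_linear_ident]]
        Ck_on_bilinear[OF assms(1) bounded_bilinear_mult] i) (use Suc.prems in auto)
  then have "Ck_on k W (\<lambda>x. frechet_derivative (\<lambda>x. inverse (f x)) (at x) v)" for v
    by (subst Ck_on_cong[OF assms(1)]) (use frechet_derivative_eqI[OF d] in auto)
  then show ?case using d by (auto simp: differentiable_def)
qed

text \<open>An affine inner map has the constant derivative \<open>L\<close>: differentiating along
  \<open>v\<close> gives an expression of the same shape along \<open>L v\<close>, and the induction
  closes without a chain rule of higher order.\<close>

lemma Ck_on_affine:
  fixes f :: "'a::euclidean_space \<Rightarrow> 'b::euclidean_space" and L :: "'c::euclidean_space \<Rightarrow> 'a"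
  assumes "open V" "bounded_linear L" "Ck_on k W f" "\<And>y. y \<in> V \<Longrightarrow> c + L y \<in> W"
  shows "Ck_on k V (\<lambda>y. f (c + L y))"
  using assms(3)
proof (induction k arbitrary: f)
  case 0
  then show ?case
    by (auto intro!: continuous_on_compose2[of W f] continuous_intros assms(4)
        bounded_linear.continuous_on[OF assms(2)])
next
  case (Suc k)
  have d: "((\<lambda>y. f (c + L y)) has_derivative (\<lambda>v. frechet_derivative f (at (c + L y)) (L v))) (at y)"
    if "y \<in> V" for y
  proof -
    have "((\<lambda>y. c + L y) has_derivative L) (at y)"
      using bounded_linear_imp_has_derivative[OF assms(2)]
      by (auto intro!: derivative_eq_intros)
    then show ?thesis
      using Suc.prems assms(4)[OF that] diff_chain_at[of "\<lambda>y. c + L y" L y f]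
      by (auto simp: frechet_derivative_works o_def)
  qed
  have "Ck_on k V (\<lambda>x. frechet_derivative (\<lambda>y. f (c + L y)) (at x) v)" for v
    by (subst Ck_on_cong[OF assms(1), of _ "\<lambda>y. frechet_derivative f (at (c + L y)) (L v)"])
      (use Suc.prems Suc.IH[of "\<lambda>z. frechet_derivative f (at z) (L v)"] frechet_derivative_eqI[OF d] in auto)
  then show ?case using d by (auto simp: differentiable_def)
qed

text \<open>\<open>smooth_on\<close> speaks of local extensions and is awkward to differentiate. On
  open sets it is equivalent to this direct notion, by \<open>Cinf_on_imp_smooth_on\<close> and
  \<open>smooth_on_imp_Cinf_on\<close>.\<close>

definition Cinf_on :: "'a::euclidean_space set \<Rightarrow> ('a \<Rightarrow> 'b::euclidean_space) \<Rightarrow> bool" where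
  "Cinf_on W f \<longleftrightarrow> (\<forall>k. Ck_on k W f)"

lemma Cinf_on_differentiable: "Cinf_on W f \<Longrightarrow> x \<in> W \<Longrightarrow> f differentiable (at x)"
  unfolding Cinf_on_def by (metis Ck_on.simps(2))

lemma Cinf_on_has_derivative:
  "Cinf_on W f \<Longrightarrow> x \<in> W \<Longrightarrow> (f has_derivative frechet_derivative f (at x)) (at x)"
  using Cinf_on_differentiable frechet_derivative_works by blast

lemma Cinf_on_continuous: "Cinf_on W f \<Longrightarrow> continuous_on W f"
  unfolding Cinf_on_def by (metis Ck_on.simps(1))

lemma Cinf_on_subset: "Cinf_on W f \<Longrightarrow> V \<subseteq> W \<Longrightarrow> Cinf_on V f"
  unfolding Cinf_on_def using Ck_on_subset by blast

lemma Cinf_on_cong: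
  "open W \<Longrightarrow> (\<And>x. x \<in> W \<Longrightarrow> f x = g x) \<Longrightarrow> Cinf_on W f \<longleftrightarrow> Cinf_on W g"
  unfolding Cinf_on_def using Ck_on_cong by metis

lemma Cinf_on_imp_smooth_on: "open W \<Longrightarrow> Cinf_on W f \<Longrightarrow> smooth_on W f"
  unfolding smooth_on_def Cinf_on_def by blast

lemma smooth_on_imp_Cinf_on:
  assumes "open W" "smooth_on W f"
  shows "Cinf_on W f"
  unfolding Cinf_on_def
proof (intro allI Ck_on_local)
  fix k x assume "x \<in> W"
  then obtain V g where "open V" "x \<in> V" and g: "\<forall>k. Ck_on k V g" "\<forall>y\<in>V \<inter> W. g y = f y"
    using assms(2) unfolding smooth_on_def by metis
  then have "Ck_on k (V \<inter> W) g" using Ck_on_subset by blast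
  then have "Ck_on k (V \<inter> W) f"
    using Ck_on_cong[of "V \<inter> W" g f k] \<open>open V\<close> assms(1) g by auto
  then show "\<exists>V. open V \<and> x \<in> V \<and> Ck_on k V f"
    using \<open>open V\<close> \<open>x \<in> V\<close> \<open>x \<in> W\<close> assms(1) by (intro exI[of _ "V \<inter> W"]) auto
qed

lemma Cinf_on_frechet: "Cinf_on W f \<Longrightarrow> Cinf_on W (\<lambda>x. frechet_derivative f (at x) v)"
  unfolding Cinf_on_def by (metis Ck_on.simps(2))

lemma Cinf_on_const: "Cinf_on W (\<lambda>x. c)"
  unfolding Cinf_on_def using Ck_on_const by blast

lemma Cinf_on_add: "open W \<Longrightarrow> Cinf_on W f \<Longrightarrow> Cinf_on W g \<Longrightarrow> Cinf_on W (\<lambda>x. f x + g x)"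
  unfolding Cinf_on_def by (simp add: Ck_on_add)

lemma Cinf_on_bilinear:
  "open W \<Longrightarrow> bounded_bilinear B \<Longrightarrow> Cinf_on W f \<Longrightarrow> Cinf_on W g \<Longrightarrow> Cinf_on W (\<lambda>x. B (f x) (g x))"
  unfolding Cinf_on_def using Ck_on_bilinear[of W B _ f g] by simp

lemma Cinf_on_linear:
  "open W \<Longrightarrow> bounded_linear L \<Longrightarrow> Cinf_on W f \<Longrightarrow> Cinf_on W (\<lambda>x. L (f x))"
  unfolding Cinf_on_def using Ck_on_linear[of W L _ f] by simp

lemma Cinf_on_affine:
  "open V \<Longrightarrow> bounded_linear L \<Longrightarrow> Cinf_on W f \<Longrightarrow> (\<And>y. y \<in> V \<Longrightarrow> c + L y \<in> W) \<Longrightarrow>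
    Cinf_on V (\<lambda>y. f (c + L y))"
  unfolding Cinf_on_def by (intro allI Ck_on_affine[where L=L and W=W]) simp_all

lemma Cinf_on_inverse:
  fixes f :: "'a::euclidean_space \<Rightarrow> real"
  shows "open W \<Longrightarrow> Cinf_on W f \<Longrightarrow> (\<And>x. x \<in> W \<Longrightarrow> f x \<noteq> 0) \<Longrightarrow> Cinf_on W (\<lambda>x. inverse (f x))"
  unfolding Cinf_on_def by (simp add: Ck_on_inverse)

lemmas Cinf_on_inner = Cinf_on_bilinear[OF _ bounded_bilinear_inner]
lemmas Cinf_on_scaleR = Cinf_on_bilinear[OF _ bounded_bilinear_scaleR]

lemma Cinf_on_mult:
  fixes f :: "'a::euclidean_space \<Rightarrow> real"
  shows "open W \<Longrightarrow> Cinf_on W f \<Longrightarrow> Cinf_on W g \<Longrightarrow> Cinf_on W (\<lambda>x. f x * g x)"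
  using Cinf_on_scaleR[of W f g] by simp

lemma Cinf_on_uminus: "open W \<Longrightarrow> Cinf_on W f \<Longrightarrow> Cinf_on W (\<lambda>x. - f x)"
  by (rule Cinf_on_linear[OF _ bounded_linear_minus[OF bounded_linear_ident]])

lemma Cinf_on_diff: "open W \<Longrightarrow> Cinf_on W f \<Longrightarrow> Cinf_on W g \<Longrightarrow> Cinf_on W (\<lambda>x. f x - g x)"
  using Cinf_on_add[of W f "\<lambda>x. - g x"] Cinf_on_uminus[of W g] by simp

lemma Cinf_on_sum:
  assumes "open W" "\<And>i. i \<in> I \<Longrightarrow> Cinf_on W (f i)"
  shows "Cinf_on W (\<lambda>x. \<Sum>i\<in>I. f i x)"
  using assms(2) by (induction I rule: infinite_finite_induct) (simp_all add: Cinf_on_const Cinf_on_add assms(1))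

lemma Cinf_on_prod:
  fixes f :: "'i \<Rightarrow> 'a::euclidean_space \<Rightarrow> real"
  assumes "open W" "\<And>i. i \<in> I \<Longrightarrow> Cinf_on W (f i)"
  shows "Cinf_on W (\<lambda>x. \<Prod>i\<in>I. f i x)"
  using assms(2) by (induction I rule: infinite_finite_induct) (simp_all add: Cinf_on_const Cinf_on_mult assms(1))

lemma Cinf_on_nth: "open W \<Longrightarrow> Cinf_on W f \<Longrightarrow> Cinf_on W (\<lambda>x. f x $ i)"
  for f :: "'a::euclidean_space \<Rightarrow> 'b::euclidean_space ^ 'm"
  by (rule Cinf_on_linear[OF _ bounded_linear_vec_nth])

lemma Cinf_on_vec:
  fixes f :: "'m::finite \<Rightarrow> 'a::euclidean_space \<Rightarrow> real"
  assumes "open W" "\<And>i. Cinf_on W (f i)"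
  shows "Cinf_on W (\<lambda>x. \<chi> i. f i x)"
proof -
  have "Cinf_on W (\<lambda>x. \<Sum>i\<in>UNIV. f i x *\<^sub>R axis i (1::real))"
    by (intro Cinf_on_sum Cinf_on_scaleR Cinf_on_const assms)
  moreover have "(\<Sum>i\<in>UNIV. f i x *\<^sub>R axis i (1::real)) = (\<chi> i. f i x)" for x
    by (simp add: vec_eq_iff axis_def if_distrib cong: if_cong)
  ultimately show ?thesis by simp
qed

lemma Cinf_on_Pair0:
  "open W \<Longrightarrow> Cinf_on W f \<Longrightarrow> Cinf_on W (\<lambda>x. (f x, 0))"
  using Cinf_on_linear[of W "\<lambda>y. (y, 0)" f] bounded_linear_Pair[OF bounded_linear_ident bounded_linear_zero] by simp

lemmas Cinf_on_intros = Cinf_on_const Cinf_on_add Cinf_on_diff Cinf_on_uminus Cinf_on_inner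
  Cinf_on_scaleR Cinf_on_mult Cinf_on_sum Cinf_on_frechet Cinf_on_nth Cinf_on_vec

section \<open>Determinants and inverse matrices with smooth entries\<close>

lemma Cinf_on_det:
  fixes A :: "'a::euclidean_space \<Rightarrow> real ^ 'm::finite ^ 'm"
  assumes "open W" "\<And>i j. Cinf_on W (\<lambda>x. A x $ i $ j)"
  shows "Cinf_on W (\<lambda>x. det (A x))"
  unfolding det_def by (intro Cinf_on_sum Cinf_on_mult Cinf_on_prod Cinf_on_const assms)

lemma matrix_inv_inverse:
  fixes A :: "real ^ 'm::finite ^ 'm"
  assumes "det A \<noteq> 0"
  shows "A ** matrix_inv A = mat 1" "matrix_inv A ** A = mat 1"
proof -
  obtain B where "A ** B = mat 1" "B ** A = mat 1"
    using assms invertible_det_nz[of A] unfolding invertible_def by blast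
  then have "A ** matrix_inv A = mat 1 \<and> matrix_inv A ** A = mat 1"
    unfolding matrix_inv_def by (rule_tac someI) blast
  then show "A ** matrix_inv A = mat 1" "matrix_inv A ** A = mat 1" by auto
qed

lemma matrix_inv_unique':
  fixes A :: "real ^ 'm::finite ^ 'm"
  assumes "B ** A = mat 1"
  shows "matrix_inv A = B"
proof -
  have "det B * det A = 1" using assms by (metis det_I det_mul)
  then have "det A \<noteq> 0" by auto
  then show ?thesis
    using matrix_inv_inverse(1)[of A] assms by (metis matrix_mul_assoc matrix_mul_lid matrix_mul_rid)
qed

lemma matrix_inv_sym:
  fixes A :: "real ^ 'm::finite ^ 'm"
  assumes "transpose A = A" "det A \<noteq> 0"
  shows "matrix_inv A $ i $ j = matrix_inv A $ j $ i"
proof -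
  have "transpose (matrix_inv A) ** A = transpose (A ** matrix_inv A)"
    by (simp add: matrix_transpose_mul assms(1))
  then have "matrix_inv A = transpose (matrix_inv A)"
    by (intro matrix_inv_unique') (simp add: matrix_inv_inverse(1)[OF assms(2)])
  then show ?thesis by (metis (no_types) transpose_def vec_lambda_beta)
qed

text \<open>Cramer's rule: \<open>?C\<close> is \<open>A x\<close> with column \<open>i\<close>
  replaced by the \<open>j\<close>-th unit vector, so each entry of the inverse is a quotient of
  determinants of smooth matrices.\<close>

lemma Cinf_on_matrix_inv:
  fixes A :: "'a::euclidean_space \<Rightarrow> real ^ 'm::finite ^ 'm"
  assumes "open W" "\<And>i j. Cinf_on W (\<lambda>x. A x $ i $ j)" "\<And>x. x \<in> W \<Longrightarrow> det (A x) \<noteq> 0"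
  shows "Cinf_on W (\<lambda>x. matrix_inv (A x) $ i $ j)"
proof -
  let ?C = "\<lambda>x. \<chi> i' j'. if j' = i then axis j 1 $ i' else A x $ i' $ j'"
  have "matrix_inv (A x) $ i $ j = det (?C x) * inverse (det (A x))" if "x \<in> W" for x
  proof -
    have "A x *v (matrix_inv (A x) *v axis j 1) = axis j 1"
      by (simp add: matrix_vector_mul_assoc matrix_inv_inverse assms(3)[OF that])
    then have "(matrix_inv (A x) *v axis j 1) $ i = det (?C x) / det (A x)"
      using cramer[OF assms(3)[OF that]] by (simp add: vec_eq_iff)
    then show ?thesis
      by (simp add: matrix_vector_mult_def axis_def field_simps if_distrib cong: if_cong)
  qed
  moreover have "Cinf_on W (\<lambda>x. det (?C x) * inverse (det (A x)))"
  proof (intro Cinf_on_mult Cinf_on_inverse Cinf_on_det assms)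
    fix i' j' show "Cinf_on W (\<lambda>x. ?C x $ i' $ j')"
      using assms by (cases "j' = i") (auto intro: Cinf_on_const)
  qed auto
  ultimately show ?thesis
    using Cinf_on_cong[OF assms(1), of "\<lambda>x. matrix_inv (A x) $ i $ j" "\<lambda>x. det (?C x) * inverse (det (A x))"]
    by blast
qed

text \<open>The mean value theorem is used twice, along \<open>v\<close> on the difference
  \<open>?k\<close> and then along \<open>w\<close> on the derivative so obtained. The second
  difference is symmetric in \<open>v\<close> and \<open>w\<close>, which makes the two mixed
  derivatives comparable.\<close>

lemma second_difference_mean_value:
  fixes f :: "'a::euclidean_space \<Rightarrow> real"
  assumes f: "Cinf_on (ball z r) f" and s: "0 < s" "s * (norm v + norm w) < r"
  shows "\<exists>y\<in>ball z r. f (z + s *\<^sub>R v + s *\<^sub>R w) - f (z + s *\<^sub>R v) - f (z + s *\<^sub>R w) + f z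
      = s\<^sup>2 * frechet_derivative (\<lambda>y. frechet_derivative f (at y) v) (at y) w"
proof -
  have inb: "z + a *\<^sub>R v + b *\<^sub>R w \<in> ball z r" if "0 \<le> a" "a \<le> s" "0 \<le> b" "b \<le> s" for a b
  proof -
    have "norm (a *\<^sub>R v + b *\<^sub>R w) \<le> a * norm v + b * norm w"
      using norm_triangle_ineq[of "a *\<^sub>R v" "b *\<^sub>R w"] that by simp
    also have "\<dots> \<le> s * norm v + s * norm w"
      using that by (intro add_mono mult_right_mono) auto
    finally show ?thesis
      using s norm_minus_cancel[of "a *\<^sub>R v + b *\<^sub>R w"] by (simp add: dist_norm distrib_left)
  qed
  have line: "((\<lambda>\<tau>. h (p + \<tau> *\<^sub>R u)) has_real_derivative frechet_derivative h (at (p + \<tau> *\<^sub>R u)) u) (at \<tau>)"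
    if "Cinf_on (ball z r) h" "p + \<tau> *\<^sub>R u \<in> ball z r" for h :: "'a \<Rightarrow> real" and p u \<tau>
  proof -
    note d = Cinf_on_has_derivative[OF that]
    have "((\<lambda>\<tau>. p + \<tau> *\<^sub>R u) has_derivative (\<lambda>a. a *\<^sub>R u)) (at \<tau>)"
      by (auto intro!: derivative_eq_intros)
    from diff_chain_at[OF this d] have "((\<lambda>\<tau>. h (p + \<tau> *\<^sub>R u)) has_derivative
        (\<lambda>a. frechet_derivative h (at (p + \<tau> *\<^sub>R u)) (a *\<^sub>R u))) (at \<tau>)"
      by (simp add: o_def)
    then show ?thesis
      using linear_cmul[OF has_derivative_linear[OF d]]
      by (simp add: has_field_derivative_def mult.commute[of _ "frechet_derivative h _ u"])
  qed
  let ?fv = "\<lambda>y. frechet_derivative f (at y) v"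
  let ?k = "\<lambda>\<tau>. f (z + s *\<^sub>R w + \<tau> *\<^sub>R v) - f (z + \<tau> *\<^sub>R v)"
  have "(?k has_real_derivative (?fv (z + s *\<^sub>R w + \<tau> *\<^sub>R v) - ?fv (z + \<tau> *\<^sub>R v))) (at \<tau>)"
    if "0 \<le> \<tau>" "\<tau> \<le> s" for \<tau>
    using inb[of \<tau> s] inb[of \<tau> 0] that s by (intro DERIV_diff line f) (auto simp: algebra_simps)
  from MVT2[OF s(1) this] obtain \<tau> where \<tau>: "0 < \<tau>" "\<tau> < s"
    "?k s - ?k 0 = (s - 0) * (?fv (z + s *\<^sub>R w + \<tau> *\<^sub>R v) - ?fv (z + \<tau> *\<^sub>R v))"
    by blast
  have "((\<lambda>b. ?fv (z + \<tau> *\<^sub>R v + b *\<^sub>R w)) has_real_derivative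
      frechet_derivative ?fv (at (z + \<tau> *\<^sub>R v + b *\<^sub>R w)) w) (at b)" if "0 \<le> b" "b \<le> s" for b
    using inb[of \<tau> b] that \<tau> by (intro line Cinf_on_frechet f) auto
  from MVT2[OF s(1) this] obtain b where b: "0 < b" "b < s"
    "?fv (z + \<tau> *\<^sub>R v + s *\<^sub>R w) - ?fv (z + \<tau> *\<^sub>R v + 0 *\<^sub>R w)
      = (s - 0) * frechet_derivative ?fv (at (z + \<tau> *\<^sub>R v + b *\<^sub>R w)) w"
    by blast
  show ?thesis
    using \<tau> b inb[of \<tau> b]
    by (intro bexI[of _ "z + \<tau> *\<^sub>R v + b *\<^sub>R w"]) (auto simp: algebra_simps power2_eq_square)
qed

text \<open>Evaluating one second difference in both orders shows that the two mixed derivatives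
  share a value, taken at two points arbitrarily close to \<open>z\<close>; continuity does the
  rest.\<close>

lemma second_derivative_symmetric_real:
  fixes f :: "'a::euclidean_space \<Rightarrow> real"
  assumes "open W" "z \<in> W" "Cinf_on W f"
  shows "frechet_derivative (\<lambda>y. frechet_derivative f (at y) v) (at z) w
       = frechet_derivative (\<lambda>y. frechet_derivative f (at y) w) (at z) v" (is "?A z = ?B z")
proof (rule ccontr)
  assume ne: "?A z \<noteq> ?B z"
  have c: "continuous_on W ?A" "continuous_on W ?B"
    by (intro Cinf_on_continuous Cinf_on_frechet assms(3))+
  define d where "d = \<bar>?A z - ?B z\<bar> / 2"
  have "d > 0" using ne by (simp add: d_def)
  have "isCont ?A z" "isCont ?B z" using c assms by (simp_all add: continuous_on_eq_continuous_at)
  then obtain r1 r2 where r: "r1 > 0" "\<And>y. dist y z < r1 \<Longrightarrow> dist (?A y) (?A z) < d"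
    "r2 > 0" "\<And>y. dist y z < r2 \<Longrightarrow> dist (?B y) (?B z) < d"
    unfolding continuous_at_eps_delta using \<open>d > 0\<close> by metis
  obtain r3 where r3: "r3 > 0" "ball z r3 \<subseteq> W" using assms openE by blast
  define r where "r = min r3 (min r1 r2)"
  have "r > 0" using r r3 by (simp add: r_def)
  \<comment> \<open>The summand 1 keeps the quotient defined when both directions vanish and makes
    the bound strict.\<close>
  define s where "s = r / (norm v + norm w + 1)"
  have s: "0 < s" "s * (norm v + norm w) < r"
  proof -
    have "0 < norm v + norm w + 1" by (simp add: add_nonneg_pos)
    then show "0 < s" "s * (norm v + norm w) < r" using \<open>r > 0\<close>
      by (simp_all add: s_def pos_divide_less_eq field_simps)
  qed
  have f: "Cinf_on (ball z r) f"
    by (rule Cinf_on_subset[OF assms(3)]) (use r3 in \<open>auto simp: r_def\<close>)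
  obtain y where y: "y \<in> ball z r" "f (z + s *\<^sub>R v + s *\<^sub>R w) - f (z + s *\<^sub>R v) - f (z + s *\<^sub>R w) + f z
      = s\<^sup>2 * ?A y"
    using second_difference_mean_value[OF f s] by blast
  obtain y' where y': "y' \<in> ball z r" "f (z + s *\<^sub>R w + s *\<^sub>R v) - f (z + s *\<^sub>R w) - f (z + s *\<^sub>R v) + f z
      = s\<^sup>2 * ?B y'"
    using second_difference_mean_value[OF f s(1), of w v] s(2) by (auto simp: add.commute)
  have "s\<^sup>2 * ?A y = s\<^sup>2 * ?B y'"
    using y(2) y'(2) by (simp add: algebra_simps)
  then have "?A y = ?B y'" using s by simp
  moreover have "dist (?A y) (?A z) < d" "dist (?B y') (?B z) < d"
    using y y' by (auto intro!: r simp: r_def dist_commute)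
  ultimately show False unfolding d_def dist_real_def by (smt (verit) field_sum_of_halves)
qed

lemma second_derivative_symmetric:
  fixes f :: "'a::euclidean_space \<Rightarrow> 'b::euclidean_space"
  assumes "open W" "z \<in> W" "Cinf_on W f"
  shows "frechet_derivative (\<lambda>y. frechet_derivative f (at y) v) (at z) w
       = frechet_derivative (\<lambda>y. frechet_derivative f (at y) w) (at z) v"
proof (rule euclidean_eqI)
  fix b :: 'b
  have comp: "frechet_derivative (\<lambda>y. h y \<bullet> b) (at y) u = frechet_derivative h (at y) u \<bullet> b"
    if "Cinf_on W h" "y \<in> W" for h :: "'a \<Rightarrow> 'b" and y u
    by (intro frechet_derivative_eqI has_derivative_inner_left Cinf_on_has_derivative[OF that])
  have comp2: "frechet_derivative (\<lambda>y. frechet_derivative (\<lambda>y. f y \<bullet> b) (at y) u) (at z) u'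
      = frechet_derivative (\<lambda>y. frechet_derivative f (at y) u) (at z) u' \<bullet> b" for u u'
    by (subst frechet_derivative_cong_open[OF assms(1,2), of _ "\<lambda>y. frechet_derivative f (at y) u \<bullet> b"])
      (auto simp: comp assms Cinf_on_frechet)
  show "frechet_derivative (\<lambda>y. frechet_derivative f (at y) v) (at z) w \<bullet> b
       = frechet_derivative (\<lambda>y. frechet_derivative f (at y) w) (at z) v \<bullet> b"
    unfolding comp2[symmetric]
    by (intro second_derivative_symmetric_real[OF assms(1,2)] Cinf_on_inner assms Cinf_on_const)
qed

section \<open>Derivatives along vector fields\<close>

definition along :: "('a::euclidean_space \<Rightarrow> 'a) \<Rightarrow> ('a \<Rightarrow> 'b::real_normed_vector) \<Rightarrow> 'a \<Rightarrow> 'b" where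
  "along X f z = frechet_derivative f (at z) (X z)"

lemma along_cong:
  "open W \<Longrightarrow> z \<in> W \<Longrightarrow> (\<And>y. y \<in> W \<Longrightarrow> f y = g y) \<Longrightarrow> along X f z = along X g z"
  unfolding along_def by (metis frechet_derivative_cong_open)

lemma along_const [simp]: "along X (\<lambda>z. c) z = 0"
  by (simp add: along_def)

lemma Cinf_on_frechet_linear: "Cinf_on W f \<Longrightarrow> z \<in> W \<Longrightarrow> linear (frechet_derivative f (at z))"
  by (meson Cinf_on_differentiable linear_frechet_derivative)

lemma frechet_derivative_Basis:
  fixes f :: "'a::euclidean_space \<Rightarrow> 'b::euclidean_space"
  assumes "Cinf_on W f" "z \<in> W"
  shows "frechet_derivative f (at z) v = (\<Sum>b\<in>Basis. (v \<bullet> b) *\<^sub>R frechet_derivative f (at z) b)"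
proof -
  note l = Cinf_on_frechet_linear[OF assms]
  have "frechet_derivative f (at z) (\<Sum>b\<in>Basis. (v \<bullet> b) *\<^sub>R b) = (\<Sum>b\<in>Basis. (v \<bullet> b) *\<^sub>R frechet_derivative f (at z) b)"
    by (simp add: linear_sum[OF l] linear_cmul[OF l])
  then show ?thesis by (simp add: euclidean_representation)
qed

text \<open>\<open>Cinf_on\<close> controls derivatives in constant directions only; expanding the
  variable direction in the basis reduces to these.\<close>

lemma Cinf_on_along:
  assumes "open W" "Cinf_on W X" "Cinf_on W f"
  shows "Cinf_on W (along X f)"
proof -
  have "Cinf_on W (\<lambda>z. \<Sum>b\<in>Basis. (X z \<bullet> b) *\<^sub>R frechet_derivative f (at z) b)"
    by (intro Cinf_on_intros assms)
  then show ?thesis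
    by (subst Cinf_on_cong[OF assms(1)]) (auto simp: along_def frechet_derivative_Basis[OF assms(3), of _ "X _"])
qed

lemma along_add:
  "Cinf_on W f \<Longrightarrow> Cinf_on W g \<Longrightarrow> z \<in> W \<Longrightarrow> along X (\<lambda>z. f z + g z) z = along X f z + along X g z"
  unfolding along_def
  by (rule frechet_derivative_eqI[OF has_derivative_add[OF Cinf_on_has_derivative Cinf_on_has_derivative]])

lemma along_diff:
  "Cinf_on W f \<Longrightarrow> Cinf_on W g \<Longrightarrow> z \<in> W \<Longrightarrow> along X (\<lambda>z. f z - g z) z = along X f z - along X g z"
  unfolding along_def
  by (rule frechet_derivative_eqI[OF has_derivative_diff[OF Cinf_on_has_derivative Cinf_on_has_derivative]])

lemma along_sum:
  assumes "\<And>i. i \<in> I \<Longrightarrow> Cinf_on W (f i)" "z \<in> W"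
  shows "along X (\<lambda>z. \<Sum>i\<in>I. f i z) z = (\<Sum>i\<in>I. along X (f i) z)"
  unfolding along_def
  by (rule frechet_derivative_eqI[OF has_derivative_sum]) (rule Cinf_on_has_derivative[OF assms])

lemma along_bilinear:
  assumes "bounded_bilinear B" "Cinf_on W f" "Cinf_on W g" "z \<in> W"
  shows "along X (\<lambda>z. B (f z) (g z)) z = B (along X f z) (g z) + B (f z) (along X g z)"
  unfolding along_def
  by (intro frechet_derivative_bilinear assms(1) Cinf_on_differentiable[OF _ assms(4)] assms(2,3))

lemmas along_inner = along_bilinear[OF bounded_bilinear_inner]
lemmas along_scaleR = along_bilinear[OF bounded_bilinear_scaleR]

lemma along_mult:
  fixes f :: "'a::euclidean_space \<Rightarrow> real"
  shows "Cinf_on W f \<Longrightarrow> Cinf_on W g \<Longrightarrow> z \<in> W \<Longrightarrow>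
    along X (\<lambda>z. f z * g z) z = along X f z * g z + f z * along X g z"
  using along_scaleR[of W f g z X] by simp

lemma along2_diff:
  assumes "open W" "Cinf_on W X" "Cinf_on W f" "Cinf_on W g" "z \<in> W"
  shows "along Y (along X (\<lambda>z. f z - g z)) z = along Y (along X f) z - along Y (along X g) z"
proof -
  have "along Y (along X (\<lambda>z. f z - g z)) z = along Y (\<lambda>z. along X f z - along X g z) z"
    by (intro along_cong[OF assms(1,5)] along_diff[OF assms(3,4)])
  also have "\<dots> = along Y (along X f) z - along Y (along X g) z"
    by (intro along_diff[OF _ _ assms(5)] Cinf_on_along assms)
  finally show ?thesis .
qed

lemma along2_sum:
  assumes "open W" "Cinf_on W X" "\<And>i. i \<in> I \<Longrightarrow> Cinf_on W (f i)" "z \<in> W"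
  shows "along Y (along X (\<lambda>z. \<Sum>i\<in>I. f i z)) z = (\<Sum>i\<in>I. along Y (along X (f i)) z)"
proof -
  have "along Y (along X (\<lambda>z. \<Sum>i\<in>I. f i z)) z = along Y (\<lambda>z. \<Sum>i\<in>I. along X (f i) z) z"
    by (intro along_cong[OF assms(1,4)] along_sum[OF assms(3)])
  also have "\<dots> = (\<Sum>i\<in>I. along Y (along X (f i)) z)"
    by (intro along_sum[OF _ assms(4)] Cinf_on_along assms)
  finally show ?thesis .
qed

lemma along2_bilinear:
  fixes B :: "'b::euclidean_space \<Rightarrow> 'c::euclidean_space \<Rightarrow> 'd::euclidean_space"
  assumes "bounded_bilinear B" "open W" "Cinf_on W X" "Cinf_on W f" "Cinf_on W g" "z \<in> W"
  shows "along Y (along X (\<lambda>z. B (f z) (g z))) z = B (along Y (along X f) z) (g z)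
    + B (along X f z) (along Y g z) + B (along Y f z) (along X g z) + B (f z) (along Y (along X g) z)"
proof -
  have "along Y (along X (\<lambda>z. B (f z) (g z))) z = along Y (\<lambda>z. B (along X f z) (g z) + B (f z) (along X g z)) z"
    by (intro along_cong[OF assms(2,6)] along_bilinear[OF assms(1,4,5)])
  also have "\<dots> = along Y (\<lambda>z. B (along X f z) (g z)) z + along Y (\<lambda>z. B (f z) (along X g z)) z"
    by (intro along_add[OF _ _ assms(6)] Cinf_on_bilinear[OF assms(2,1)] Cinf_on_along assms)
  also have "along Y (\<lambda>z. B (along X f z) (g z)) z = B (along Y (along X f) z) (g z) + B (along X f z) (along Y g z)"
    by (intro along_bilinear[OF assms(1) _ _ assms(6)] Cinf_on_along assms)
  also have "along Y (\<lambda>z. B (f z) (along X g z)) z = B (along Y f z) (along X g z) + B (f z) (along Y (along X g) z)"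
    by (intro along_bilinear[OF assms(1) _ _ assms(6)] Cinf_on_along assms)
  finally show ?thesis by (simp add: add.assoc)
qed

lemmas along2_inner = along2_bilinear[OF bounded_bilinear_inner]
lemmas along2_scaleR = along2_bilinear[OF bounded_bilinear_scaleR]

lemma along2_mult:
  fixes f :: "'a::euclidean_space \<Rightarrow> real"
  shows "open W \<Longrightarrow> Cinf_on W X \<Longrightarrow> Cinf_on W f \<Longrightarrow> Cinf_on W g \<Longrightarrow> z \<in> W \<Longrightarrow>
    along Y (along X (\<lambda>z. f z * g z)) z = along Y (along X f) z * g z
    + along X f z * along Y g z + along Y f z * along X g z + f z * along Y (along X g) z"
  using along2_scaleR[of W X f g z Y] by simp

text \<open>Product rule for a derivative whose direction also varies, by expanding the direction in
  the basis. The first summand is symmetric under exchange of the fields, the second one produces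
  the Lie bracket.\<close>

lemma along_along:
  assumes "open W" "Cinf_on W X" "Cinf_on W Y" "Cinf_on W f" "z \<in> W"
  shows "along X (along Y f) z = frechet_derivative (\<lambda>y. frechet_derivative f (at y) (Y z)) (at z) (X z)
      + frechet_derivative f (at z) (along X Y z)"
proof -
  let ?D = "\<lambda>b y. frechet_derivative f (at y) b"
  have exp: "along X (\<lambda>y. ?D (V y) y) z = (\<Sum>b\<in>Basis. (along X V z \<bullet> b) *\<^sub>R ?D b z) + (\<Sum>b\<in>Basis. (V z \<bullet> b) *\<^sub>R along X (?D b) z)"
    if V: "Cinf_on W V" for V
  proof -
    have "along X (\<lambda>y. ?D (V y) y) z = along X (\<lambda>y. \<Sum>b\<in>Basis. (V y \<bullet> b) *\<^sub>R ?D b y) z"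
      by (intro along_cong[OF assms(1,5)] frechet_derivative_Basis[OF assms(4)])
    also have "\<dots> = (\<Sum>b\<in>Basis. along X (\<lambda>y. (V y \<bullet> b) *\<^sub>R ?D b y) z)"
      by (intro along_sum[OF _ assms(5)] Cinf_on_intros assms V)
    also have "\<dots> = (\<Sum>b\<in>Basis. (along X V z \<bullet> b) *\<^sub>R ?D b z + (V z \<bullet> b) *\<^sub>R along X (?D b) z)"
    proof (rule sum.cong[OF refl])
      fix b :: 'a
      have "along X (\<lambda>y. (V y \<bullet> b) *\<^sub>R ?D b y) z
          = along X (\<lambda>y. V y \<bullet> b) z *\<^sub>R ?D b z + (V z \<bullet> b) *\<^sub>R along X (?D b) z"
        by (intro along_scaleR[OF _ _ assms(5)] Cinf_on_intros assms V)
      moreover have "along X (\<lambda>y. V y \<bullet> b) z = along X V z \<bullet> b"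
        using along_inner[OF V Cinf_on_const assms(5), of X b] by simp
      ultimately show "along X (\<lambda>y. (V y \<bullet> b) *\<^sub>R ?D b y) z = (along X V z \<bullet> b) *\<^sub>R ?D b z + (V z \<bullet> b) *\<^sub>R along X (?D b) z"
        by simp
    qed
    finally show ?thesis by (simp add: sum.distrib)
  qed
  have "along X (along Y f) z = along X (\<lambda>y. ?D (Y y) y) z"
    by (simp add: along_def[abs_def])
  moreover have "along X (\<lambda>y. ?D (Y z) y) z = (\<Sum>b\<in>Basis. (Y z \<bullet> b) *\<^sub>R along X (?D b) z)"
    using exp[OF Cinf_on_const, of "Y z"] by simp
  moreover have "along X (\<lambda>y. ?D (Y z) y) z = frechet_derivative (?D (Y z)) (at z) (X z)"
    by (simp add: along_def)
  ultimately show ?thesis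
    using exp[OF assms(3)] frechet_derivative_Basis[OF assms(4,5), of "along X Y z"] by simp
qed

lemma along_commutator:
  assumes "open W" "Cinf_on W X" "Cinf_on W Y" "Cinf_on W f" "z \<in> W"
  shows "along X (along Y f) z - along Y (along X f) z
      = frechet_derivative f (at z) (along X Y z - along Y X z)"
  using along_along[OF assms] along_along[OF assms(1,3,2,4,5)]
    second_derivative_symmetric[OF assms(1,5,4), of "Y z" "X z"]
    linear_diff[OF Cinf_on_frechet_linear[OF assms(4,5)]]
  by simp

section \<open>The evolution of the normal curvature in a commuting frame\<close>

text \<open>In these definitions \<open>h\<close> stands for the inverse of the Gram matrix of the frame \<open>X\<close> under \<open>G\<close>, so that
  \<open>frame_nor\<close> is the normal projection and \<open>frame_curv\<close> the normal curvature expressed by the Ricci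
  equation.\<close>

definition frame_nor ::
    "('m::finite \<Rightarrow> 'z::euclidean_space \<Rightarrow> 'z) \<Rightarrow> ('z \<Rightarrow> 'v::euclidean_space) \<Rightarrow> ('m \<Rightarrow> 'm \<Rightarrow> 'z \<Rightarrow> real) \<Rightarrow> 'v \<Rightarrow> 'z \<Rightarrow> 'v" where
  "frame_nor X G h \<nu> z = \<nu> - (\<Sum>k\<in>UNIV. \<Sum>l\<in>UNIV. h k l z *\<^sub>R ((along (X k) G z \<bullet> \<nu>) *\<^sub>R along (X l) G z))"

definition frame_sff ::
    "('m::finite \<Rightarrow> 'z::euclidean_space \<Rightarrow> 'z) \<Rightarrow> ('z \<Rightarrow> 'v::euclidean_space) \<Rightarrow> ('m \<Rightarrow> 'm \<Rightarrow> 'z \<Rightarrow> real) \<Rightarrow> 'v \<Rightarrow> 'm \<Rightarrow> 'm \<Rightarrow> 'z \<Rightarrow> real" where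
  "frame_sff X G h \<nu> i j z = along (X i) (along (X j) G) z \<bullet> frame_nor X G h \<nu> z"

definition frame_curv ::
    "('m::finite \<Rightarrow> 'z::euclidean_space \<Rightarrow> 'z) \<Rightarrow> ('z \<Rightarrow> 'v::euclidean_space) \<Rightarrow> ('m \<Rightarrow> 'm \<Rightarrow> 'z \<Rightarrow> real) \<Rightarrow> 'v \<Rightarrow> 'v \<Rightarrow> 'm \<Rightarrow> 'm \<Rightarrow> 'z \<Rightarrow> real" where
  "frame_curv X G h \<nu> \<xi> i j z = (\<Sum>k\<in>UNIV. \<Sum>l\<in>UNIV. h k l z *
     (frame_sff X G h \<nu> i k z * frame_sff X G h \<xi> l j z - frame_sff X G h \<xi> i k z * frame_sff X G h \<nu> l j z))"

lemma sum_delta_mult: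
  fixes f :: "'m::finite \<Rightarrow> real"
  shows "(\<Sum>l\<in>UNIV. (if k = l then 1 else 0) * f l) = f k"
    "(\<Sum>l\<in>UNIV. f l * (if l = k then 1 else 0)) = f k"
  by (simp_all add: if_distrib[of "\<lambda>x. x * _"] if_distrib[of "\<lambda>x. _ * x"] cong: if_cong)

lemma sum_delta_scaleR:
  fixes f :: "'m::finite \<Rightarrow> 'b::real_vector"
  shows "(\<Sum>l\<in>UNIV. (if k = l then 1 else 0) *\<^sub>R f l) = f k"
  by (simp add: if_distrib[of "\<lambda>x. x *\<^sub>R _"] cong: if_cong)

text \<open>\<open>S\<close> is the initial time slice and \<open>T\<close> the time direction. The assumption \<open>graph\<close> says that \<open>X\<close> is the
  coordinate frame of the graph representation over the tangent plane at \<open>p\<close>.\<close>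

locale flowing_frame =
  fixes W S :: "'z::euclidean_space set" and p :: 'z
    and X :: "'m::finite \<Rightarrow> 'z \<Rightarrow> 'z" and T :: "'z \<Rightarrow> 'z"
    and G :: "'z \<Rightarrow> 'v::euclidean_space" and h :: "'m \<Rightarrow> 'm \<Rightarrow> 'z \<Rightarrow> real"
  assumes openW: "open W" and SW: "S \<subseteq> W" and pS: "p \<in> S"
    and X: "\<And>i. Cinf_on W (X i)" and T: "Cinf_on W T"
    and G: "Cinf_on W G" and h: "\<And>k l. Cinf_on W (h k l)"
    and comm: "\<And>f :: 'z \<Rightarrow> 'v. \<And>i j z. Cinf_on W f \<Longrightarrow> z \<in> W \<Longrightarrow>
          along (X i) (along (X j) f) z = along (X j) (along (X i) f) z"
    and commT: "\<And>f :: 'z \<Rightarrow> 'v. \<And>i z. Cinf_on W f \<Longrightarrow> z \<in> W \<Longrightarrow>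
          along T (along (X i) f) z = along (X i) (along T f) z"
    and slice: "\<And>f :: 'z \<Rightarrow> real. \<And>i z. Cinf_on W f \<Longrightarrow> (\<And>y. y \<in> S \<Longrightarrow> f y = 0) \<Longrightarrow> z \<in> S \<Longrightarrow> along (X i) f z = 0"
    and inv: "\<And>k j z. z \<in> W \<Longrightarrow>
          (\<Sum>l\<in>UNIV. h k l z * (along (X l) G z \<bullet> along (X j) G z)) = (if k = j then 1 else 0)"
    and sym: "\<And>k l z. z \<in> W \<Longrightarrow> h k l z = h l k z"
    and graph: "\<And>i j z. z \<in> S \<Longrightarrow> along (X i) G z \<bullet> along (X j) G p = (if i = j then 1 else 0)"
    and mcf: "\<And>\<nu> z. z \<in> S \<Longrightarrow>
          along T G z \<bullet> \<nu> = (\<Sum>k\<in>UNIV. \<Sum>l\<in>UNIV. h k l z * frame_sff X G h \<nu> k l z)"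
    and flat: "\<And>\<nu> \<xi> i j z. z \<in> S \<Longrightarrow> frame_curv X G h \<nu> \<xi> i j z = 0"
begin

section \<open>Frame derivatives at the base point\<close>

definition "P i = along (X i) G"
definition "Q i j = along (X i) (P j)"
abbreviation "nn \<equiv> frame_nor X G h"
abbreviation "a \<equiv> frame_sff X G h"
abbreviation "E \<equiv> frame_curv X G h"

lemma pW: "p \<in> W" using SW pS by auto

lemma P: "Cinf_on W (P i)"
  unfolding P_def by (intro Cinf_on_along openW X G)

lemma Q: "Cinf_on W (Q i j)"
  unfolding Q_def by (intro Cinf_on_along openW X P)

lemma nn_eq: "nn \<nu> = (\<lambda>z. \<nu> - (\<Sum>k\<in>UNIV. \<Sum>l\<in>UNIV. h k l z *\<^sub>R ((P k z \<bullet> \<nu>) *\<^sub>R P l z)))"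
  by (simp add: fun_eq_iff frame_nor_def P_def)

lemma nn: "Cinf_on W (nn \<nu>)"
  unfolding nn_eq by (intro Cinf_on_intros openW h P)

lemma a_eq: "a \<nu> i j = (\<lambda>z. Q i j z \<bullet> nn \<nu> z)"
  by (simp add: fun_eq_iff frame_sff_def P_def Q_def)

lemma a: "Cinf_on W (a \<nu> i j)"
  unfolding a_eq by (intro Cinf_on_intros openW Q nn)

text \<open>The fields \<open>X i\<close> act as tangent to \<open>S\<close>, so identities on
  \<open>S\<close> may be differentiated along them. The flow equation and \<open>graph\<close>,
  which are assumed on \<open>S\<close> alone, are differentiated in this way.\<close>

lemma slice_eq:
  fixes f g :: "'z \<Rightarrow> real"
  assumes "Cinf_on W f" "Cinf_on W g" "\<And>y. y \<in> S \<Longrightarrow> f y = g y" "z \<in> S"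
  shows "along (X i) f z = along (X i) g z"
proof -
  have "along (X i) (\<lambda>y. f y - g y) z = 0"
    by (rule slice) (use assms in \<open>auto intro: Cinf_on_diff openW\<close>)
  then show ?thesis
    using along_diff[OF assms(1,2), of z "X i"] assms(4) SW by auto
qed

lemma graph': "z \<in> S \<Longrightarrow> P i z \<bullet> P j p = (if i = j then 1 else 0)"
  using graph by (simp add: P_def)

lemma along_inner_const:
  "Cinf_on W f \<Longrightarrow> z \<in> W \<Longrightarrow> along Y (\<lambda>z. f z \<bullet> c) z = along Y f z \<bullet> c"
  using along_inner[OF _ Cinf_on_const, of W f z Y c] by simp

lemma along2_inner_const:
  "Cinf_on W f \<Longrightarrow> Cinf_on W Z \<Longrightarrow> z \<in> W \<Longrightarrow> along Y (along Z (\<lambda>z. f z \<bullet> c)) z = along Y (along Z f) z \<bullet> c"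
  using along2_inner[OF openW _ _ Cinf_on_const, of Z f z Y c]
  by (simp add: along_def[abs_def])

text \<open>By \<open>graph\<close> the pairing \<open>P j z \<bullet> P m p\<close> is constant on
  \<open>S\<close>. The reference vector \<open>P m p\<close> stays fixed while \<open>z\<close>
  varies, so one more derivative is again orthogonal to it (\<open>XQ_normal\<close>).\<close>

lemma Q_normal: "z \<in> S \<Longrightarrow> Q i j z \<bullet> P m p = 0"
  using slice_eq[of "\<lambda>z. P j z \<bullet> P m p" "\<lambda>z. if j = m then 1 else 0" z i] graph' SW
  by (auto simp: Q_def along_inner_const P Cinf_on_inner Cinf_on_const openW subset_iff)

lemma XQ_normal: "along (X k) (Q i j) p \<bullet> P m p = 0"
  using slice_eq[of "\<lambda>z. Q i j z \<bullet> P m p" "\<lambda>z. 0" p k] Q_normal pS pW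
  by (auto simp: along_inner_const Q Cinf_on_inner Cinf_on_const openW)

lemma Q_sym: "z \<in> W \<Longrightarrow> Q i j z = Q j i z"
  unfolding Q_def P_def using comm[OF G] by blast

lemma inv': "z \<in> W \<Longrightarrow> (\<Sum>l\<in>UNIV. h k l z * (P l z \<bullet> P j z)) = (if k = j then 1 else 0)"
  using inv by (simp add: P_def)

lemma h_p: "h k l p = (if k = l then 1 else 0)"
  using inv'[OF pW, of k l] by (simp add: graph'[OF pS] sum_delta_mult)

text \<open>Differentiates the relation between \<open>h\<close> and the Gram matrix at
  \<open>p\<close>, where both are the identity. It serves for the frame directions and for
  time.\<close>

lemma Z_h:
  assumes "Cinf_on W Z"
  shows "along Z (h k j) p = - (along Z (P k) p \<bullet> P j p + P k p \<bullet> along Z (P j) p)"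
proof -
  have "along Z (\<lambda>z. \<Sum>l\<in>UNIV. h k l z * (P l z \<bullet> P j z)) p = along Z (\<lambda>z. if k = j then 1 else 0) p"
    by (rule along_cong[OF openW pW inv'])
  also have "\<dots> = 0" by simp
  also have "along Z (\<lambda>z. \<Sum>l\<in>UNIV. h k l z * (P l z \<bullet> P j z)) p
      = (\<Sum>l\<in>UNIV. along Z (\<lambda>z. h k l z * (P l z \<bullet> P j z)) p)"
    by (intro along_sum[OF _ pW] Cinf_on_intros openW h P)
  also have "\<dots> = (\<Sum>l\<in>UNIV. along Z (h k l) p * (P l p \<bullet> P j p)
      + h k l p * (along Z (P l) p \<bullet> P j p + P l p \<bullet> along Z (P j) p))"
    by (intro sum.cong refl, subst along_mult[OF h _ pW])
      (auto intro!: Cinf_on_intros openW P simp: along_inner[OF P P pW])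
  also have "\<dots> = along Z (h k j) p + (along Z (P k) p \<bullet> P j p + P k p \<bullet> along Z (P j) p)"
    by (simp add: graph'[OF pS] h_p sum.distrib sum_delta_mult)
  finally show ?thesis by simp
qed

lemma X_h: "along (X q) (h k j) p = 0"
  using Z_h[OF X, of q k j] Q_normal[OF pS] by (simp add: Q_def[symmetric] inner_commute)

text \<open>The first frame derivatives of \<open>h\<close> and of the Gram matrix vanish at
  \<open>p\<close>, and second derivatives of \<open>P\<close> are normal there; after two
  differentiations only products of first derivatives of \<open>P\<close> survive.\<close>

lemma XX_h: "along (X q) (along (X r) (h k j)) p = - (Q q k p \<bullet> Q r j p + Q r k p \<bullet> Q q j p)"
proof -
  have XP: "along (X i) (P k) = Q i k" for i k by (simp add: Q_def)
  have g0: "along (X i) (\<lambda>z. P l z \<bullet> P j z) p = 0" for i l j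
    by (simp add: along_inner[OF P P pW] XP Q_normal[OF pS] inner_commute[of "P l p"])
  have g2: "along (X q) (along (X r) (\<lambda>z. P l z \<bullet> P j z)) p = Q q l p \<bullet> Q r j p + Q r l p \<bullet> Q q j p" for l
    by (simp add: along2_inner[OF openW X P P pW] XP XQ_normal inner_commute[of "P l p"])
  have "along (X q) (along (X r) (\<lambda>z. \<Sum>l\<in>UNIV. h k l z * (P l z \<bullet> P j z))) p = along (X q) (along (X r) (\<lambda>z. if k = j then 1 else 0)) p"
    by (intro along_cong[OF openW pW] along_cong[OF openW _ inv'])
  also have "\<dots> = 0" by (simp add: along_def[abs_def])
  also have "along (X q) (along (X r) (\<lambda>z. \<Sum>l\<in>UNIV. h k l z * (P l z \<bullet> P j z))) p
      = (\<Sum>l\<in>UNIV. along (X q) (along (X r) (\<lambda>z. h k l z * (P l z \<bullet> P j z))) p)"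
    by (intro along2_sum[OF openW X _ pW] Cinf_on_intros openW h P)
  also have "\<dots> = (\<Sum>l\<in>UNIV. along (X q) (along (X r) (h k l)) p * (P l p \<bullet> P j p)
      + h k l p * (Q q l p \<bullet> Q r j p + Q r l p \<bullet> Q q j p))"
    by (intro sum.cong refl, subst along2_mult[OF openW X h _ pW])
      (auto intro!: Cinf_on_intros openW P simp: X_h g0 g2)
  also have "\<dots> = along (X q) (along (X r) (h k j)) p + (Q q k p \<bullet> Q r j p + Q r k p \<bullet> Q q j p)"
    by (simp add: graph'[OF pS] h_p sum.distrib sum_delta_mult)
  finally show ?thesis by simp
qed

section \<open>Contractions with the inverse Gram matrix, differentiated at the base point\<close>

lemma contraction_p:
  fixes u :: "'m \<Rightarrow> 'm \<Rightarrow> 'z \<Rightarrow> 'b::euclidean_space"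
  shows "(\<Sum>k\<in>UNIV. \<Sum>l\<in>UNIV. h k l p *\<^sub>R u k l p) = (\<Sum>k\<in>UNIV. u k k p)"
  by (simp add: h_p sum_delta_scaleR)

lemma Z_contraction:
  fixes u :: "'m \<Rightarrow> 'm \<Rightarrow> 'z \<Rightarrow> 'b::euclidean_space"
  assumes u: "\<And>k l. Cinf_on W (u k l)"
  shows "along Z (\<lambda>z. \<Sum>k\<in>UNIV. \<Sum>l\<in>UNIV. h k l z *\<^sub>R u k l z) p
     = (\<Sum>k\<in>UNIV. \<Sum>l\<in>UNIV. along Z (h k l) p *\<^sub>R u k l p) + (\<Sum>k\<in>UNIV. along Z (u k k) p)"
proof -
  have "along Z (\<lambda>z. \<Sum>k\<in>UNIV. \<Sum>l\<in>UNIV. h k l z *\<^sub>R u k l z) p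
     = (\<Sum>k\<in>UNIV. along Z (\<lambda>z. \<Sum>l\<in>UNIV. h k l z *\<^sub>R u k l z) p)"
    by (intro along_sum[OF _ pW] Cinf_on_intros openW h u)
  also have "\<dots> = (\<Sum>k\<in>UNIV. \<Sum>l\<in>UNIV. along Z (\<lambda>z. h k l z *\<^sub>R u k l z) p)"
    by (intro sum.cong refl along_sum[OF _ pW] Cinf_on_intros openW h u)
  finally show ?thesis
    by (simp add: along_scaleR[OF h u pW] sum.distrib h_p sum_delta_scaleR)
qed

text \<open>Mixed terms are absent by \<open>X_h\<close>; the terms quadratic in \<open>Q\<close>
  are the second derivatives of \<open>h\<close>.\<close>

lemma XX_contraction:
  fixes u :: "'m \<Rightarrow> 'm \<Rightarrow> 'z \<Rightarrow> 'b::euclidean_space"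
  assumes u: "\<And>k l. Cinf_on W (u k l)"
  shows "along (X q) (along (X r) (\<lambda>z. \<Sum>k\<in>UNIV. \<Sum>l\<in>UNIV. h k l z *\<^sub>R u k l z)) p
     = - (\<Sum>k\<in>UNIV. \<Sum>l\<in>UNIV. (Q q k p \<bullet> Q r l p + Q r k p \<bullet> Q q l p) *\<^sub>R u k l p)
       + (\<Sum>k\<in>UNIV. along (X q) (along (X r) (u k k)) p)"
proof -
  have "along (X q) (along (X r) (\<lambda>z. \<Sum>k\<in>UNIV. \<Sum>l\<in>UNIV. h k l z *\<^sub>R u k l z)) p
     = (\<Sum>k\<in>UNIV. along (X q) (along (X r) (\<lambda>z. \<Sum>l\<in>UNIV. h k l z *\<^sub>R u k l z)) p)"
    by (intro along2_sum[OF openW X _ pW] Cinf_on_intros openW h u)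
  also have "\<dots> = (\<Sum>k\<in>UNIV. \<Sum>l\<in>UNIV. along (X q) (along (X r) (\<lambda>z. h k l z *\<^sub>R u k l z)) p)"
    by (intro sum.cong refl along2_sum[OF openW X _ pW] Cinf_on_intros openW h u)
  finally show ?thesis
    by (simp add: along2_scaleR[OF openW X h u pW] X_h XX_h sum.distrib h_p sum_delta_scaleR sum_subtractf
        del: minus_add_distrib)
qed

lemma nn_p: "nn \<nu> p = \<nu> - (\<Sum>k\<in>UNIV. (P k p \<bullet> \<nu>) *\<^sub>R P k p)"
  unfolding nn_eq using contraction_p[of "\<lambda>k l z. (P k z \<bullet> \<nu>) *\<^sub>R P l z"] by simp

text \<open>Terms in which \<open>P k z \<bullet> \<nu>\<close> stays undifferentiated vanish at
  \<open>p\<close>. What is left is tangential, which is why a constant vector can replace a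
  parallel normal field.\<close>

lemma Z_nn:
  assumes "\<And>k. P k p \<bullet> \<nu> = 0"
  shows "along Z (nn \<nu>) p = - (\<Sum>k\<in>UNIV. (along Z (P k) p \<bullet> \<nu>) *\<^sub>R P k p)"
proof -
  have u: "Cinf_on W (\<lambda>z. (P k z \<bullet> \<nu>) *\<^sub>R P l z)" for k l
    by (intro Cinf_on_intros openW P)
  have "along Z (nn \<nu>) p = - along Z (\<lambda>z. \<Sum>k\<in>UNIV. \<Sum>l\<in>UNIV. h k l z *\<^sub>R ((P k z \<bullet> \<nu>) *\<^sub>R P l z)) p"
    unfolding nn_eq by (subst along_diff[OF _ _ pW]) (auto intro!: Cinf_on_intros openW P h)
  also have "\<dots> = - (\<Sum>k\<in>UNIV. along Z (\<lambda>z. (P k z \<bullet> \<nu>) *\<^sub>R P k z) p)"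
    unfolding Z_contraction[OF u] by (simp add: assms)
  finally have 1: "along Z (nn \<nu>) p = - (\<Sum>k\<in>UNIV. along Z (\<lambda>z. (P k z \<bullet> \<nu>) *\<^sub>R P k z) p)" .
  have 2: "along Z (\<lambda>z. (P k z \<bullet> \<nu>) *\<^sub>R P k z) p = (along Z (P k) p \<bullet> \<nu>) *\<^sub>R P k p" for k
    by (subst along_scaleR[OF _ P pW]) (auto intro!: Cinf_on_intros openW P simp: along_inner_const P pW assms)
  show ?thesis unfolding 1 2 ..
qed

lemma XX_nn:
  assumes "\<And>k. P k p \<bullet> \<nu> = 0"
  shows "along (X q) (along (X r) (nn \<nu>)) p = - (\<Sum>k\<in>UNIV. (along (X q) (Q r k) p \<bullet> \<nu>) *\<^sub>R P k p
     + (Q r k p \<bullet> \<nu>) *\<^sub>R Q q k p + (Q q k p \<bullet> \<nu>) *\<^sub>R Q r k p)"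
proof -
  have u: "Cinf_on W (\<lambda>z. (P k z \<bullet> \<nu>) *\<^sub>R P l z)" for k l
    by (intro Cinf_on_intros openW P)
  have "along (X q) (along (X r) (nn \<nu>)) p = - along (X q) (along (X r) (\<lambda>z. \<Sum>k\<in>UNIV. \<Sum>l\<in>UNIV. h k l z *\<^sub>R ((P k z \<bullet> \<nu>) *\<^sub>R P l z))) p"
    unfolding nn_eq by (subst along2_diff[OF openW X _ _ pW]) (auto intro!: Cinf_on_intros openW P h simp: along_def[abs_def])
  also have "\<dots> = - (\<Sum>k\<in>UNIV. along (X q) (along (X r) (\<lambda>z. (P k z \<bullet> \<nu>) *\<^sub>R P k z)) p)"
    unfolding XX_contraction[OF u] by (simp add: assms)
  finally have 1: "along (X q) (along (X r) (nn \<nu>)) p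
      = - (\<Sum>k\<in>UNIV. along (X q) (along (X r) (\<lambda>z. (P k z \<bullet> \<nu>) *\<^sub>R P k z)) p)" .
  have 2: "along (X q) (along (X r) (\<lambda>z. (P k z \<bullet> \<nu>) *\<^sub>R P k z)) p = (along (X q) (Q r k) p \<bullet> \<nu>) *\<^sub>R P k p
     + (Q r k p \<bullet> \<nu>) *\<^sub>R Q q k p + (Q q k p \<bullet> \<nu>) *\<^sub>R Q r k p" for k
    by (subst along2_scaleR[OF openW X _ P pW])
      (auto intro!: Cinf_on_intros openW P simp: along_inner_const along2_inner_const P X pW assms Q_def[symmetric])
  show ?thesis unfolding 1 2 ..
qed

lemma a_p: "a \<nu> i j p = Q i j p \<bullet> \<nu>"
  by (simp add: a_eq nn_p inner_diff_right inner_sum_right Q_normal[OF pS])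

lemma Z_a:
  assumes "\<And>k. P k p \<bullet> \<nu> = 0"
  shows "along Z (a \<nu> i j) p = along Z (Q i j) p \<bullet> \<nu>"
  unfolding a_eq along_inner[OF Q nn pW] Z_nn[OF assms]
  by (simp add: nn_p assms inner_sum_right Q_normal[OF pS])

text \<open>The mixed terms pair the normal vectors \<open>along (X k) (Q i j) p\<close> with
  tangential derivatives of \<open>nn \<nu>\<close> and vanish. The correction is the normal part of
  the second derivative of the projection.\<close>

lemma XX_a:
  assumes "\<And>k. P k p \<bullet> \<nu> = 0"
  shows "along (X q) (along (X r) (a \<nu> i j)) p = along (X q) (along (X r) (Q i j)) p \<bullet> \<nu>
     - (\<Sum>k\<in>UNIV. (Q r k p \<bullet> \<nu>) * (Q i j p \<bullet> Q q k p) + (Q q k p \<bullet> \<nu>) * (Q i j p \<bullet> Q r k p))"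
  unfolding a_eq along2_inner[OF openW X Q nn pW] Z_nn[OF assms] XX_nn[OF assms]
  by (simp add: nn_p assms inner_sum_right inner_add_right Q_normal[OF pS] XQ_normal)

section \<open>Evolution at the initial time\<close>

lemma mcf': "z \<in> S \<Longrightarrow> along T G z \<bullet> \<nu> = (\<Sum>k\<in>UNIV. \<Sum>l\<in>UNIV. h k l z *\<^sub>R a \<nu> k l z)"
  using mcf by simp

lemma TG: "Cinf_on W (along T G)"
  by (intro Cinf_on_along openW T G)

lemma TG_p: "along T G p \<bullet> \<nu> = (\<Sum>k\<in>UNIV. Q k k p \<bullet> \<nu>)"
  using mcf'[OF pS, of \<nu>] contraction_p[of "a \<nu>"] by (simp add: a_p)

text \<open>For a frame vector in place of \<nu> the right side of the flow equation is zero,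
  because \<open>nn\<close> projects that vector to zero.\<close>

lemma TG_normal: "z \<in> S \<Longrightarrow> along T G z \<bullet> P j z = 0"
proof -
  assume z: "z \<in> S"
  then have zW: "z \<in> W" using SW by auto
  have "(\<Sum>k\<in>UNIV. \<Sum>l\<in>UNIV. h k l z *\<^sub>R ((P k z \<bullet> P j z) *\<^sub>R P l z))
      = (\<Sum>l\<in>UNIV. (\<Sum>k\<in>UNIV. h l k z * (P k z \<bullet> P j z)) *\<^sub>R P l z)"
    by (subst sum.swap) (simp add: scaleR_sum_left sym[OF zW])
  also have "\<dots> = P j z"
    by (simp add: inv'[OF zW] eq_commute[of _ j] sum_delta_scaleR)
  finally have "nn (P j z) z = 0" by (simp add: nn_eq)
  then show ?thesis using mcf'[OF z, of "P j z"] by (simp add: a_eq)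
qed

lemma T_P: "z \<in> W \<Longrightarrow> along T (P i) z = along (X i) (along T G) z"
  unfolding P_def by (rule commT[OF G])

lemma T_Q: "z \<in> W \<Longrightarrow> along T (Q i j) z = along (X i) (along (X j) (along T G)) z"
proof -
  assume z: "z \<in> W"
  have "along T (Q i j) z = along (X i) (along T (P j)) z"
    unfolding Q_def by (rule commT[OF P z])
  also have "\<dots> = along (X i) (along (X j) (along T G)) z"
    by (rule along_cong[OF openW z T_P])
  finally show ?thesis .
qed

text \<open>Differentiating \<open>TG_normal\<close> along the frame moves the derivative from the
  velocity to \<open>P l\<close>, and the velocity at \<open>p\<close> is the trace of
  \<open>Q\<close>. The two terms of \<open>Z_h\<close> are equal, hence the factor 2.\<close>

lemma T_h: "along T (h k l) p = 2 * (\<Sum>m\<in>UNIV. Q m m p \<bullet> Q k l p)"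
proof -
  have "along (X k) (along T G) p \<bullet> P l p = - (\<Sum>m\<in>UNIV. Q m m p \<bullet> Q k l p)" for k l
  proof -
    have "along (X k) (\<lambda>z. along T G z \<bullet> P l z) p = 0"
      by (rule slice) (auto intro!: Cinf_on_inner openW TG P TG_normal pS)
    then show ?thesis
      using TG_p[of "Q k l p"] by (simp add: along_inner[OF TG P pW] Q_def)
  qed
  then show ?thesis
    by (simp add: Z_h[OF T] T_P[OF pW] inner_commute[of "P k p"] Q_sym[OF pW, of l k])
qed

text \<open>The fourth derivatives of \<open>G\<close> are the only terms of the evolution equation that are not
  polynomial in the shape operators.\<close>

lemma T_a:
  assumes "\<And>k. P k p \<bullet> \<nu> = 0"
  shows "along T (a \<nu> i j) p = (\<Sum>k\<in>UNIV. along (X k) (along (X k) (Q i j)) p \<bullet> \<nu>)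
     - (\<Sum>k\<in>UNIV. \<Sum>l\<in>UNIV. (Q i k p \<bullet> Q j l p + Q j k p \<bullet> Q i l p) * (Q k l p \<bullet> \<nu>))
     - (\<Sum>m\<in>UNIV. \<Sum>k\<in>UNIV. (Q j k p \<bullet> \<nu>) * (Q m m p \<bullet> Q i k p) + (Q i k p \<bullet> \<nu>) * (Q m m p \<bullet> Q j k p))"
proof -
  let ?H = "\<lambda>z. \<Sum>k\<in>UNIV. \<Sum>l\<in>UNIV. h k l z *\<^sub>R a \<nu> k l z"
  have H: "Cinf_on W ?H" by (intro Cinf_on_intros openW h a)
  have TG\<nu>: "Cinf_on W (\<lambda>z. along T G z \<bullet> \<nu>)" by (intro Cinf_on_intros openW TG)
  \<comment> \<open>The flow equation is available on \<open>S\<close> only, so its two derivatives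
    are taken one after the other, each along \<open>S\<close>.\<close>
  have 1: "along (X j) (\<lambda>z. along T G z \<bullet> \<nu>) z = along (X j) ?H z" if "z \<in> S" for z
    by (rule slice_eq[OF TG\<nu> H mcf' that])
  have 2: "along (X i) (along (X j) (\<lambda>z. along T G z \<bullet> \<nu>)) p = along (X i) (along (X j) ?H) p"
    by (rule slice_eq[OF _ _ 1 pS]) (intro Cinf_on_along openW X H TG\<nu>)+
  \<comment> \<open>The fields commute, so the four indices can be permuted: here the Codazzi
    equation is replaced.\<close>
  have 4: "along (X i) (along (X j) (Q k k)) p = along (X k) (along (X k) (Q i j)) p" for k
  proof -
    have jk: "along (X j) (Q k k) z = along (X k) (Q k j) z" if z: "z \<in> W" for z
    proof -
      have "along (X j) (Q k k) z = along (X k) (along (X j) (P k)) z"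
        unfolding Q_def[of k k] by (rule comm[OF P z])
      also have "\<dots> = along (X k) (Q k j) z"
        by (rule along_cong[OF openW z]) (metis Q_def Q_sym)
      finally show ?thesis .
    qed
    have ik: "along (X i) (Q k j) z = along (X k) (Q i j) z" if z: "z \<in> W" for z
      unfolding Q_def by (rule comm[OF P z])
    have "along (X i) (along (X j) (Q k k)) p = along (X i) (along (X k) (Q k j)) p"
      by (rule along_cong[OF openW pW jk])
    also have "\<dots> = along (X k) (along (X i) (Q k j)) p"
      by (rule comm[OF Q pW])
    also have "\<dots> = along (X k) (along (X k) (Q i j)) p"
      by (rule along_cong[OF openW pW ik])
    finally show ?thesis .
  qed
  have "along T (a \<nu> i j) p = along (X i) (along (X j) (\<lambda>z. along T G z \<bullet> \<nu>)) p"
    by (simp add: Z_a[OF assms] T_Q[OF pW] along2_inner_const TG X pW)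
  also have "\<dots> = - (\<Sum>k\<in>UNIV. \<Sum>l\<in>UNIV. (Q i k p \<bullet> Q j l p + Q j k p \<bullet> Q i l p) *\<^sub>R a \<nu> k l p)
       + (\<Sum>k\<in>UNIV. along (X i) (along (X j) (a \<nu> k k)) p)"
    unfolding 2 by (rule XX_contraction[OF a])
  finally show ?thesis
    unfolding XX_a[OF assms] 4 a_p by (simp add: sum_subtractf)
qed

end

text \<open>Terms polynomial in the shape operators enter the argument only through membership in
  this set, which is closed under sums, multiples and products, and under transposition for
  symmetric generators.\<close>

definition commutant :: "(real ^ 'm::finite ^ 'm) set \<Rightarrow> (real ^ 'm ^ 'm) set" where
  "commutant \<S> = {K. \<forall>A\<in>\<S>. K ** A = A ** K}"

lemma commutantI: "(\<And>A. A \<in> \<S> \<Longrightarrow> K ** A = A ** K) \<Longrightarrow> K \<in> commutant \<S>"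
  by (simp add: commutant_def)

lemma commutantD: "K \<in> commutant \<S> \<Longrightarrow> A \<in> \<S> \<Longrightarrow> K ** A = A ** K"
  by (simp add: commutant_def)

lemma matrix_add_rdistrib: "(B + C) ** A = B ** A + C ** A"
  for A :: "'a::semiring_1 ^ 'l ^ 'm"
  by (vector matrix_matrix_mult_def sum.distrib[symmetric] distrib_right)

lemma matrix_sum_nth: "(\<Sum>b\<in>I. K b) $ i $ j = (\<Sum>b\<in>I. K b $ i $ j)"
  by (simp add: sum_component)

lemma commutant_add: "K \<in> commutant \<S> \<Longrightarrow> L \<in> commutant \<S> \<Longrightarrow> K + L \<in> commutant \<S>"
  by (simp add: commutant_def matrix_add_ldistrib matrix_add_rdistrib)

lemma commutant_scaleR: "K \<in> commutant \<S> \<Longrightarrow> c *\<^sub>R K \<in> commutant \<S>"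
  by (simp add: commutant_def matrix_matrix_mult_def vec_eq_iff
      sum_distrib_left[symmetric] mult.assoc mult.left_commute[of _ c])

lemma commutant_mult: "K \<in> commutant \<S> \<Longrightarrow> L \<in> commutant \<S> \<Longrightarrow> K ** L \<in> commutant \<S>"
  by (simp add: commutant_def) (metis matrix_mul_assoc)

lemma commutant_sum: "(\<And>b. b \<in> I \<Longrightarrow> K b \<in> commutant \<S>) \<Longrightarrow> (\<Sum>b\<in>I. K b) \<in> commutant \<S>"
proof (induction I rule: infinite_finite_induct)
  case (insert x F)
  then show ?case by (simp add: commutant_add)
qed (simp_all add: commutant_def matrix_matrix_mult_def zero_vec_def)

lemma commutant_transpose:
  assumes "\<And>A. A \<in> \<S> \<Longrightarrow> transpose A = A" "K \<in> commutant \<S>"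
  shows "transpose K \<in> commutant \<S>"
proof (rule commutantI)
  fix A assume A: "A \<in> \<S>"
  then have "transpose (K ** A) = transpose (A ** K)" using commutantD[OF assms(2)] by simp
  then show "transpose K ** A = A ** transpose K"
    by (simp add: matrix_transpose_mul assms(1)[OF A])
qed

section \<open>Matrix form of the evolution equations\<close>

context flowing_frame begin

definition "A \<nu> = (\<chi> i j. Q i j p \<bullet> \<nu>)"
text \<open>The fourth order term shared by the time derivative and by the trace of the second frame
  derivatives of \<open>a \<nu>\<close>. It cancels in the comparison and is never
  evaluated.\<close>

definition "LQ \<nu> = (\<chi> i j. \<Sum>k\<in>UNIV. along (X k) (along (X k) (Q i j)) p \<bullet> \<nu>)"
definition "dA q \<nu> = (\<chi> i j. along (X q) (Q i j) p \<bullet> \<nu>)"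

lemma A_nth: "A \<nu> $ i $ j = Q i j p \<bullet> \<nu>" by (simp add: A_def)

lemma transpose_A: "transpose (A \<nu>) = A \<nu>"
  by (simp add: transpose_def vec_eq_iff A_nth Q_sym[OF pW])

lemma A_nth_sym: "A \<nu> $ i $ j = A \<nu> $ j $ i"
  by (metis A_nth Q_sym pW)

lemma E_eq: "E \<nu> \<xi> i j = (\<lambda>z. \<Sum>k\<in>UNIV. \<Sum>l\<in>UNIV. h k l z *\<^sub>R (a \<nu> i k z * a \<xi> l j z - a \<xi> i k z * a \<nu> l j z))"
  by (simp add: fun_eq_iff frame_curv_def)

text \<open>At \<open>p\<close> the matrix \<open>h\<close> is the identity and \<open>a\<close>
  reduces to \<open>Q\<close>, so \<open>flat\<close> becomes literal commutation.\<close>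

lemma A_commute: "A \<nu> \<in> commutant (range A)"
proof (rule commutantI, clarify)
  fix \<xi>
  show "A \<nu> ** A \<xi> = A \<xi> ** A \<nu>"
    using flat[OF pS, of \<nu> \<xi>] contraction_p[of "\<lambda>k l z. a \<nu> _ k z * a \<xi> l _ z - a \<xi> _ k z * a \<nu> l _ z"]
    by (simp add: vec_eq_iff matrix_matrix_mult_def A_nth E_eq a_p sum_subtractf)
qed

text \<open>Parseval in the ambient space. It rewrites pairings of vector valued second derivatives
  through the commuting matrices \<open>A b\<close>.\<close>

lemma Q_inner_Q: "Q i j p \<bullet> Q k l p = (\<Sum>b\<in>Basis. A b $ i $ j * A b $ k $ l)"
  by (subst euclidean_inner) (simp add: A_nth)

lemma T_a_matrix:
  assumes "\<And>k. P k p \<bullet> \<nu> = 0"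
  shows "\<exists>K\<in>commutant (range A). (\<chi> i j. along T (a \<nu> i j) p) = LQ \<nu> + K"
proof
  \<comment> \<open>\<open>K1\<close> and \<open>K2\<close> are the two sums subtracted in
    \<open>T_a\<close>; the traces of \<open>A b\<close> in \<open>K2\<close> are the components of
    the mean curvature vector.\<close>
  define K1 where "K1 = (\<Sum>b\<in>Basis. A b ** A \<nu> ** A b + transpose (A b ** A \<nu> ** A b))"
  define K2 where "K2 = (\<Sum>b\<in>Basis. (\<Sum>m\<in>UNIV. A b $ m $ m) *\<^sub>R (A b ** A \<nu> + A \<nu> ** A b))"
  show "(-1) *\<^sub>R (K1 + K2) \<in> commutant (range A)"
    unfolding K1_def K2_def
    by (intro commutant_scaleR commutant_add commutant_sum commutant_mult A_commute commutant_transpose)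
      (auto simp: transpose_A)
  have K1: "K1 $ i $ j = (\<Sum>k\<in>UNIV. \<Sum>l\<in>UNIV. (Q i k p \<bullet> Q j l p + Q j k p \<bullet> Q i l p) * (Q k l p \<bullet> \<nu>))" for i j
  proof -
    have m: "(A b ** A \<nu> ** A b) $ i $ j = (\<Sum>k\<in>UNIV. \<Sum>l\<in>UNIV. A b $ i $ k * A b $ j $ l * A \<nu> $ k $ l)" for b i j
      unfolding matrix_matrix_mult_def
      by (simp add: sum_distrib_left sum_distrib_right A_nth_sym[of b _ j] mult_ac)
         (subst sum.swap, simp)
    have "(\<Sum>k\<in>UNIV. \<Sum>l\<in>UNIV. (Q i k p \<bullet> Q j l p + Q j k p \<bullet> Q i l p) * (Q k l p \<bullet> \<nu>))
      = (\<Sum>k\<in>UNIV. \<Sum>l\<in>UNIV. \<Sum>b\<in>Basis. A b $ i $ k * A b $ j $ l * A \<nu> $ k $ l + A b $ j $ k * A b $ i $ l * A \<nu> $ k $ l)"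
      by (simp add: Q_inner_Q A_nth[of \<nu>, symmetric] sum_distrib_right sum.distrib distrib_right)
    also have "\<dots> = (\<Sum>b\<in>Basis. \<Sum>k\<in>UNIV. \<Sum>l\<in>UNIV. A b $ i $ k * A b $ j $ l * A \<nu> $ k $ l + A b $ j $ k * A b $ i $ l * A \<nu> $ k $ l)"
      by (simp add: sum.swap[of _ Basis])
    also have "\<dots> = K1 $ i $ j"
      by (simp add: K1_def sum_component transpose_def m sum.distrib)
    finally show ?thesis by simp
  qed
  have K2: "K2 $ i $ j = (\<Sum>m\<in>UNIV. \<Sum>k\<in>UNIV. (Q j k p \<bullet> \<nu>) * (Q m m p \<bullet> Q i k p) + (Q i k p \<bullet> \<nu>) * (Q m m p \<bullet> Q j k p))" for i j
  proof -
    have "(\<Sum>m\<in>UNIV. \<Sum>k\<in>UNIV. (Q j k p \<bullet> \<nu>) * (Q m m p \<bullet> Q i k p) + (Q i k p \<bullet> \<nu>) * (Q m m p \<bullet> Q j k p))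
      = (\<Sum>m\<in>UNIV. \<Sum>k\<in>UNIV. \<Sum>b\<in>Basis. A b $ m $ m * (A b $ i $ k * A \<nu> $ k $ j + A \<nu> $ i $ k * A b $ k $ j))"
      by (simp add: Q_inner_Q A_nth[of \<nu>, symmetric] sum_distrib_left sum.distrib distrib_left A_nth_sym[of _ _ j] mult_ac)
    also have "\<dots> = (\<Sum>b\<in>Basis. \<Sum>m\<in>UNIV. \<Sum>k\<in>UNIV. A b $ m $ m * (A b $ i $ k * A \<nu> $ k $ j + A \<nu> $ i $ k * A b $ k $ j))"
      by (simp add: sum.swap[of _ Basis])
    also have "\<dots> = K2 $ i $ j"
      by (simp add: K2_def sum_component matrix_matrix_mult_def sum.distrib[symmetric] sum_product)
    finally show ?thesis by simp
  qed
  show "(\<chi> i j. along T (a \<nu> i j) p) = LQ \<nu> + (-1) *\<^sub>R (K1 + K2)"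
    by (simp add: vec_eq_iff T_a[OF assms] LQ_def K1 K2)
qed

lemma LX_a_matrix:
  assumes "\<And>k. P k p \<bullet> \<nu> = 0"
  shows "\<exists>K\<in>commutant (range A). (\<chi> i j. \<Sum>q\<in>UNIV. along (X q) (along (X q) (a \<nu> i j)) p) = LQ \<nu> + K"
proof
  \<comment> \<open>The correction in \<open>XX_a\<close> for equal directions: its two summands
    coincide, and the coefficient of \<open>A b\<close> is -2 times the Frobenius product of
    \<open>A \<nu>\<close> and \<open>A b\<close>.\<close>
  define K where "K = (\<Sum>b\<in>Basis. (-2 * (\<Sum>q\<in>UNIV. \<Sum>k\<in>UNIV. A \<nu> $ q $ k * A b $ q $ k)) *\<^sub>R A b)"
  show "K \<in> commutant (range A)"
    unfolding K_def by (intro commutant_scaleR commutant_sum A_commute)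
  have K: "K $ i $ j = - (\<Sum>q\<in>UNIV. \<Sum>k\<in>UNIV. (Q q k p \<bullet> \<nu>) * (Q i j p \<bullet> Q q k p) + (Q q k p \<bullet> \<nu>) * (Q i j p \<bullet> Q q k p))" for i j
  proof -
    have "(\<Sum>q\<in>UNIV. \<Sum>k\<in>UNIV. (Q q k p \<bullet> \<nu>) * (Q i j p \<bullet> Q q k p) + (Q q k p \<bullet> \<nu>) * (Q i j p \<bullet> Q q k p))
      = (\<Sum>q\<in>UNIV. \<Sum>k\<in>UNIV. \<Sum>b\<in>Basis. 2 * (A \<nu> $ q $ k * A b $ q $ k) * A b $ i $ j)"
      by (simp add: Q_inner_Q A_nth[of \<nu>, symmetric] sum_distrib_left sum_distrib_right mult_ac)
    also have "\<dots> = (\<Sum>b\<in>Basis. \<Sum>q\<in>UNIV. \<Sum>k\<in>UNIV. 2 * (A \<nu> $ q $ k * A b $ q $ k) * A b $ i $ j)"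
      by (simp add: sum.swap[of _ Basis])
    also have "\<dots> = - K $ i $ j"
      by (simp add: K_def sum_component sum_distrib_left sum_distrib_right sum_negf)
    finally show ?thesis by simp
  qed
  show "(\<chi> i j. \<Sum>q\<in>UNIV. along (X q) (along (X q) (a \<nu> i j)) p) = LQ \<nu> + K"
    by (simp add: vec_eq_iff XX_a[OF assms] LQ_def K sum_subtractf)
qed

lemma T_h_matrix: "(\<chi> k l. along T (h k l) p) \<in> commutant (range A)"
proof -
  have "(\<chi> k l. along T (h k l) p) = (\<Sum>b\<in>Basis. (2 * (\<Sum>m\<in>UNIV. A b $ m $ m)) *\<^sub>R A b)"
    by (simp add: vec_eq_iff T_h Q_inner_Q sum_component sum_distrib_left sum_distrib_right mult_ac sum.swap[of _ Basis])
  then show ?thesis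
    by (simp only:) (intro commutant_scaleR commutant_sum A_commute)
qed

lemma LX_h_matrix: "(\<chi> k l. \<Sum>q\<in>UNIV. Q q k p \<bullet> Q q l p) \<in> commutant (range A)"
proof -
  have "(\<chi> k l. \<Sum>q\<in>UNIV. Q q k p \<bullet> Q q l p) = (\<Sum>b\<in>Basis. A b ** A b)"
    by (simp add: vec_eq_iff Q_inner_Q sum_component matrix_matrix_mult_def sum.swap[of _ Basis]
        A_nth_sym[of _ _ "_::'m"])
  then show ?thesis
    by (simp only:) (intro commutant_mult commutant_sum A_commute)
qed

lemma frame_curv_evolution:
  assumes \<nu>: "\<And>k. P k p \<bullet> \<nu> = 0" and \<xi>: "\<And>k. P k p \<bullet> \<xi> = 0"
  shows "along T (E \<nu> \<xi> i j) p
    = -2 * (\<Sum>q\<in>UNIV. (dA q \<nu> ** dA q \<xi> - dA q \<xi> ** dA q \<nu>) $ i $ j)"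
proof -
  let ?u = "\<lambda>i j k l z. a \<nu> i k z * a \<xi> l j z - a \<xi> i k z * a \<nu> l j z"
  have u: "Cinf_on W (?u i j k l)" for i j k l by (intro Cinf_on_intros openW a)
  define Th where "Th = (\<chi> k l. along T (h k l) p)"
  define Lh where "Lh = (\<chi> k l. \<Sum>q\<in>UNIV. Q q k p \<bullet> Q q l p)"
  define Ta where "Ta \<nu> = (\<chi> i j. along T (a \<nu> i j) p)" for \<nu>
  define La where "La \<nu> = (\<chi> i j. \<Sum>q\<in>UNIV. along (X q) (along (X q) (a \<nu> i j)) p)" for \<nu>
  define dd where "dd = (\<Sum>q\<in>UNIV. dA q \<nu> ** dA q \<xi> - dA q \<xi> ** dA q \<nu>)"
  \<comment> \<open>Disposes of the terms in which \<open>h\<close> is differentiated: the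
    derivatives of \<open>h\<close> that occur form commutant matrices, and exchanging the outer
    factors around such a matrix changes nothing.\<close>
  have sandwich: "A \<nu> ** K ** A \<xi> = A \<xi> ** K ** A \<nu>" if "K \<in> commutant (range A)" for K
    using commutantD[OF that, of "A \<nu>"] commutantD[OF that, of "A \<xi>"] commutantD[OF A_commute, of "A \<xi>" \<nu>]
    by (metis matrix_mul_assoc rangeI)
  have mid: "(\<Sum>k\<in>UNIV. \<Sum>l\<in>UNIV. K $ k $ l * ?u i j k l p)
      = (A \<nu> ** K ** A \<xi>) $ i $ j - (A \<xi> ** K ** A \<nu>) $ i $ j" for K i j
  proof -
    have "(B ** K ** C) $ i $ j = (\<Sum>k\<in>UNIV. \<Sum>l\<in>UNIV. K $ k $ l * (B $ i $ k * C $ l $ j))" for B C :: "real ^ 'm ^ 'm"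
      unfolding matrix_matrix_mult_def
      by (simp add: sum_distrib_left sum_distrib_right mult_ac) (subst sum.swap, simp)
    then show ?thesis by (simp add: a_p A_nth right_diff_distrib sum_subtractf)
  qed
  have T1: "along T (E \<nu> \<xi> i j) p = (Ta \<nu> ** A \<xi> + A \<nu> ** Ta \<xi> - Ta \<xi> ** A \<nu> - A \<xi> ** Ta \<nu>) $ i $ j" for i j
  proof -
    have k: "along T (?u i j k k) p = Ta \<nu> $ i $ k * A \<xi> $ k $ j + A \<nu> $ i $ k * Ta \<xi> $ k $ j
        - Ta \<xi> $ i $ k * A \<nu> $ k $ j - A \<xi> $ i $ k * Ta \<nu> $ k $ j" for k
      by (simp add: along_diff[OF Cinf_on_mult[OF openW a a] Cinf_on_mult[OF openW a a] pW]
          along_mult[OF a a pW] a_p A_nth Ta_def)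
    have "along T (E \<nu> \<xi> i j) p = (\<Sum>k\<in>UNIV. \<Sum>l\<in>UNIV. Th $ k $ l * ?u i j k l p) + (\<Sum>k\<in>UNIV. along T (?u i j k k) p)"
      unfolding E_eq Z_contraction[OF u] by (simp add: Th_def)
    also have "(\<Sum>k\<in>UNIV. \<Sum>l\<in>UNIV. Th $ k $ l * ?u i j k l p) = 0"
      unfolding mid using sandwich[OF T_h_matrix] by (simp add: Th_def)
    finally show ?thesis
      by (simp add: k matrix_matrix_mult_def sum.distrib sum_subtractf)
  qed
  \<comment> \<open>Flatness differentiated twice: the brackets with \<open>La\<close> and twice the
    cross terms \<open>dd\<close> add up to zero.\<close>
  have L1: "0 = (La \<nu> ** A \<xi> + A \<nu> ** La \<xi> - La \<xi> ** A \<nu> - A \<xi> ** La \<nu>) $ i $ j + 2 * dd $ i $ j" for i j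
  proof -
    have k: "along (X q) (along (X q) (?u i j k k)) p
        = along (X q) (along (X q) (a \<nu> i k)) p * A \<xi> $ k $ j + A \<nu> $ i $ k * along (X q) (along (X q) (a \<xi> k j)) p
        - along (X q) (along (X q) (a \<xi> i k)) p * A \<nu> $ k $ j - A \<xi> $ i $ k * along (X q) (along (X q) (a \<nu> k j)) p
        + 2 * (dA q \<nu> $ i $ k * dA q \<xi> $ k $ j - dA q \<xi> $ i $ k * dA q \<nu> $ k $ j)" for k q
      by (simp add: along2_diff[OF openW X Cinf_on_mult[OF openW a a] Cinf_on_mult[OF openW a a] pW]
          along2_mult[OF openW X a a pW] a_p A_nth dA_def Z_a[OF \<nu>] Z_a[OF \<xi>])
    \<comment> \<open>Uses flatness on the whole slice: the first derivative of \<open>E\<close>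
      vanishes on \<open>S\<close> and can be differentiated along \<open>S\<close> again.\<close>
    have E0: "along (X q) (along (X q) (E \<nu> \<xi> i j)) p = 0" for q
    proof -
      have EC: "Cinf_on W (E \<nu> \<xi> i j)" unfolding E_eq by (intro Cinf_on_intros openW h a)
      show ?thesis
        by (rule slice[OF Cinf_on_along[OF openW X EC] slice[OF EC flat] pS])
    qed
    have "0 = (\<Sum>q\<in>UNIV. along (X q) (along (X q) (E \<nu> \<xi> i j)) p)" by (simp add: E0)
    also have "\<dots> = (\<Sum>q\<in>UNIV. - (\<Sum>k\<in>UNIV. \<Sum>l\<in>UNIV. (Q q k p \<bullet> Q q l p + Q q k p \<bullet> Q q l p) * ?u i j k l p)
        + (\<Sum>k\<in>UNIV. along (X q) (along (X q) (?u i j k k)) p))"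
      unfolding E_eq XX_contraction[OF u] by simp
    also have "\<dots> = - 2 * (\<Sum>k\<in>UNIV. \<Sum>l\<in>UNIV. Lh $ k $ l * ?u i j k l p)
        + (\<Sum>k\<in>UNIV. \<Sum>q\<in>UNIV. along (X q) (along (X q) (?u i j k k)) p)"
    proof -
      have "(\<Sum>q\<in>UNIV. \<Sum>k\<in>UNIV. \<Sum>l\<in>UNIV. (Q q k p \<bullet> Q q l p) * ?u i j k l p)
          = (\<Sum>k\<in>UNIV. \<Sum>l\<in>UNIV. Lh $ k $ l * ?u i j k l p)"
        (is "?l = _")
      proof -
        have "?l = (\<Sum>k\<in>UNIV. \<Sum>q\<in>UNIV. \<Sum>l\<in>UNIV. (Q q k p \<bullet> Q q l p) * ?u i j k l p)"
          by (rule sum.swap)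
        also have "\<dots> = (\<Sum>k\<in>UNIV. \<Sum>l\<in>UNIV. \<Sum>q\<in>UNIV. (Q q k p \<bullet> Q q l p) * ?u i j k l p)"
          by (intro sum.cong refl sum.swap)
        finally show ?thesis by (simp add: Lh_def sum_distrib_right)
      qed
      moreover have "(\<Sum>k\<in>UNIV. \<Sum>l\<in>UNIV. (Q q k p \<bullet> Q q l p + Q q k p \<bullet> Q q l p) * ?u i j k l p)
          = 2 * (\<Sum>k\<in>UNIV. \<Sum>l\<in>UNIV. (Q q k p \<bullet> Q q l p) * ?u i j k l p)" for q
        by (simp add: sum_distrib_left mult.assoc flip: mult_2)
      moreover have "(\<Sum>q\<in>UNIV. \<Sum>k\<in>UNIV. along (X q) (along (X q) (?u i j k k)) p)
          = (\<Sum>k\<in>UNIV. \<Sum>q\<in>UNIV. along (X q) (along (X q) (?u i j k k)) p)"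
        by (rule sum.swap)
      ultimately show ?thesis
        by (simp only: sum.distrib sum_negf sum_distrib_left[symmetric] mult_minus_left)
    qed
    also have "(\<Sum>k\<in>UNIV. \<Sum>l\<in>UNIV. Lh $ k $ l * ?u i j k l p) = 0"
      unfolding mid using sandwich[OF LX_h_matrix] by (simp add: Lh_def)
    also have "(\<Sum>k\<in>UNIV. \<Sum>q\<in>UNIV. along (X q) (along (X q) (?u i j k k)) p)
       = (La \<nu> ** A \<xi> + A \<nu> ** La \<xi> - La \<xi> ** A \<nu> - A \<xi> ** La \<nu>) $ i $ j
         + 2 * (\<Sum>k\<in>UNIV. \<Sum>q\<in>UNIV. dA q \<nu> $ i $ k * dA q \<xi> $ k $ j - dA q \<xi> $ i $ k * dA q \<nu> $ k $ j)"
      unfolding k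
      by (simp add: La_def matrix_matrix_mult_def sum.distrib sum_subtractf sum_distrib_left sum_distrib_right)
    also have "(\<Sum>k\<in>UNIV. \<Sum>q\<in>UNIV. dA q \<nu> $ i $ k * dA q \<xi> $ k $ j - dA q \<xi> $ i $ k * dA q \<nu> $ k $ j) = dd $ i $ j"
      unfolding dd_def matrix_sum_nth
      by (subst sum.swap) (simp add: matrix_matrix_mult_def sum_subtractf)
    finally show ?thesis by simp
  qed
  obtain K where K: "K \<in> commutant (range A)" "Ta \<nu> = LQ \<nu> + K"
    unfolding Ta_def using T_a_matrix[OF \<nu>] by blast
  obtain K' where K': "K' \<in> commutant (range A)" "Ta \<xi> = LQ \<xi> + K'"
    unfolding Ta_def using T_a_matrix[OF \<xi>] by blast
  obtain L where L: "L \<in> commutant (range A)" "La \<nu> = LQ \<nu> + L"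
    unfolding La_def using LX_a_matrix[OF \<nu>] by blast
  obtain L' where L': "L' \<in> commutant (range A)" "La \<xi> = LQ \<xi> + L'"
    unfolding La_def using LX_a_matrix[OF \<xi>] by blast
  note eq = K(2) K'(2) L(2) L'(2)
  have c: "K ** A \<xi> = A \<xi> ** K" "K' ** A \<nu> = A \<nu> ** K'" "L ** A \<xi> = A \<xi> ** L" "L' ** A \<nu> = A \<nu> ** L'"
    using K(1) K'(1) L(1) L'(1) commutantD by blast+
  \<comment> \<open>The commutant parts cancel in the brackets, so \<open>T1\<close> and
    \<open>L1\<close> contain the same brackets in \<open>LQ\<close> and differ only by
    \<open>2 * dd\<close>.\<close>
  have "along T (E \<nu> \<xi> i j) p = -2 * dd $ i $ j"
    using T1[of i j] L1[of i j] by (simp add: eq matrix_add_ldistrib matrix_add_rdistrib c)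
  then show ?thesis by (simp add: dd_def matrix_sum_nth)
qed

end

section \<open>Geometry of an immersion in a frame\<close>

text \<open>The ordinary Hessian in coordinates. For an immersion its normal part is the second
  fundamental form and its tangential part the Christoffel term
  (\<open>christoffel_eq\<close>).\<close>

definition hess :: "('a::euclidean_space \<Rightarrow> 'b::euclidean_space) \<Rightarrow> 'a \<Rightarrow> 'a \<Rightarrow> 'a \<Rightarrow> 'b" where
  "hess f x v w = frechet_derivative (\<lambda>y. frechet_derivative f (at y) w) (at x) v"

lemma dir_deriv_eq_along: "dir_deriv X g = along X g"
  by (simp add: fun_eq_iff dir_deriv_def along_def)

lemma linear_sum_scaleR: "linear L \<Longrightarrow> L (\<Sum>k\<in>I. c k *\<^sub>R v k) = (\<Sum>k\<in>I. c k *\<^sub>R L (v k))"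
  by (simp add: linear_sum linear_cmul)

lemma linear_expand_axis:
  fixes L :: "real ^ 'm::finite \<Rightarrow> 'b::real_vector"
  assumes "linear L"
  shows "L c = (\<Sum>j\<in>UNIV. (c $ j) *\<^sub>R L (axis j 1))"
proof -
  have "c = (\<Sum>j\<in>UNIV. (c $ j) *\<^sub>R axis j 1)"
    by (simp add: vec_eq_iff axis_def if_distrib cong: if_cong)
  then have "L c = L (\<Sum>j\<in>UNIV. (c $ j) *\<^sub>R axis j 1)" by (rule arg_cong)
  also have "\<dots> = (\<Sum>j\<in>UNIV. (c $ j) *\<^sub>R L (axis j 1))" by (rule linear_sum_scaleR[OF assms])
  finally show ?thesis .
qed

locale immersed =
  fixes \<Omega> :: "(real ^ 'm::finite) set" and f :: "real ^ 'm \<Rightarrow> real ^ 'n::finite"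
  assumes open\<Omega>: "open \<Omega>" and f: "Cinf_on \<Omega> f" and inj: "\<And>x. x \<in> \<Omega> \<Longrightarrow> inj (push f x)"
begin

lemma push_linear: "x \<in> \<Omega> \<Longrightarrow> linear (push f x)"
  unfolding push_def using Cinf_on_frechet_linear[OF f] by simp

lemma push_0: "x \<in> \<Omega> \<Longrightarrow> push f x 0 = 0"
  by (simp add: push_linear linear_0)

lemma push_along: "along Y f = (\<lambda>x. push f x (Y x))"
  by (simp add: fun_eq_iff along_def push_def)

lemma Cinf_push: "Cinf_on \<Omega> Y \<Longrightarrow> Cinf_on \<Omega> (\<lambda>x. push f x (Y x))"
  unfolding push_along[symmetric] by (intro Cinf_on_along open\<Omega> f)

lemma push_eqI:
  assumes "x \<in> \<Omega>" "\<And>u. push f x w \<bullet> push f x u = push f x w' \<bullet> push f x u"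
  shows "w = w'"
proof -
  have "(push f x w - push f x w') \<bullet> (push f x w - push f x w') = 0"
    using assms(2)[of w] assms(2)[of w'] by (simp add: inner_diff_left inner_diff_right)
  then have "push f x w = push f x w'" by simp
  then show ?thesis using inj[OF assms(1)] by (simp add: inj_def)
qed

lemma tang_eqI:
  assumes "x \<in> \<Omega>" "\<And>v. (u - push f x w) \<bullet> push f x v = 0"
  shows "tang f x u = w"
  unfolding tang_def
proof (rule the_equality)
  show "\<forall>v. (u - push f x w) \<bullet> push f x v = 0" using assms by blast
next
  fix w' assume "\<forall>v. (u - push f x w') \<bullet> push f x v = 0"
  then show "w' = w"
    by (intro push_eqI[OF assms(1)]) (use assms(2) in \<open>simp add: inner_diff_left\<close>)
qed

text \<open>An orthogonal decomposition along the tangent space supplies the vector that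
  \<open>THE\<close> in \<open>tang\<close> asks for; its uniqueness comes from injectivity of
  \<open>push\<close>.\<close>

lemma tang_inner:
  assumes "x \<in> \<Omega>"
  shows "push f x (tang f x u) \<bullet> push f x v = u \<bullet> push f x v"
proof -
  obtain y z where y: "y \<in> span (range (push f x))" and z: "\<And>w. w \<in> span (range (push f x)) \<Longrightarrow> orthogonal z w"
    and u: "u = y + z"
    using orthogonal_subspace_decomp_exists[of "range (push f x)" u] by metis
  have "subspace (range (push f x))"
    by (simp add: linear_subspace_image[OF push_linear[OF assms]])
  then have "y \<in> range (push f x)" using y by (metis span_eq_iff)
  then obtain w where w: "y = push f x w" by blast
  have "(u - push f x w) \<bullet> push f x v = 0" for v
    using z[of "push f x v"] by (simp add: u w orthogonal_def span_base)
  then have "tang f x u = w" by (rule tang_eqI[OF assms])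
  then show ?thesis using \<open>\<And>v. (u - push f x w) \<bullet> push f x v = 0\<close>[of v] by (simp add: inner_diff_left)
qed

lemma nor_push: "x \<in> \<Omega> \<Longrightarrow> nor f x u \<bullet> push f x v = 0" "x \<in> \<Omega> \<Longrightarrow> push f x v \<bullet> nor f x u = 0"
  by (simp_all add: nor_def inner_diff_left inner_diff_right tang_inner inner_commute[of "push f x v"])

lemma normal_at_nor: "x \<in> \<Omega> \<Longrightarrow> normal_at f x (nor f x u)"
  by (simp add: normal_at_def nor_push)

lemma tang_normal: "x \<in> \<Omega> \<Longrightarrow> normal_at f x u \<Longrightarrow> tang f x u = 0"
  by (rule tang_eqI) (simp_all add: normal_at_def push_0)

lemma nor_normal: "x \<in> \<Omega> \<Longrightarrow> normal_at f x u \<Longrightarrow> nor f x u = u"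
  by (simp add: nor_def tang_normal push_0)

lemma tang_push: "x \<in> \<Omega> \<Longrightarrow> tang f x (push f x v) = v"
  by (rule tang_eqI) simp_all

lemma nor_of_push: "x \<in> \<Omega> \<Longrightarrow> nor f x (push f x v) = 0"
  by (simp add: nor_def tang_push)

lemma tang_diff: "x \<in> \<Omega> \<Longrightarrow> tang f x (u - u') = tang f x u - tang f x u'"
  by (rule tang_eqI)
    (simp_all add: linear_diff[OF push_linear] inner_diff_left tang_inner)

lemma nor_diff: "x \<in> \<Omega> \<Longrightarrow> nor f x (u - u') = nor f x u - nor f x u'"
  by (simp add: nor_def tang_diff linear_diff[OF push_linear])

lemma nor_adjoint: "x \<in> \<Omega> \<Longrightarrow> nor f x u \<bullet> u' = u \<bullet> nor f x u'"
proof -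
  assume x: "x \<in> \<Omega>"
  have "nor f x u \<bullet> u' = nor f x u \<bullet> nor f x u'"
    by (subst (2) nor_def) (simp add: inner_diff_right nor_push[OF x])
  also have "\<dots> = u \<bullet> nor f x u'"
    by (subst nor_def) (simp add: inner_diff_left nor_push[OF x])
  finally show ?thesis .
qed

text \<open>By \<open>hv\<close> the matrix \<open>h\<close> is a left inverse of the Gram matrix of
  \<open>v\<close>, so the family is linearly independent; it has as many members as the
  dimension.\<close>

lemma frame_spans:
  fixes v :: "'m \<Rightarrow> real ^ 'm"
  assumes x: "x \<in> \<Omega>"
    and hv: "\<And>k j. (\<Sum>l\<in>UNIV. h k l * (push f x (v l) \<bullet> push f x (v j))) = (if k = j then 1 else (0::real))"
  shows "\<exists>c. w = (\<Sum>k\<in>UNIV. c k *\<^sub>R v k)"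
proof -
  let ?L = "\<lambda>c :: real ^ 'm. \<Sum>k\<in>UNIV. (c $ k) *\<^sub>R v k"
  have lin: "linear ?L"
    by (rule linearI) (simp_all add: scaleR_add_left sum.distrib scaleR_sum_right)
  have "c = 0" if "?L c = 0" for c
  proof -
    have z: "(\<Sum>j\<in>UNIV. (c $ j) * (push f x (v l) \<bullet> push f x (v j))) = 0" for l
    proof -
      have "(\<Sum>j\<in>UNIV. (c $ j) * (push f x (v l) \<bullet> push f x (v j))) = push f x (v l) \<bullet> push f x (?L c)"
        by (simp add: linear_sum_scaleR[OF push_linear[OF x]] inner_sum_right)
      then show ?thesis by (simp add: that push_0[OF x])
    qed
    have "c $ k = 0" for k
    proof -
      have "c $ k = (\<Sum>j\<in>UNIV. (\<Sum>l\<in>UNIV. h k l * (push f x (v l) \<bullet> push f x (v j))) * c $ j)"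
        by (simp add: hv sum_delta_mult)
      also have "\<dots> = (\<Sum>l\<in>UNIV. h k l * (\<Sum>j\<in>UNIV. (c $ j) * (push f x (v l) \<bullet> push f x (v j))))"
        unfolding sum_distrib_left sum_distrib_right by (subst sum.swap) (simp add: mult_ac)
      finally show ?thesis by (simp add: z)
    qed
    then show ?thesis by (simp add: vec_eq_iff)
  qed
  then have "inj ?L" using linear_injective_0[OF lin] by blast
  then have "surj ?L" using lin linear_injective_imp_surjective by blast
  then obtain c where "w = ?L c" by (rule surjE)
  then show ?thesis by (intro exI[of _ "\<lambda>k. c $ k"])
qed

lemma tang_frame:
  fixes v :: "'m \<Rightarrow> real ^ 'm"
  assumes x: "x \<in> \<Omega>"
    and hv: "\<And>k j. (\<Sum>l\<in>UNIV. h k l * (push f x (v l) \<bullet> push f x (v j))) = (if k = j then 1 else (0::real))"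
  shows "tang f x u = (\<Sum>k\<in>UNIV. \<Sum>l\<in>UNIV. (h k l * (push f x (v k) \<bullet> u)) *\<^sub>R v l)"
proof (rule tang_eqI[OF x])
  fix w
  let ?t = "\<Sum>k\<in>UNIV. \<Sum>l\<in>UNIV. (h k l * (push f x (v k) \<bullet> u)) *\<^sub>R v l"
  obtain c where w: "w = (\<Sum>k\<in>UNIV. c k *\<^sub>R v k)" using frame_spans[OF x hv] by blast
  have pt: "push f x ?t = (\<Sum>k\<in>UNIV. \<Sum>l\<in>UNIV. (h k l * (push f x (v k) \<bullet> u)) *\<^sub>R push f x (v l))"
    by (simp add: linear_sum[OF push_linear[OF x]] linear_cmul[OF push_linear[OF x]])
  have "push f x ?t \<bullet> push f x (v j) = u \<bullet> push f x (v j)" for j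
  proof -
    have "push f x ?t \<bullet> push f x (v j) = (\<Sum>k\<in>UNIV. (push f x (v k) \<bullet> u) * (\<Sum>l\<in>UNIV. h k l * (push f x (v l) \<bullet> push f x (v j))))"
      unfolding pt by (simp add: inner_sum_left sum_distrib_left mult_ac)
    then show ?thesis by (simp add: hv sum_delta_mult inner_commute)
  qed
  then show "(u - push f x ?t) \<bullet> push f x w = 0"
    by (simp add: w linear_sum_scaleR[OF push_linear[OF x]] inner_sum_right inner_diff_left)
qed

lemma nor_frame:
  fixes v :: "'m \<Rightarrow> real ^ 'm"
  assumes x: "x \<in> \<Omega>"
    and hv: "\<And>k j. (\<Sum>l\<in>UNIV. h k l * (push f x (v l) \<bullet> push f x (v j))) = (if k = j then 1 else (0::real))"
  shows "nor f x u = u - (\<Sum>k\<in>UNIV. \<Sum>l\<in>UNIV. h k l *\<^sub>R ((push f x (v k) \<bullet> u) *\<^sub>R push f x (v l)))"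
  unfolding nor_def tang_frame[OF assms]
  by (simp add: linear_sum[OF push_linear[OF x]] linear_cmul[OF push_linear[OF x]])

lemma gram_vec: "x \<in> \<Omega> \<Longrightarrow> (\<Sum>j\<in>UNIV. gram f x $ i $ j * c $ j) = push f x (axis i 1) \<bullet> push f x c"
proof -
  assume x: "x \<in> \<Omega>"
  show ?thesis
    unfolding linear_expand_axis[OF push_linear[OF x], of c]
    by (simp add: gram_def induced_metric_def inner_sum_right mult_ac)
qed

lemma det_gram: "x \<in> \<Omega> \<Longrightarrow> det (gram f x) \<noteq> 0"
proof -
  assume x: "x \<in> \<Omega>"
  have "c = 0" if "gram f x *v c = 0" for c
  proof -
    have z: "push f x (axis i 1) \<bullet> push f x c = 0" for i
      using that by (simp add: gram_vec[OF x, symmetric] vec_eq_iff matrix_vector_mult_def)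
    have "push f x c \<bullet> push f x c = 0"
      by (subst linear_expand_axis[OF push_linear[OF x]]) (simp add: z inner_sum_left)
    then have "push f x c = push f x 0" by (simp add: push_0[OF x])
    then show ?thesis using inj[OF x] by (simp add: inj_def)
  qed
  then show ?thesis
    by (meson invertible_det_nz invertible_left_inverse matrix_left_invertible_ker)
qed

abbreviation "gi x \<equiv> matrix_inv (gram f x)"

lemma gi_frame: "x \<in> \<Omega> \<Longrightarrow> (\<Sum>l\<in>UNIV. gi x $ k $ l * (push f x (axis l 1) \<bullet> push f x (axis j 1))) = (if k = j then 1 else 0)"
proof -
  assume x: "x \<in> \<Omega>"
  have "(gi x ** gram f x) $ k $ j = mat 1 $ k $ j"
    using matrix_inv_inverse(2)[OF det_gram[OF x]] by simp
  then show ?thesis by (simp add: matrix_matrix_mult_def gram_def induced_metric_def mat_def)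
qed

lemma Cinf_gi: "Cinf_on \<Omega> (\<lambda>x. gi x $ k $ l)"
  by (rule Cinf_on_matrix_inv[OF open\<Omega> _ det_gram])
    (auto simp: gram_def induced_metric_def intro!: Cinf_on_inner open\<Omega> Cinf_push Cinf_on_const)

text \<open>A map defined by \<open>THE\<close> shows no smoothness by itself; its expression
  through the inverse Gram matrix does.\<close>

lemma Cinf_tang: "Cinf_on \<Omega> U \<Longrightarrow> Cinf_on \<Omega> (\<lambda>x. tang f x (U x))"
proof -
  assume U: "Cinf_on \<Omega> U"
  have "Cinf_on \<Omega> (\<lambda>x. \<Sum>k\<in>UNIV. \<Sum>l\<in>UNIV. (gi x $ k $ l * (push f x (axis k 1) \<bullet> U x)) *\<^sub>R axis l (1::real))"
    by (intro Cinf_on_intros open\<Omega> U Cinf_gi Cinf_push)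
  then show ?thesis
    by (subst Cinf_on_cong[OF open\<Omega> tang_frame[OF _ gi_frame]]) auto
qed

lemma Cinf_nor: "Cinf_on \<Omega> U \<Longrightarrow> Cinf_on \<Omega> (\<lambda>x. nor f x (U x))"
  unfolding nor_def by (intro Cinf_on_intros open\<Omega> Cinf_push Cinf_tang)

lemma hess_sym: "x \<in> \<Omega> \<Longrightarrow> hess f x v w = hess f x w v"
  unfolding hess_def by (rule second_derivative_symmetric[OF open\<Omega> _ f])

lemma hess_linear_left: "x \<in> \<Omega> \<Longrightarrow> linear (\<lambda>v. hess f x v w)"
  unfolding hess_def by (rule Cinf_on_frechet_linear[OF Cinf_on_frechet[OF f]])

lemma hess_linear_right: "x \<in> \<Omega> \<Longrightarrow> linear (hess f x v)"
proof -
  assume x: "x \<in> \<Omega>"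
  have "(\<lambda>w. hess f x w v) = hess f x v" by (simp add: fun_eq_iff hess_sym[OF x, of _ v])
  then show ?thesis using hess_linear_left[OF x, of v] by simp
qed

lemma Cinf_hess: "Cinf_on \<Omega> (\<lambda>x. hess f x v w)"
  unfolding hess_def by (intro Cinf_on_frechet f)

lemma along_push_const: "along (\<lambda>_. v) (\<lambda>y. push f y w) x = hess f x v w"
  by (simp add: along_def hess_def push_def)

lemma along_push:
  assumes "x \<in> \<Omega>" "Cinf_on \<Omega> Y" "Cinf_on \<Omega> V"
  shows "along Y (\<lambda>y. push f y (V y)) x = hess f x (Y x) (V x) + push f x (along Y V x)"
  using along_along[OF open\<Omega> assms(2,3) f assms(1)]
  by (simp add: push_along hess_def) (simp add: push_def)

lemma Cinf_push_const: "Cinf_on \<Omega> (\<lambda>y. push f y w)"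
  by (rule Cinf_push[OF Cinf_on_const])

text \<open>Weingarten relation: product rule for the vanishing pairing of \<open>N\<close> with
  tangent vectors.\<close>

lemma along_normal_inner:
  assumes x: "x \<in> \<Omega>" and N: "Cinf_on \<Omega> N" and normal: "\<And>y. y \<in> \<Omega> \<Longrightarrow> normal_at f y (N y)"
  shows "along (\<lambda>_. w) N x \<bullet> push f x u = - (N x \<bullet> hess f x w u)"
proof -
  have "along (\<lambda>_. w) (\<lambda>y. N y \<bullet> push f y u) x = along (\<lambda>_. w) (\<lambda>y. 0 :: real) x"
    by (rule along_cong[OF open\<Omega> x]) (use normal in \<open>auto simp: normal_at_def\<close>)
  then show ?thesis
    by (simp add: along_inner[OF N Cinf_push_const x] along_push_const)
qed

lemma shape_op_eq: "shape_op f N Y x = - tang f x (along Y N x)"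
  by (simp add: shape_op_def dir_deriv_eq_along)

lemma Cinf_shape_op: "Cinf_on \<Omega> N \<Longrightarrow> Cinf_on \<Omega> (shape_op f N (\<lambda>_. w))"
  unfolding shape_op_def dir_deriv_eq_along
  by (intro Cinf_on_uminus open\<Omega> Cinf_tang Cinf_on_along Cinf_on_const)

lemma shape_op_inner:
  assumes x: "x \<in> \<Omega>" and N: "Cinf_on \<Omega> N" and normal: "\<And>y. y \<in> \<Omega> \<Longrightarrow> normal_at f y (N y)"
  shows "push f x (shape_op f N (\<lambda>_. w) x) \<bullet> push f x u = N x \<bullet> hess f x w u"
  by (simp add: shape_op_eq linear_neg[OF push_linear[OF x]] tang_inner[OF x] along_normal_inner[OF assms])

lemma shape_op_frame:
  fixes v :: "'m \<Rightarrow> real ^ 'm"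
  assumes x: "x \<in> \<Omega>" and N: "Cinf_on \<Omega> N" and normal: "\<And>y. y \<in> \<Omega> \<Longrightarrow> normal_at f y (N y)"
    and hv: "\<And>k j. (\<Sum>l\<in>UNIV. h k l * (push f x (v l) \<bullet> push f x (v j))) = (if k = j then 1 else (0::real))"
  shows "shape_op f N (\<lambda>_. w) x = (\<Sum>k\<in>UNIV. \<Sum>l\<in>UNIV. (h k l * (N x \<bullet> hess f x w (v k))) *\<^sub>R v l)"
  unfolding shape_op_eq tang_frame[OF x hv]
  by (simp add: inner_commute[of "push f x (v _)"] along_normal_inner[OF x N normal] sum_negf)

text \<open>Ricci equation: the second derivatives of \<open>N\<close> cancel in the curvature, and only the derivatives of
  the tangential parts removed by the normal projection remain.\<close>

lemma flat_imp_shape_op_commute: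
  assumes flat: "flat_normal_on \<Omega> f" and x: "x \<in> \<Omega>"
    and N: "Cinf_on \<Omega> N" and normal: "\<And>y. y \<in> \<Omega> \<Longrightarrow> normal_at f y (N y)"
  shows "nor f x (hess f x v (shape_op f N (\<lambda>_. w) x)) = nor f x (hess f x w (shape_op f N (\<lambda>_. v) x))"
proof -
  have dN: "Cinf_on \<Omega> (along (\<lambda>_. w) N)" for w
    by (intro Cinf_on_along open\<Omega> N Cinf_on_const)
  have cc: "normal_conn f (\<lambda>_. v) (normal_conn f (\<lambda>_. w) N) x
      = nor f x (along (\<lambda>_. v) (along (\<lambda>_. w) N) x) - nor f x (- hess f x v (shape_op f N (\<lambda>_. w) x))" for v w
  proof -
    let ?\<tau> = "\<lambda>y. tang f y (along (\<lambda>_. w) N y)"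
    have \<tau>: "Cinf_on \<Omega> ?\<tau>" by (intro Cinf_tang dN)
    have "along (\<lambda>_. v) (\<lambda>y. nor f y (along (\<lambda>_. w) N y)) x
        = along (\<lambda>_. v) (along (\<lambda>_. w) N) x - (hess f x v (?\<tau> x) + push f x (along (\<lambda>_. v) ?\<tau> x))"
      unfolding nor_def
      by (simp add: along_diff[OF dN Cinf_push[OF \<tau>] x] along_push[OF x Cinf_on_const \<tau>])
    moreover have "hess f x v (?\<tau> x) = - hess f x v (shape_op f N (\<lambda>_. w) x)"
      by (simp add: shape_op_eq linear_neg[OF hess_linear_right[OF x]])
    ultimately have e: "along (\<lambda>_. v) (\<lambda>y. nor f y (along (\<lambda>_. w) N y)) x
        = along (\<lambda>_. v) (along (\<lambda>_. w) N) x - (- hess f x v (shape_op f N (\<lambda>_. w) x)) - push f x (along (\<lambda>_. v) ?\<tau> x)"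
      by simp
    show ?thesis
      unfolding normal_conn_def dir_deriv_eq_along e by (simp only: nor_diff[OF x] nor_of_push[OF x] diff_zero)
  qed
  have "normal_conn f (lie_bracket (\<lambda>_. v) (\<lambda>_. w)) N x = nor f x (frechet_derivative N (at x) 0)"
    by (simp add: normal_conn_def lie_bracket_def dir_deriv_eq_along) (simp add: along_def)
  also have "\<dots> = 0"
    using nor_of_push[OF x, of 0] by (simp add: linear_0[OF Cinf_on_frechet_linear[OF N x]] push_0[OF x])
  finally have lb: "normal_conn f (lie_bracket (\<lambda>_. v) (\<lambda>_. w)) N x = 0" .
  have sym: "along (\<lambda>_. v) (along (\<lambda>_. w) N) x = along (\<lambda>_. w) (along (\<lambda>_. v) N) x"
    using along_commutator[OF open\<Omega> Cinf_on_const Cinf_on_const N x, of v w]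
    by (simp add: linear_0[OF Cinf_on_frechet_linear[OF N x]])
  \<comment> \<open>Constant coordinate fields are enough as test fields: their bracket vanishes and
    the second derivatives of \<open>N\<close> along them commute.\<close>
  have "normal_curv f (\<lambda>_. v) (\<lambda>_. w) N x = 0"
    using flat x N normal unfolding flat_normal_on_def
    by (auto intro!: Cinf_on_imp_smooth_on open\<Omega> Cinf_on_const)
  then have "nor f x (- hess f x w (shape_op f N (\<lambda>_. v) x)) = nor f x (- hess f x v (shape_op f N (\<lambda>_. w) x))"
    unfolding normal_curv_def lb cc by (simp add: sym)
  then show ?thesis
    using nor_diff[OF x, of 0] nor_of_push[OF x, of 0] by (simp add: push_0[OF x])
qed

text \<open>The commutation of shape operators for the extension \<open>nor f y \<nu>\<close>,
  paired with \<xi>. Symmetry of \<open>h\<close> and of the Hessian turns exchanging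
  \<open>i\<close> and \<open>j\<close> into exchanging \<nu> and \<xi>.\<close>

lemma flat_imp_frame_commute:
  fixes v :: "'m \<Rightarrow> real ^ 'm"
  assumes flat: "flat_normal_on \<Omega> f" and x: "x \<in> \<Omega>"
    and hv: "\<And>k j. (\<Sum>l\<in>UNIV. h k l * (push f x (v l) \<bullet> push f x (v j))) = (if k = j then 1 else (0::real))"
    and sym: "\<And>k l. h k l = h l k"
  shows "(\<Sum>k\<in>UNIV. \<Sum>l\<in>UNIV. h k l * ((hess f x (v i) (v k) \<bullet> nor f x \<nu>) * (hess f x (v l) (v j) \<bullet> nor f x \<xi>)
     - (hess f x (v i) (v k) \<bullet> nor f x \<xi>) * (hess f x (v l) (v j) \<bullet> nor f x \<nu>))) = 0"
proof -
  let ?N = "\<lambda>y. nor f y \<nu>"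
  let ?a = "\<lambda>\<nu> i j. hess f x (v i) (v j) \<bullet> nor f x \<nu>"
  have N: "Cinf_on \<Omega> ?N" by (intro Cinf_nor Cinf_on_const)
  have fr: "shape_op f ?N (\<lambda>_. w) x = (\<Sum>k\<in>UNIV. \<Sum>l\<in>UNIV. (h k l * (nor f x \<nu> \<bullet> hess f x w (v k))) *\<^sub>R v l)" for w
    by (rule shape_op_frame[OF x N _ hv]) (rule normal_at_nor)
  have e: "hess f x (v j) (shape_op f ?N (\<lambda>_. v i) x) \<bullet> nor f x \<xi>
      = (\<Sum>k\<in>UNIV. \<Sum>l\<in>UNIV. h k l * (?a \<nu> i k * ?a \<xi> l j))" for i j
    unfolding fr
    by (simp add: linear_sum[OF hess_linear_right[OF x]] linear_cmul[OF hess_linear_right[OF x]]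
        inner_sum_left hess_sym[OF x, of "v j"] inner_commute[of "nor f x \<nu>"] mult.assoc)
  have "hess f x (v j) (shape_op f ?N (\<lambda>_. v i) x) \<bullet> nor f x \<xi> = hess f x (v i) (shape_op f ?N (\<lambda>_. v j) x) \<bullet> nor f x \<xi>"
    using flat_imp_shape_op_commute[OF flat x N normal_at_nor, of "v j" "v i"]
    by (simp add: nor_adjoint[OF x, symmetric])
  then have "(\<Sum>k\<in>UNIV. \<Sum>l\<in>UNIV. h k l * (?a \<nu> i k * ?a \<xi> l j)) = (\<Sum>k\<in>UNIV. \<Sum>l\<in>UNIV. h k l * (?a \<nu> j k * ?a \<xi> l i))"
    unfolding e .
  also have "\<dots> = (\<Sum>k\<in>UNIV. \<Sum>l\<in>UNIV. h k l * (?a \<xi> i k * ?a \<nu> l j))"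
  proof -
    have "h k l * (?a \<nu> j k * ?a \<xi> l i) = h l k * (?a \<xi> i l * ?a \<nu> k j)" for k l
      using sym[of k l] hess_sym[OF x, of "v j" "v k"] hess_sym[OF x, of "v l" "v i"] by simp
    then show ?thesis by (subst sum.swap) simp
  qed
  finally show ?thesis by (simp add: right_diff_distrib sum_subtractf)
qed

text \<open>Change of frame: with the vectors \<open>v k\<close> as columns of \<open>V\<close>, the
  inverse Gram matrix of the coordinate frame is \<open>V ** hM ** transpose V\<close>, so the trace
  may be taken in the frame \<open>v\<close>.\<close>

lemma mean_curv_frame:
  fixes v :: "'m \<Rightarrow> real ^ 'm"
  assumes x: "x \<in> \<Omega>"
    and hv: "\<And>k j. (\<Sum>l\<in>UNIV. h k l * (push f x (v l) \<bullet> push f x (v j))) = (if k = j then 1 else (0::real))"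
  shows "mean_curv f x \<bullet> \<nu> = (\<Sum>k\<in>UNIV. \<Sum>l\<in>UNIV. h k l * (hess f x (v k) (v l) \<bullet> nor f x \<nu>))"
proof -
  define V :: "real ^ 'm ^ 'm" where "V = (\<chi> i k. v k $ i)"
  define hM :: "real ^ 'm ^ 'm" where "hM = (\<chi> k l. h k l)"
  have "(hM ** (transpose V ** gram f x ** V)) $ k $ j = mat 1 $ k $ j" for k j
  proof -
    have "(transpose V ** gram f x ** V) $ l $ j = push f x (v l) \<bullet> push f x (v j)" for l j
    proof -
      have "(transpose V ** (gram f x ** V)) $ l $ j = (\<Sum>i\<in>UNIV. v l $ i * (push f x (axis i 1) \<bullet> push f x (v j)))"
        by (simp add: matrix_matrix_mult_def transpose_def V_def gram_vec[OF x])
      also have "\<dots> = push f x (v l) \<bullet> push f x (v j)"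
        by (subst (2) linear_expand_axis[OF push_linear[OF x]]) (simp add: inner_sum_left)
      finally show ?thesis by (simp add: matrix_mul_assoc)
    qed
    then show ?thesis
      by (simp add: hM_def mat_def matrix_matrix_mult_def[of "\<chi> k l. h k l"] hv)
  qed
  then have "(hM ** transpose V ** gram f x) ** V = mat 1"
    by (simp add: vec_eq_iff matrix_mul_assoc)
  then have "V ** (hM ** transpose V ** gram f x) = mat 1"
    using matrix_left_right_inverse by blast
  then have "(V ** hM ** transpose V) ** gram f x = mat 1"
    by (simp add: matrix_mul_assoc)
  then have gi: "gi x = V ** hM ** transpose V" by (rule matrix_inv_unique')
  let ?a = "\<lambda>i j. hess f x (axis i 1) (axis j 1) \<bullet> nor f x \<nu>"
  have av: "hess f x (v k) (v l) \<bullet> nor f x \<nu> = (\<Sum>i\<in>UNIV. \<Sum>j\<in>UNIV. v k $ i * v l $ j * ?a i j)" for k l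
    by (subst linear_expand_axis[OF hess_linear_left[OF x]], subst linear_expand_axis[OF hess_linear_right[OF x]])
      (simp add: inner_sum_left scaleR_sum_right sum_distrib_left mult_ac)
  have "mean_curv f x \<bullet> \<nu> = (\<Sum>i\<in>UNIV. \<Sum>j\<in>UNIV. gi x $ i $ j * ?a i j)"
    by (simp add: mean_curv_def second_ff_def dir_deriv_eq_along along_push_const inner_sum_left nor_adjoint[OF x])
  also have "\<dots> = (\<Sum>i\<in>UNIV. \<Sum>j\<in>UNIV. \<Sum>k\<in>UNIV. \<Sum>l\<in>UNIV. h k l * (v k $ i * v l $ j * ?a i j))"
  proof -
    have "gi x $ i $ j = (\<Sum>k\<in>UNIV. \<Sum>l\<in>UNIV. h k l * (v k $ i * v l $ j))" for i j
      unfolding gi by (simp add: matrix_matrix_mult_def V_def hM_def transpose_def sum_distrib_right)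
        (subst sum.swap, simp add: mult_ac)
    then show ?thesis by (simp add: sum_distrib_right mult.assoc)
  qed
  also have "\<dots> = (\<Sum>i\<in>UNIV. \<Sum>k\<in>UNIV. \<Sum>j\<in>UNIV. \<Sum>l\<in>UNIV. h k l * (v k $ i * v l $ j * ?a i j))"
    by (intro sum.cong refl sum.swap)
  also have "\<dots> = (\<Sum>k\<in>UNIV. \<Sum>i\<in>UNIV. \<Sum>j\<in>UNIV. \<Sum>l\<in>UNIV. h k l * (v k $ i * v l $ j * ?a i j))"
    by (rule sum.swap)
  also have "\<dots> = (\<Sum>k\<in>UNIV. \<Sum>i\<in>UNIV. \<Sum>l\<in>UNIV. \<Sum>j\<in>UNIV. h k l * (v k $ i * v l $ j * ?a i j))"
    by (intro sum.cong refl sum.swap)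
  also have "\<dots> = (\<Sum>k\<in>UNIV. \<Sum>l\<in>UNIV. \<Sum>i\<in>UNIV. \<Sum>j\<in>UNIV. h k l * (v k $ i * v l $ j * ?a i j))"
    by (intro sum.cong refl sum.swap)
  finally show ?thesis by (simp add: av sum_distrib_left)
qed

text \<open>Each derivative of the induced metric splits into two Hessian terms. By symmetry of the
  Hessian four of the six cancel in the Christoffel combination and the other two are equal.\<close>

lemma christoffel_eq:
  assumes x: "x \<in> \<Omega>"
  shows "christoffel (induced_metric f) x v w = tang f x (hess f x v w)"
proof -
  have d: "frechet_derivative (\<lambda>y. induced_metric f y w u) (at x) v
      = hess f x v w \<bullet> push f x u + push f x w \<bullet> hess f x v u" for v w u
    using along_inner[OF Cinf_push_const[of w] Cinf_push_const[of u] x, of "\<lambda>_. v"]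
    unfolding along_push_const by (simp add: along_def induced_metric_def)
  have r: "(frechet_derivative (\<lambda>y. induced_metric f y w u) (at x) v
      + frechet_derivative (\<lambda>y. induced_metric f y v u) (at x) w
      - frechet_derivative (\<lambda>y. induced_metric f y v w) (at x) u) / 2 = hess f x v w \<bullet> push f x u" for u
    unfolding d using hess_sym[OF x, of u v] hess_sym[OF x, of u w] hess_sym[OF x, of w v]
    by (simp add: inner_commute)
  show ?thesis
    unfolding christoffel_def r tang_def
    by (rule arg_cong[of _ _ The]) (auto simp: fun_eq_iff induced_metric_def inner_diff_left)
qed

text \<open>The right side is the covariant derivative of the second fundamental form in direction
  \<nu>: the ordinary derivative minus two Christoffel terms. In this shape it can be compared with
  frame derivatives.\<close>

lemma nabla_shape_at_inner:
  assumes x: "x \<in> \<Omega>" and \<nu>: "normal_at f x \<nu>"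
  shows "push f x (nabla_shape_at f x v \<nu> w) \<bullet> push f x u
     = along (\<lambda>_. v) (\<lambda>y. hess f y w u \<bullet> nor f y \<nu>) x
       - hess f x w (tang f x (hess f x v u)) \<bullet> \<nu> - hess f x (tang f x (hess f x v w)) u \<bullet> \<nu>"
proof -
  let ?N = "\<lambda>y. nor f y \<nu>"
  have N: "Cinf_on \<Omega> ?N" by (intro Cinf_nor Cinf_on_const)
  have N0: "nor f x \<nu> = \<nu>" by (rule nor_normal[OF x \<nu>])
  have si: "push f y (shape_op f ?N (\<lambda>_. w) y) \<bullet> push f y u = hess f y w u \<bullet> nor f y \<nu>" if "y \<in> \<Omega>" for y w u
    by (simp add: shape_op_inner[OF that N normal_at_nor] inner_commute[of "nor f y \<nu>"])
  let ?s = "shape_op f ?N (\<lambda>_. w)"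
  let ?M = "normal_conn f (\<lambda>_. v) ?N"
  have s: "Cinf_on \<Omega> ?s" by (rule Cinf_shape_op[OF N])
  have M: "Cinf_on \<Omega> ?M"
    unfolding normal_conn_def dir_deriv_eq_along by (intro Cinf_nor Cinf_on_along open\<Omega> N Cinf_on_const)
  have Mn: "normal_at f y (?M y)" if "y \<in> \<Omega>" for y
    unfolding normal_conn_def by (rule normal_at_nor[OF that])
  text \<open>The extension of \<open>\<nu>\<close> by normal projections is parallel at \<open>x\<close> since it differs from a constant
    by a tangent field that vanishes at \<open>x\<close>.\<close>
  have "?M x = 0"
  proof -
    let ?\<tau> = "\<lambda>y. tang f y \<nu>"
    have \<tau>: "Cinf_on \<Omega> ?\<tau>" by (intro Cinf_tang Cinf_on_const)
    have "along (\<lambda>_. v) ?N x = - (hess f x v (?\<tau> x) + push f x (along (\<lambda>_. v) ?\<tau> x))"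
      unfolding nor_def by (simp add: along_diff[OF Cinf_on_const Cinf_push[OF \<tau>] x] along_push[OF x Cinf_on_const \<tau>])
    also have "\<dots> = push f x (- along (\<lambda>_. v) ?\<tau> x)"
      by (simp add: tang_normal[OF x \<nu>] linear_0[OF hess_linear_right[OF x]] linear_neg[OF push_linear[OF x]])
    finally show ?thesis by (simp add: normal_conn_def dir_deriv_eq_along nor_of_push[OF x])
  qed
  then have M0: "push f x (shape_op f ?M (\<lambda>_. w) x) \<bullet> push f x u = 0"
    using shape_op_inner[OF x M Mn] by simp
  have lc: "levi_civita (induced_metric f) (\<lambda>_. v) (\<lambda>_. w) x = tang f x (hess f x v w)"
    by (simp add: levi_civita_def dir_deriv_eq_along christoffel_eq[OF x])
  have s2: "push f x (shape_op f ?N (levi_civita (induced_metric f) (\<lambda>_. v) (\<lambda>_. w)) x) \<bullet> push f x u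
      = hess f x (tang f x (hess f x v w)) u \<bullet> \<nu>"
  proof -
    have "shape_op f ?N (levi_civita (induced_metric f) (\<lambda>_. v) (\<lambda>_. w)) x = shape_op f ?N (\<lambda>_. tang f x (hess f x v w)) x"
      unfolding shape_op_eq along_def lc ..
    then show ?thesis by (simp add: si[OF x] N0)
  qed
  have s1: "push f x (levi_civita (induced_metric f) (\<lambda>_. v) ?s x) \<bullet> push f x u
      = along (\<lambda>_. v) (\<lambda>y. hess f y w u \<bullet> ?N y) x - hess f x w (tang f x (hess f x v u)) \<bullet> \<nu>"
  proof -
    have "along (\<lambda>_. v) (\<lambda>y. hess f y w u \<bullet> ?N y) x = along (\<lambda>_. v) (\<lambda>y. push f y (?s y) \<bullet> push f y u) x"
      by (rule along_cong[OF open\<Omega> x]) (simp add: si)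
    also have "\<dots> = (hess f x v (?s x) + push f x (along (\<lambda>_. v) ?s x)) \<bullet> push f x u + push f x (?s x) \<bullet> hess f x v u"
      by (simp add: along_inner[OF Cinf_push[OF s] Cinf_push_const x] along_push_const along_push[OF x Cinf_on_const s])
    \<comment> \<open>\<open>push f x (?s x)\<close> is tangent, so only the tangential part of the
      Hessian counts, and \<open>si\<close> applies to it.\<close>
    also have "push f x (?s x) \<bullet> hess f x v u = push f x (?s x) \<bullet> push f x (tang f x (hess f x v u))"
      using tang_inner[OF x, of "hess f x v u" "?s x"] by (simp only: inner_commute)
    also have "\<dots> = hess f x w (tang f x (hess f x v u)) \<bullet> \<nu>"
      by (simp add: si[OF x] N0)
    finally show ?thesis
      by (simp add: levi_civita_def dir_deriv_eq_along christoffel_eq[OF x] linear_add[OF push_linear[OF x]]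
          inner_add_left tang_inner[OF x])
  qed
  show ?thesis
    unfolding nabla_shape_at_def nabla_shape_def
    by (simp add: linear_diff[OF push_linear[OF x]] inner_diff_left s1 s2 M0)
qed

text \<open>The graph frame varies while \<open>nabla_shape_at\<close> is built from constant
  fields; expanding in the standard basis gives the product rule relating the two.\<close>

lemma along_hess_nor:
  assumes x: "x \<in> \<Omega>" and V: "Cinf_on \<Omega> V" and U: "Cinf_on \<Omega> U"
  shows "along Y (\<lambda>y. hess f y (V y) (U y) \<bullet> nor f y \<nu>) x
     = along (\<lambda>_. Y x) (\<lambda>y. hess f y (V x) (U x) \<bullet> nor f y \<nu>) x
       + hess f x (along Y V x) (U x) \<bullet> nor f x \<nu> + hess f x (V x) (along Y U x) \<bullet> nor f x \<nu>"
proof -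
  define \<alpha> where "\<alpha> a b y = hess f y (axis a 1) (axis b 1) \<bullet> nor f y \<nu>" for a b y
  have \<alpha>: "Cinf_on \<Omega> (\<alpha> a b)" for a b
    unfolding \<alpha>_def by (intro Cinf_on_inner open\<Omega> Cinf_hess Cinf_nor Cinf_on_const)
  have ex: "hess f y v u \<bullet> nor f y \<nu> = (\<Sum>a\<in>UNIV. \<Sum>b\<in>UNIV. (v $ a * u $ b) * \<alpha> a b y)" if "y \<in> \<Omega>" for y v u
    by (subst linear_expand_axis[OF hess_linear_left[OF that]], subst linear_expand_axis[OF hess_linear_right[OF that]])
      (simp add: inner_sum_left scaleR_sum_right sum_distrib_left mult_ac \<alpha>_def)
  have nth: "along Y (\<lambda>y. V y $ a) x = along Y V x $ a" if "Cinf_on \<Omega> V" for V :: "real ^ 'm \<Rightarrow> real ^ 'm" and Y a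
    unfolding along_def
    by (rule frechet_derivative_eqI[OF bounded_linear.has_derivative[OF bounded_linear_vec_nth Cinf_on_has_derivative[OF that x]]])
  have D: "along Y (\<lambda>y. hess f y (V y) (U y) \<bullet> nor f y \<nu>) x = (\<Sum>a\<in>UNIV. \<Sum>b\<in>UNIV. (along Y V x $ a * U x $ b) * \<alpha> a b x)
     + (\<Sum>a\<in>UNIV. \<Sum>b\<in>UNIV. (V x $ a * along Y U x $ b) * \<alpha> a b x) + (\<Sum>a\<in>UNIV. \<Sum>b\<in>UNIV. (V x $ a * U x $ b) * along Y (\<alpha> a b) x)"
    if V: "Cinf_on \<Omega> V" and U: "Cinf_on \<Omega> U" for V U and Y :: "real ^ 'm \<Rightarrow> real ^ 'm"
  proof -
    have "along Y (\<lambda>y. hess f y (V y) (U y) \<bullet> nor f y \<nu>) x = along Y (\<lambda>y. \<Sum>a\<in>UNIV. \<Sum>b\<in>UNIV. (V y $ a * U y $ b) * \<alpha> a b y) x"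
      by (rule along_cong[OF open\<Omega> x ex])
    also have "\<dots> = (\<Sum>a\<in>UNIV. along Y (\<lambda>y. \<Sum>b\<in>UNIV. (V y $ a * U y $ b) * \<alpha> a b y) x)"
      by (intro along_sum[OF _ x] Cinf_on_intros open\<Omega> \<alpha> V U)
    also have "\<dots> = (\<Sum>a\<in>UNIV. \<Sum>b\<in>UNIV. along Y (\<lambda>y. (V y $ a * U y $ b) * \<alpha> a b y) x)"
      by (intro sum.cong refl along_sum[OF _ x] Cinf_on_intros open\<Omega> \<alpha> V U)
    also have "\<dots> = (\<Sum>a\<in>UNIV. \<Sum>b\<in>UNIV. (along Y V x $ a * U x $ b + V x $ a * along Y U x $ b) * \<alpha> a b x
        + (V x $ a * U x $ b) * along Y (\<alpha> a b) x)"
      by (simp add: along_mult[OF Cinf_on_mult[OF open\<Omega> Cinf_on_nth[OF open\<Omega> V] Cinf_on_nth[OF open\<Omega> U]] \<alpha> x]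
          along_mult[OF Cinf_on_nth[OF open\<Omega> V] Cinf_on_nth[OF open\<Omega> U] x] nth[OF V] nth[OF U])
    finally show ?thesis by (simp add: distrib_right sum.distrib)
  qed
  have "along (\<lambda>_. Y x) (\<alpha> a b) x = along Y (\<alpha> a b) x" for a b by (simp add: along_def)
  then show ?thesis
    unfolding D[OF V U] D[OF Cinf_on_const Cinf_on_const] ex[OF x] by simp
qed

lemma along_hess_linear:
  assumes x: "x \<in> \<Omega>"
  shows "linear (\<lambda>w. along Y (\<lambda>y. hess f y w u \<bullet> nor f y \<nu>) x)"
proof -
  have c: "Cinf_on \<Omega> (\<lambda>y. hess f y w u \<bullet> nor f y \<nu>)" for w
    by (intro Cinf_on_inner open\<Omega> Cinf_hess Cinf_nor Cinf_on_const)
  show ?thesis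
  proof (rule linearI)
    fix w w'
    have "along Y (\<lambda>y. hess f y (w + w') u \<bullet> nor f y \<nu>) x
        = along Y (\<lambda>y. hess f y w u \<bullet> nor f y \<nu> + hess f y w' u \<bullet> nor f y \<nu>) x"
      by (rule along_cong[OF open\<Omega> x]) (simp add: linear_add[OF hess_linear_left] inner_add_left)
    then show "along Y (\<lambda>y. hess f y (w + w') u \<bullet> nor f y \<nu>) x
        = along Y (\<lambda>y. hess f y w u \<bullet> nor f y \<nu>) x + along Y (\<lambda>y. hess f y w' u \<bullet> nor f y \<nu>) x"
      by (simp add: along_add[OF c c x])
  next
    fix r w
    have "along Y (\<lambda>y. hess f y (r *\<^sub>R w) u \<bullet> nor f y \<nu>) x = along Y (\<lambda>y. r * (hess f y w u \<bullet> nor f y \<nu>)) x"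
      by (rule along_cong[OF open\<Omega> x]) (simp add: linear_cmul[OF hess_linear_left])
    then show "along Y (\<lambda>y. hess f y (r *\<^sub>R w) u \<bullet> nor f y \<nu>) x = r *\<^sub>R along Y (\<lambda>y. hess f y w u \<bullet> nor f y \<nu>) x"
      by (simp add: along_mult[OF Cinf_on_const c x])
  qed
qed

lemma tang_linear: "x \<in> \<Omega> \<Longrightarrow> linear (tang f x)"
  by (intro linearI tang_eqI)
    (simp_all add: linear_add[OF push_linear] linear_cmul[OF push_linear] inner_diff_left inner_add_left tang_inner)

text \<open>The definition hides linearity behind connections; it is read off the pairing formula,
  whose terms are linear one by one.\<close>

lemma nabla_shape_at_linear:
  assumes x: "x \<in> \<Omega>" and \<nu>: "normal_at f x \<nu>"
  shows "linear (nabla_shape_at f x v \<nu>)"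
proof -
  note l = linear_add[OF along_hess_linear[OF x]] linear_add[OF hess_linear_left[OF x]] linear_add[OF hess_linear_right[OF x]]
    linear_add[OF tang_linear[OF x]] linear_add[OF push_linear[OF x]]
    linear_cmul[OF along_hess_linear[OF x]] linear_cmul[OF hess_linear_left[OF x]] linear_cmul[OF hess_linear_right[OF x]]
    linear_cmul[OF tang_linear[OF x]] linear_cmul[OF push_linear[OF x]]
  show ?thesis
    by (intro linearI push_eqI[OF x])
      (simp_all add: l inner_add_left nabla_shape_at_inner[OF x \<nu>] algebra_simps)
qed

lemma orthonormal_expand:
  assumes x: "x \<in> \<Omega>" and e: "orthonormal_at f x e"
  shows "w = (\<Sum>k\<in>UNIV. (push f x w \<bullet> push f x (e k)) *\<^sub>R e k)"
proof -
  have "(\<Sum>l\<in>UNIV. (if k = l then 1 else 0) * (push f x (e l) \<bullet> push f x (e j))) = (if k = j then 1 else 0)" for k j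
    using e by (simp add: sum_delta_mult orthonormal_at_def induced_metric_def)
  from tang_frame[OF x this, of "push f x w"] show ?thesis
    by (simp add: tang_push[OF x] inner_commute eq_commute if_distrib[of "\<lambda>c. (c * _) *\<^sub>R _"] cong: if_cong)
qed

lemma C_endo_eq_0:
  assumes x: "x \<in> \<Omega>" and \<nu>: "normal_at f x \<nu>" and \<xi>: "normal_at f x \<xi>" and e: "orthonormal_at f x e"
    and B: "\<And>\<nu> q i j. B q \<nu> $ i $ j = push f x (nabla_shape_at f x (e q) \<nu> (e i)) \<bullet> push f x (e j)"
    and 0: "\<And>i j. (\<Sum>q\<in>UNIV. (B q \<nu> ** B q \<xi> - B q \<xi> ** B q \<nu>) $ i $ j) = (0::real)"
  shows "C_endo f x e \<nu> \<xi> = (\<lambda>w. 0)"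
proof -
  let ?N = "\<lambda>q. nabla_shape_at f x (e q)"
  note lin = nabla_shape_at_linear[OF x \<nu>] nabla_shape_at_linear[OF x \<xi>]
  \<comment> \<open>Rows of \<open>B\<close> carry the argument of the endomorphism, so composition
    reverses the matrix product; hence the minus sign in \<open>C\<close>.\<close>
  have NN: "push f x (?N q \<nu>1 (?N q \<nu>2 (e i))) \<bullet> push f x (e j) = (B q \<nu>2 ** B q \<nu>1) $ i $ j"
    if "normal_at f x \<nu>1" for q \<nu>1 \<nu>2 i j
  proof -
    note l = nabla_shape_at_linear[OF x that]
    have "?N q \<nu>2 (e i) = (\<Sum>k\<in>UNIV. B q \<nu>2 $ i $ k *\<^sub>R e k)"
      using orthonormal_expand[OF x e, of "?N q \<nu>2 (e i)"] by (simp add: B)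
    then have "?N q \<nu>1 (?N q \<nu>2 (e i)) = (\<Sum>k\<in>UNIV. B q \<nu>2 $ i $ k *\<^sub>R ?N q \<nu>1 (e k))"
      by (simp add: linear_sum_scaleR[OF l])
    then show ?thesis
      by (simp add: linear_sum_scaleR[OF push_linear[OF x]] inner_sum_left B matrix_matrix_mult_def)
  qed
  have C: "C_endo f x e \<nu> \<xi> (e i) = 0" for i
  proof -
    have "push f x (C_endo f x e \<nu> \<xi> (e i)) \<bullet> push f x (e j)
        = - (\<Sum>q\<in>UNIV. (B q \<nu> ** B q \<xi> - B q \<xi> ** B q \<nu>) $ i $ j)" for j
      by (simp add: C_endo_def commutator_def linear_sum[OF push_linear[OF x]] linear_diff[OF push_linear[OF x]]
          inner_sum_left inner_diff_left NN[OF \<nu>] NN[OF \<xi>] sum_negf[symmetric])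
    then have "push f x (C_endo f x e \<nu> \<xi> (e i)) \<bullet> push f x (e j) = 0" for j
      by (simp only: 0 minus_zero)
    then show ?thesis
      using orthonormal_expand[OF x e, of "C_endo f x e \<nu> \<xi> (e i)"] by simp
  qed
  have "linear (C_endo f x e \<nu> \<xi>)"
    by (rule linearI) (simp_all add: C_endo_def commutator_def linear_add[OF lin(1)] linear_add[OF lin(2)]
        linear_cmul[OF lin(1)] linear_cmul[OF lin(2)] sum.distrib[symmetric] scaleR_sum_right scaleR_diff_right algebra_simps)
  then have z: "C_endo f x e \<nu> \<xi> (\<Sum>k\<in>UNIV. c k *\<^sub>R e k) = 0" for c
    by (simp add: linear_sum_scaleR C)
  show ?thesis
  proof
    fix w
    show "C_endo f x e \<nu> \<xi> w = 0"
      by (subst orthonormal_expand[OF x e]) (rule z)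
  qed
qed

end

section \<open>The graph frame of a flow\<close>

lemma frechet_derivative_slice:
  assumes "Cinf_on U g" "(x, t) \<in> U"
  shows "frechet_derivative (\<lambda>y. g (y, t)) (at x) v = frechet_derivative g (at (x, t)) (v, 0)"
proof -
  have "((\<lambda>y. (y, t)) has_derivative (\<lambda>v. (v, 0))) (at x)"
    by (auto intro!: derivative_eq_intros)
  from diff_chain_at[OF this Cinf_on_has_derivative[OF assms]] show ?thesis
    by (auto simp: o_def intro: frechet_derivative_eqI)
qed

lemma open_slice: "open U \<Longrightarrow> open {y. (y, t) \<in> U}"
  using open_vimage[of U "\<lambda>y. (y, t)"] by (simp add: vimage_def continuous_intros)

text \<open>\<open>G\<close> extends the flow smoothly beyond time zero, so that two-sided
  derivatives exist at \<open>t = 0\<close>; it is tied to the flow only where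
  \<open>0 \<le> t\<close> and \<open>t < r\<close>.\<close>

locale flow_chart =
  fixes \<Omega> :: "(real ^ 'm::finite) set" and r :: real and f :: "real \<Rightarrow> real ^ 'm \<Rightarrow> real ^ 'n::finite"
    and W0 :: "((real ^ 'm) \<times> real) set" and G :: "(real ^ 'm) \<times> real \<Rightarrow> real ^ 'n"
    and x0 :: "real ^ 'm" and e :: "'m \<Rightarrow> real ^ 'm"
  assumes r: "0 < r"
    and imm: "\<And>t. 0 \<le> t \<Longrightarrow> t < r \<Longrightarrow> immersed \<Omega> (f t)"
    and W0: "open W0" "(x0, 0) \<in> W0" and G: "Cinf_on W0 G"
    and Gf: "\<And>x t. (x, t) \<in> W0 \<Longrightarrow> x \<in> \<Omega> \<Longrightarrow> 0 \<le> t \<Longrightarrow> t < r \<Longrightarrow> G (x, t) = f t x"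
    and x0: "x0 \<in> \<Omega>" and e: "orthonormal_at (f 0) x0 e"
    and evol: "\<And>x. x \<in> \<Omega> \<Longrightarrow>
        ((\<lambda>t. f t x) has_vector_derivative mean_curv (f 0) x) (at 0 within {0..<r})"
    and flat0: "flat_normal_on \<Omega> (f 0)"
begin

sublocale f0: immersed \<Omega> "f 0"
  using imm[of 0] r by simp

text \<open>\<open>J\<close> is the Jacobian of the graph coordinates \<open>x \<mapsto> (f 0 x \<bullet> c m)\<^sub>m\<close>, and the columns \<open>Xf\<close> of its
  inverse are their coordinate fields.\<close>

definition "c m = push (f 0) x0 (e m)"
definition "J x = (\<chi> m k. push (f 0) x (axis k 1) \<bullet> c m)"
definition "\<Omega>' = {x \<in> \<Omega>. det (J x) \<noteq> 0}"
definition "Xf j x = (\<chi> i. matrix_inv (J x) $ i $ j)"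
text \<open>No time component and no dependence on time: the fields are tangent to the time slices
  and commute with \<open>T\<close>.\<close>

definition "X j z = (Xf j (fst z), 0 :: real)" for z :: "(real ^ 'm) \<times> real"
definition "Gm z = (\<chi> k l. along (X k) G z \<bullet> along (X l) G z)"
definition "h k l z = matrix_inv (Gm z) $ k $ l"
definition "W1 = {z \<in> W0. fst z \<in> \<Omega>' \<and> snd z < r}"
text \<open>For negative times \<open>G\<close> need not be an immersion, so invertibility of its
  Gram matrix is secured by shrinking the domain.\<close>

definition "W = {z \<in> W1. det (Gm z) \<noteq> 0}"
definition "S = {z \<in> W. snd z = 0}"
definition "T z = (0 :: real ^ 'm, 1 :: real)" for z :: "(real ^ 'm) \<times> real"

lemma \<Omega>'_subset: "x \<in> \<Omega>' \<Longrightarrow> x \<in> \<Omega>" by (simp add: \<Omega>'_def)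

lemma Cinf_J: "Cinf_on \<Omega> (\<lambda>x. J x $ i $ j)"
  by (simp add: J_def) (intro Cinf_on_intros f0.open\<Omega> f0.Cinf_push)

lemma open_det: "open {x \<in> U. det (A x) \<noteq> 0}"
  if "open U" "\<And>i j. Cinf_on U (\<lambda>x. A x $ i $ j)" for U and A :: "'a::euclidean_space \<Rightarrow> real ^ 'm ^ 'm"
proof -
  have "open (U \<inter> (\<lambda>x. det (A x)) -` (- {0}))"
    by (intro continuous_open_preimage Cinf_on_continuous Cinf_on_det that) auto
  moreover have "U \<inter> (\<lambda>x. det (A x)) -` (- {0}) = {x \<in> U. det (A x) \<noteq> 0}" by auto
  ultimately show ?thesis by simp
qed

lemma open\<Omega>': "open \<Omega>'"
  unfolding \<Omega>'_def by (rule open_det[OF f0.open\<Omega> Cinf_J])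

lemma imm': "0 \<le> t \<Longrightarrow> t < r \<Longrightarrow> immersed \<Omega>' (f t)"
  using imm[of t] open\<Omega>' \<Omega>'_subset Cinf_on_subset[of \<Omega> "f t" \<Omega>']
  by (auto simp: immersed_def subset_iff)

lemma Cinf_Xf: "Cinf_on \<Omega>' (Xf j)"
  unfolding Xf_def
  by (intro Cinf_on_vec open\<Omega>' Cinf_on_matrix_inv Cinf_on_subset[OF Cinf_J]) (auto simp: \<Omega>'_def)

lemma J_vec: "x \<in> \<Omega> \<Longrightarrow> (J x *v v) $ m = push (f 0) x v \<bullet> c m"
  by (subst linear_expand_axis[OF f0.push_linear, of x v])
    (simp_all add: matrix_vector_mult_def J_def inner_sum_left mult_ac)

lemma J_Xf: "x \<in> \<Omega>' \<Longrightarrow> push (f 0) x (Xf j x) \<bullet> c m = (if j = m then 1 else 0)"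
proof -
  assume x: "x \<in> \<Omega>'"
  then have d: "det (J x) \<noteq> 0" by (simp add: \<Omega>'_def)
  have "(J x ** matrix_inv (J x)) $ m $ j = (if j = m then 1 else 0)"
    unfolding matrix_inv_inverse(1)[OF d] by (auto simp: mat_def)
  then show ?thesis
    unfolding J_vec[OF \<Omega>'_subset[OF x], symmetric]
    by (simp add: matrix_matrix_mult_def matrix_vector_mult_def Xf_def)
qed

lemma c_ortho: "c i \<bullet> c j = (if i = j then 1 else 0)"
  using e by (simp add: c_def orthonormal_at_def induced_metric_def)

lemma J_x0: "matrix_inv (J x0) = (\<chi> i j. e j $ i)" and x0': "x0 \<in> \<Omega>'"
proof -
  let ?B = "\<chi> i j. e j $ i"
  have "(J x0 ** ?B) $ m $ j = (if j = m then 1 else 0)" for m j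
    using J_vec[OF x0, of "e j" m] c_ortho[of j m]
    by (simp add: c_def matrix_matrix_mult_def matrix_vector_mult_def)
  then have "J x0 ** ?B = mat 1" by (simp add: vec_eq_iff mat_def eq_commute)
  then have B: "?B ** J x0 = mat 1" using matrix_left_right_inverse by blast
  then show "matrix_inv (J x0) = ?B" by (rule matrix_inv_unique')
  have "det ?B * det (J x0) = 1" using B by (metis det_I det_mul)
  then show "x0 \<in> \<Omega>'" using x0 by (auto simp: \<Omega>'_def)
qed

lemma Xf_x0: "Xf j x0 = e j"
  by (simp add: Xf_def J_x0 vec_eq_iff)

lemma open_W1: "open W1"
proof -
  have "W1 = W0 \<inter> fst -` \<Omega>' \<inter> snd -` {..<r}" by (auto simp: W1_def)
  then show ?thesis by (auto intro!: open_Int open_vimage W0 open\<Omega>' continuous_intros)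
qed

lemma W1_W0: "W1 \<subseteq> W0" by (auto simp: W1_def)

lemma Cinf_X: "Cinf_on W1 (X j)"
proof -
  have "Cinf_on W1 (\<lambda>z. Xf j (0 + fst z))"
    by (rule Cinf_on_affine[OF open_W1 bounded_linear_fst Cinf_Xf]) (auto simp: W1_def)
  then show ?thesis
    unfolding X_def using Cinf_on_Pair0[OF open_W1] by simp
qed

lemma Cinf_G: "Cinf_on W1 G" by (rule Cinf_on_subset[OF G W1_W0])

lemma Cinf_P: "Cinf_on W1 (along (X j) G)"
  by (intro Cinf_on_along open_W1 Cinf_X Cinf_G)

lemma Cinf_Gm: "Cinf_on W1 (\<lambda>z. Gm z $ i $ j)"
  by (simp add: Gm_def) (intro Cinf_on_inner open_W1 Cinf_P)

lemma open_W: "open W"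
  unfolding W_def by (rule open_det[OF open_W1 Cinf_Gm])

lemma W_W1: "W \<subseteq> W1" by (auto simp: W_def)

lemma Cinf_h: "Cinf_on W (h k l)"
  unfolding h_def
  by (rule Cinf_on_matrix_inv[OF open_W Cinf_on_subset[OF Cinf_Gm W_W1]]) (simp add: W_def)

lemma along_slice:
  "Cinf_on U g \<Longrightarrow> (x, t) \<in> U \<Longrightarrow> along (X i) g (x, t) = along (Xf i) (\<lambda>y. g (y, t)) x"
  by (simp add: along_def X_def frechet_derivative_slice)

lemma frame_push: "(x, t) \<in> W1 \<Longrightarrow> 0 \<le> t \<Longrightarrow> along (X k) G (x, t) = push (f t) x (Xf k x)"
proof -
  assume z: "(x, t) \<in> W1" and t: "0 \<le> t"
  have "along (Xf k) (\<lambda>y. G (y, t)) x = along (Xf k) (f t) x"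
    by (rule along_cong[OF open_slice[OF open_W1, of t]])
      (use z t in \<open>auto simp: W1_def \<Omega>'_subset intro!: Gf\<close>)
  then show ?thesis
    unfolding along_slice[OF Cinf_G z] by (simp add: along_def push_def)
qed

lemma frame_hess:
  assumes z: "(x, t) \<in> W1" and t: "0 \<le> t"
  shows "along (X i) (along (X j) G) (x, t)
    = hess (f t) x (Xf i x) (Xf j x) + push (f t) x (along (Xf i) (Xf j) x)"
proof -
  interpret ft: immersed \<Omega>' "f t" using imm'[of t] z t by (simp add: W1_def)
  have x: "x \<in> \<Omega>'" using z by (simp add: W1_def)
  have "along (X i) (along (X j) G) (x, t) = along (Xf i) (\<lambda>y. along (X j) G (y, t)) x"
    by (rule along_slice[OF Cinf_P z])
  also have "\<dots> = along (Xf i) (\<lambda>y. push (f t) y (Xf j y)) x"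
    by (rule along_cong[OF open_slice[OF open_W1, of t]]) (use z t in \<open>auto intro: frame_push\<close>)
  also have "\<dots> = hess (f t) x (Xf i x) (Xf j x) + push (f t) x (along (Xf i) (Xf j) x)"
    by (rule ft.along_push[OF x Cinf_Xf Cinf_Xf])
  finally show ?thesis .
qed

lemma h_inverse: "z \<in> W \<Longrightarrow> (\<Sum>l\<in>UNIV. h k l z * (along (X l) G z \<bullet> along (X j) G z)) = (if k = j then 1 else 0)"
proof -
  assume "z \<in> W"
  then have "(matrix_inv (Gm z) ** Gm z) $ k $ j = mat 1 $ k $ j"
    using matrix_inv_inverse(2)[of "Gm z"] by (simp add: W_def)
  moreover have "Gm z $ l $ j = along (X l) G z \<bullet> along (X j) G z" for l by (simp add: Gm_def)
  ultimately show ?thesis by (simp add: matrix_matrix_mult_def h_def mat_def split: if_splits)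
qed

lemma h_sym: "z \<in> W \<Longrightarrow> h k l z = h l k z"
  unfolding h_def
  by (rule matrix_inv_sym) (simp_all add: W_def transpose_def Gm_def vec_eq_iff inner_commute)

text \<open>The term of \<open>frame_hess\<close> with derivatives of the frame is tangential and is
  removed by the normal projection; hence the frame expressions are the geometric ones.\<close>

lemma frame_geometry:
  assumes z: "(x, t) \<in> W" and t: "0 \<le> t"
  shows "frame_nor X G h \<nu> (x, t) = nor (f t) x \<nu>"
    and "frame_sff X G h \<nu> i j (x, t) = hess (f t) x (Xf i x) (Xf j x) \<bullet> nor (f t) x \<nu>"
    and "flat_normal_on \<Omega> (f t) \<Longrightarrow> frame_curv X G h \<nu> \<xi> i j (x, t) = 0"
    and "mean_curv (f t) x \<bullet> \<nu> = (\<Sum>k\<in>UNIV. \<Sum>l\<in>UNIV. h k l (x, t) * frame_sff X G h \<nu> k l (x, t))"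
proof -
  have z1: "(x, t) \<in> W1" using z W_W1 by blast
  interpret ft: immersed \<Omega> "f t" using imm[of t] z1 t by (simp add: W1_def)
  have x: "x \<in> \<Omega>" using z1 by (simp add: W1_def \<Omega>'_subset)
  note p = frame_push[OF z1 t]
  have hv: "(\<Sum>l\<in>UNIV. h k l (x, t) * (push (f t) x (Xf l x) \<bullet> push (f t) x (Xf j x))) = (if k = j then 1 else 0)" for k j
    using h_inverse[OF z] by (simp add: p)
  note sym = h_sym[OF z]
  show n: "frame_nor X G h \<nu> (x, t) = nor (f t) x \<nu>" for \<nu>
    unfolding frame_nor_def p by (rule ft.nor_frame[OF x hv, symmetric])
  show s: "frame_sff X G h \<nu> i j (x, t) = hess (f t) x (Xf i x) (Xf j x) \<bullet> nor (f t) x \<nu>" for \<nu> i j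
    unfolding frame_sff_def n frame_hess[OF z1 t] by (simp add: inner_add_left ft.nor_push[OF x])
  show "frame_curv X G h \<nu> \<xi> i j (x, t) = 0" if "flat_normal_on \<Omega> (f t)"
    unfolding frame_curv_def s by (rule ft.flat_imp_frame_commute[OF that x hv sym])
  show "mean_curv (f t) x \<bullet> \<nu> = (\<Sum>k\<in>UNIV. \<Sum>l\<in>UNIV. h k l (x, t) * frame_sff X G h \<nu> k l (x, t))"
    unfolding s by (rule ft.mean_curv_frame[OF x hv])
qed

text \<open>The flow has a one-sided time derivative at its initial time and \<open>G\<close> a
  two-sided one; both are derivatives within \<open>{0..<r}\<close> and therefore agree.\<close>

lemma along_T_G: "(x, 0) \<in> W1 \<Longrightarrow> along T G (x, 0) = mean_curv (f 0) x"
proof -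
  assume z: "(x, 0) \<in> W1"
  then have x: "x \<in> \<Omega>" and zW0: "(x, 0) \<in> W0" by (auto simp: W1_def \<Omega>'_subset)
  have "((\<lambda>t. (x, t)) has_derivative (\<lambda>s. (0, s))) (at (0::real))"
    by (auto intro!: derivative_eq_intros)
  from diff_chain_at[OF this Cinf_on_has_derivative[OF Cinf_G z]]
  have d: "((\<lambda>t. G (x, t)) has_derivative (\<lambda>s. frechet_derivative G (at (x, 0)) (0, s))) (at 0)"
    by (simp add: o_def)
  have "frechet_derivative G (at (x, 0)) (0, s) = s *\<^sub>R along T G (x, 0)" for s
    using linear_cmul[OF Cinf_on_frechet_linear[OF Cinf_G z], of s "(0, 1)"]
    by (simp add: along_def T_def)
  then have "((\<lambda>t. G (x, t)) has_vector_derivative along T G (x, 0)) (at 0 within {0..<r})"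
    using d by (simp add: has_vector_derivative_def has_derivative_at_withinI)
  moreover have "((\<lambda>t. G (x, t)) has_vector_derivative mean_curv (f 0) x) (at 0 within {0..<r})"
  proof -
    have "open {t. (x, t) \<in> W0}"
      using open_vimage[OF W0(1), of "\<lambda>t. (x, t)"] by (simp add: vimage_def continuous_intros)
    then obtain d where d: "d > 0" "ball 0 d \<subseteq> {t. (x, t) \<in> W0}" using zW0 openE by blast
    show ?thesis
      by (rule has_vector_derivative_transform_within[OF evol[OF x] d(1)])
        (use r d x in \<open>auto intro!: Gf[symmetric] simp: dist_commute subset_iff\<close>)
  qed
  moreover have "at (0::real) within {0..<r} \<noteq> bot"
  proof -
    have "{0..<r} - {0} = {0<..<r}" by auto
    then show ?thesis using r by (simp add: at_within_eq_bot_iff)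
  qed
  ultimately show ?thesis
    by (rule vector_derivative_unique_within[rotated])
qed

text \<open>Each graph coordinate \<open>?y\<close> has constant derivatives along the frame, so the
  bracket annihilates all of them; invertibility of \<open>J x\<close> then forces it to be
  zero.\<close>

lemma Xf_bracket: "x \<in> \<Omega>' \<Longrightarrow> along (Xf i) (Xf j) x = along (Xf j) (Xf i) x"
proof -
  assume x: "x \<in> \<Omega>'"
  let ?b = "along (Xf i) (Xf j) x - along (Xf j) (Xf i) x"
  have f: "Cinf_on \<Omega>' (f 0)" by (rule Cinf_on_subset[OF f0.f]) (auto simp: \<Omega>'_def)
  have "push (f 0) x ?b \<bullet> c m = 0" for m
  proof -
    let ?y = "\<lambda>x. f 0 x \<bullet> c m"
    have y: "Cinf_on \<Omega>' ?y" by (intro Cinf_on_inner open\<Omega>' f Cinf_on_const)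
    have dy: "along V ?y x = push (f 0) x (V x) \<bullet> c m" if "x \<in> \<Omega>'" for V x
      using along_inner[OF f Cinf_on_const that, of V "c m"] by (simp add: along_def push_def)
    have "along (Xf i) (along (Xf j) ?y) x = 0" for i j
    proof -
      have "along (Xf i) (along (Xf j) ?y) x = along (Xf i) (\<lambda>x. if j = m then 1 else 0 :: real) x"
        by (rule along_cong[OF open\<Omega>' x]) (simp add: dy J_Xf)
      then show ?thesis by simp
    qed
    then have "frechet_derivative ?y (at x) ?b = 0"
      using along_commutator[OF open\<Omega>' Cinf_Xf Cinf_Xf y x, of i j] by simp
    then show ?thesis
      using dy[OF x, of "\<lambda>_. ?b"] by (simp add: along_def)
  qed
  then have "J x *v ?b = 0" by (simp add: vec_eq_iff J_vec[OF \<Omega>'_subset[OF x]])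
  then have "matrix_inv (J x) *v (J x *v ?b) = 0" by simp
  then have "?b = 0"
    using x by (simp add: matrix_vector_mul_assoc matrix_inv_inverse(2) \<Omega>'_def)
  then show ?thesis by simp
qed

lemma along_X: "z \<in> W1 \<Longrightarrow> along Y (X j) z = (frechet_derivative (Xf j) (at (fst z)) (fst (Y z)), 0)"
proof -
  assume z: "z \<in> W1"
  have "((\<lambda>z. Xf j (fst z)) has_derivative (\<lambda>v. frechet_derivative (Xf j) (at (fst z)) (fst v))) (at z)"
    using diff_chain_at[OF bounded_linear_imp_has_derivative[OF bounded_linear_fst]
        Cinf_on_has_derivative[OF Cinf_Xf, of "fst z" j]] z
    by (simp add: W1_def o_def)
  then have "(X j has_derivative (\<lambda>v. (frechet_derivative (Xf j) (at (fst z)) (fst v), 0))) (at z)"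
    unfolding X_def by (intro has_derivative_Pair has_derivative_const)
  then show ?thesis unfolding along_def by (rule frechet_derivative_eqI)
qed

lemma W_W1': "z \<in> W \<Longrightarrow> z \<in> W1" using W_W1 by blast

lemma p_W: "(x0, 0) \<in> W"
proof -
  have z: "(x0, 0) \<in> W1" using W0 x0' r by (simp add: W1_def)
  have "Gm (x0, 0) = mat 1"
    by (simp add: vec_eq_iff Gm_def frame_push[OF z] Xf_x0 c_def[symmetric] c_ortho mat_def)
  then show ?thesis using z by (simp add: W_def)
qed

lemma Cinf_T: "Cinf_on U T"
  unfolding T_def by (rule Cinf_on_const)

sublocale flowing_frame W S "(x0, 0)" X T G h
proof
  show "open W" by (rule open_W)
  show "S \<subseteq> W" by (auto simp: S_def)
  show "(x0, 0) \<in> S" using p_W by (simp add: S_def)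
  show XW: "Cinf_on W (X i)" for i by (rule Cinf_on_subset[OF Cinf_X W_W1])
  show TW: "Cinf_on W T" by (rule Cinf_T)
  show "Cinf_on W G" by (rule Cinf_on_subset[OF Cinf_G W_W1])
  show "Cinf_on W (h k l)" for k l by (rule Cinf_h)
  fix z
  show "along (X i) (along (X j) g) z = along (X j) (along (X i) g) z"
    if g: "Cinf_on W g" and z: "z \<in> W" for g :: "(real ^ 'm) \<times> real \<Rightarrow> real ^ 'n" and i j
  proof -
    have "along (X i) (X j) z = along (X j) (X i) z"
      using Xf_bracket[of "fst z" i j] z W_W1'[OF z]
      by (simp add: along_X) (simp add: W1_def along_def X_def)
    then show ?thesis
      using along_commutator[OF open_W XW XW g z, of i j] by (simp add: linear_0[OF Cinf_on_frechet_linear[OF g z]])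
  qed
  show "along T (along (X i) g) z = along (X i) (along T g) z"
    if g: "Cinf_on W g" and z: "z \<in> W" for g :: "(real ^ 'm) \<times> real \<Rightarrow> real ^ 'n" and i
  proof -
    have "fst z \<in> \<Omega>'" using W_W1'[OF z] by (simp add: W1_def)
    then have "along T (X i) z = 0"
      using W_W1'[OF z] linear_0[OF Cinf_on_frechet_linear[OF Cinf_Xf]]
      by (simp add: along_X T_def zero_prod_def)
    moreover have "along (X i) T z = 0" unfolding T_def by simp
    ultimately show ?thesis
      using along_commutator[OF open_W TW XW g z, of i] by (simp add: linear_0[OF Cinf_on_frechet_linear[OF g z]])
  qed
  show "along (X i) g z = 0"
    if g: "Cinf_on W g" and g0: "\<And>y. y \<in> S \<Longrightarrow> g y = 0" and z: "z \<in> S" for g :: "(real ^ 'm) \<times> real \<Rightarrow> real" and i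
  proof -
    obtain x where x: "z = (x, 0)" "(x, 0) \<in> W" using z by (cases z) (auto simp: S_def)
    have "along (Xf i) (\<lambda>y. g (y, 0)) x = along (Xf i) (\<lambda>y. 0 :: real) x"
      by (rule along_cong[OF open_slice[OF open_W, of 0]]) (use x in \<open>auto simp: S_def intro!: g0\<close>)
    then show ?thesis using along_slice[OF g x(2), of i] x(1) by simp
  qed
  show "(\<Sum>l\<in>UNIV. h k l z * (along (X l) G z \<bullet> along (X j) G z)) = (if k = j then 1 else 0)" if "z \<in> W" for k j
    by (rule h_inverse[OF that])
  show "h k l z = h l k z" if "z \<in> W" for k l by (rule h_sym[OF that])
  show "along (X i) G z \<bullet> along (X j) G (x0, 0) = (if i = j then 1 else 0)" if zS: "z \<in> S" for i j
  proof -
    obtain x where x: "z = (x, 0)" "(x, 0) \<in> W1" using zS W_W1 by (cases z) (auto simp: S_def)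
    have "along (X i) G z = push (f 0) x (Xf i x)" using frame_push[OF x(2), of i] x(1) by simp
    moreover have "along (X j) G (x0, 0) = c j"
      using frame_push[OF W_W1'[OF p_W], of j] by (simp add: Xf_x0 c_def)
    moreover have "x \<in> \<Omega>'" using x by (simp add: W1_def)
    ultimately show ?thesis by (simp only: J_Xf)
  qed
  show "along T G z \<bullet> \<nu> = (\<Sum>k\<in>UNIV. \<Sum>l\<in>UNIV. h k l z * frame_sff X G h \<nu> k l z)" if zS: "z \<in> S" for \<nu>
  proof -
    obtain x where x: "z = (x, 0)" "(x, 0) \<in> W" using zS by (cases z) (auto simp: S_def)
    then show ?thesis using frame_geometry(4)[OF x(2), of \<nu>] along_T_G[OF W_W1'[OF x(2)]] by simp
  qed
  show "frame_curv X G h \<nu> \<xi> i j z = 0" if zS: "z \<in> S" for \<nu> \<xi> i j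
  proof -
    obtain x where x: "z = (x, 0)" "(x, 0) \<in> W" using zS by (cases z) (auto simp: S_def)
    then show ?thesis using frame_geometry(3)[OF x(2) _ flat0] by simp
  qed
qed

text \<open>Differentiating the frame fields contributes exactly the Christoffel terms of
  \<open>nabla_shape_at_inner\<close>, so the plain frame derivative equals the covariant one at the
  base point.\<close>

lemma dA_eq_nabla_shape:
  assumes \<nu>: "normal_at (f 0) x0 \<nu>"
  shows "dA q \<nu> $ i $ j = push (f 0) x0 (nabla_shape_at (f 0) x0 (e q) \<nu> (e i)) \<bullet> push (f 0) x0 (e j)"
proof -
  interpret f0': immersed \<Omega>' "f 0" using imm'[of 0] r by simp
  have P: "P k (x0, 0) = push (f 0) x0 (e k)" for k
    unfolding P_def using frame_push[OF W_W1'[OF p_W], of k] by (simp add: Xf_x0)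
  have N: "P k (x0, 0) \<bullet> \<nu> = 0" for k
    using \<nu> by (simp add: P normal_at_def inner_commute)
  text \<open>Since \<open>Q\<close> is normal at the base point, the frame is parallel there.\<close>
  have par: "along (Xf q) (Xf k) x0 = - tang (f 0) x0 (hess (f 0) x0 (e q) (e k))" for k
  proof -
    have "(hess (f 0) x0 (e q) (e k) - push (f 0) x0 (- along (Xf q) (Xf k) x0)) \<bullet> push (f 0) x0 (e m) = 0" for m
      using Q_normal[OF pS, of q k m] frame_hess[OF W_W1'[OF p_W], of q k] f0.push_linear[OF x0]
      by (simp add: P Q_def P_def[of k] Xf_x0 linear_neg)
    then have "(hess (f 0) x0 (e q) (e k) - push (f 0) x0 (- along (Xf q) (Xf k) x0)) \<bullet> push (f 0) x0 u = 0" for u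
      by (subst f0.orthonormal_expand[OF x0 e, of u])
        (simp add: linear_sum_scaleR[OF f0.push_linear[OF x0]] inner_sum_right)
    from f0.tang_eqI[OF x0 this] show ?thesis by simp
  qed
  have "dA q \<nu> $ i $ j = along (X q) (a \<nu> i j) (x0, 0)"
    by (simp add: Z_a[OF N] dA_def)
  also have "\<dots> = along (Xf q) (\<lambda>y. a \<nu> i j (y, 0)) x0"
    by (rule along_slice[OF a p_W])
  also have "\<dots> = along (Xf q) (\<lambda>y. hess (f 0) y (Xf i y) (Xf j y) \<bullet> nor (f 0) y \<nu>) x0"
    by (rule along_cong[OF open_slice[OF open_W, of 0]]) (use p_W frame_geometry(2) in auto)
  also have "\<dots> = along (\<lambda>_. e q) (\<lambda>y. hess (f 0) y (e i) (e j) \<bullet> nor (f 0) y \<nu>) x0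
       + hess (f 0) x0 (along (Xf q) (Xf i) x0) (e j) \<bullet> \<nu> + hess (f 0) x0 (e i) (along (Xf q) (Xf j) x0) \<bullet> \<nu>"
    unfolding f0'.along_hess_nor[OF x0' Cinf_Xf Cinf_Xf] by (simp add: Xf_x0 f0.nor_normal[OF x0 \<nu>])
  finally show ?thesis
    unfolding f0.nabla_shape_at_inner[OF x0 \<nu>] par
    by (simp add: linear_neg[OF f0.hess_linear_left[OF x0]] linear_neg[OF f0.hess_linear_right[OF x0]])
qed

text \<open>\<open>E\<close> vanishes at the base point at time zero and has nonzero time derivative
  there, so it is nonzero shortly afterwards, when flatness would force it to vanish.\<close>

lemma eventually_not_flat:
  assumes \<nu>: "normal_at (f 0) x0 \<nu>" and \<xi>: "normal_at (f 0) x0 \<xi>"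
    and C: "C_endo (f 0) x0 e \<nu> \<xi> \<noteq> (\<lambda>w. 0)"
  shows "\<forall>\<^sub>F t in at_right 0. \<not> flat_normal_on \<Omega> (f t)"
proof -
  let ?p = "(x0, 0 :: real)"
  have P: "P k ?p = push (f 0) x0 (e k)" for k
    unfolding P_def using frame_push[OF W_W1'[OF p_W], of k] by (simp add: Xf_x0)
  have N: "P k ?p \<bullet> \<eta> = 0" if "normal_at (f 0) x0 \<eta>" for k \<eta>
    using that by (simp add: P normal_at_def inner_commute)
  define B where "B q \<eta> = (\<chi> i j. push (f 0) x0 (nabla_shape_at (f 0) x0 (e q) \<eta> (e i)) \<bullet> push (f 0) x0 (e j))" for q \<eta>
  have B: "dA q \<nu> = B q \<nu>" "dA q \<xi> = B q \<xi>" for q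
    by (simp_all add: vec_eq_iff B_def dA_eq_nabla_shape[OF \<nu>] dA_eq_nabla_shape[OF \<xi>])
  obtain i j where ij: "(\<Sum>q\<in>UNIV. (B q \<nu> ** B q \<xi> - B q \<xi> ** B q \<nu>) $ i $ j) \<noteq> 0"
    using f0.C_endo_eq_0[OF x0 \<nu> \<xi> e, of B] C by (auto simp: B_def)
  let ?\<kappa> = "along T (E \<nu> \<xi> i j) ?p"
  have \<kappa>: "?\<kappa> \<noteq> 0"
    using frame_curv_evolution[OF N[OF \<nu>] N[OF \<xi>], of i j] ij by (simp add: B)
  have EC: "Cinf_on W (E \<nu> \<xi> i j)" unfolding E_eq by (intro Cinf_on_intros openW h a)
  let ?\<phi> = "\<lambda>t. E \<nu> \<xi> i j (x0, t)"
  have "((\<lambda>t. (x0, t)) has_derivative (\<lambda>s. (0, s))) (at (0::real))"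
    by (auto intro!: derivative_eq_intros)
  from diff_chain_at[OF this Cinf_on_has_derivative[OF EC p_W]]
  have d: "(?\<phi> has_derivative (\<lambda>s. frechet_derivative (E \<nu> \<xi> i j) (at ?p) (0, s))) (at 0)"
    by (simp add: o_def)
  have "frechet_derivative (E \<nu> \<xi> i j) (at ?p) (0, s) = ?\<kappa> * s" for s
    using linear_cmul[OF Cinf_on_frechet_linear[OF EC p_W], of s "(0, 1)"]
    by (simp add: along_def T_def mult.commute)
  then have "(?\<phi> has_real_derivative ?\<kappa>) (at 0)"
    using d by (simp add: has_field_derivative_def)
  then have "((\<lambda>t. (?\<phi> t - ?\<phi> 0) / (t - 0)) \<longlongrightarrow> ?\<kappa>) (at 0)"
    by (simp add: has_field_derivative_iff)
  then have "\<forall>\<^sub>F t in at 0. (?\<phi> t - ?\<phi> 0) / (t - 0) \<noteq> 0"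
    using tendsto_imp_eventually_ne[OF _ \<kappa>] by blast
  then have "\<forall>\<^sub>F t in at_right 0. (?\<phi> t - ?\<phi> 0) / (t - 0) \<noteq> 0"
    by (simp add: eventually_at_split)
  then have ne: "\<forall>\<^sub>F t in at_right 0. ?\<phi> t \<noteq> 0"
    by (rule eventually_mono) (use flat[OF pS] in auto)
  \<comment> \<open>\<open>frame_geometry\<close> holds only inside \<open>W\<close>, which contains
    a short time segment above the base point.\<close>
  have "open {t. (x0, t) \<in> W}"
    using open_vimage[OF open_W, of "\<lambda>t. (x0, t)"] by (simp add: vimage_def continuous_intros)
  then have "\<forall>\<^sub>F t in nhds 0. (x0, t) \<in> W"
    using p_W by (auto simp: eventually_nhds)
  then have inW: "\<forall>\<^sub>F t in at_right 0. (x0, t) \<in> W"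
    by (simp add: eventually_at_filter eventually_mono)
  have "\<forall>\<^sub>F t in at_right 0. t > (0::real)" by (rule eventually_at_right_less)
  with ne inW show ?thesis
  proof eventually_elim
    case (elim t)
    then show ?case using frame_geometry(3)[of x0 t \<nu> \<xi> i j] by auto
  qed
qed

end

section \<open>From one chart to the manifold\<close>

theorem theorem2p2:
  fixes M :: "'a topology"
    and \<A> :: "('a, 'm::finite) chart set"
    and T :: ereal
    and F :: "'a \<Rightarrow> real \<Rightarrow> real ^ 'n::finite"
    and c :: "('a, 'm) chart"
    and p :: 'a
    and \<nu> \<xi> :: "real ^ 'n"
    and e :: "'m \<Rightarrow> real ^ 'm"
  defines "f0 \<equiv> in_chart c (\<lambda>q. F q 0)"
  assumes "smooth_manifold M \<A>"
    and "0 < T"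
    and "mean_curvature_flow \<A> T F"
    and "flat_normal_bundle \<A> (\<lambda>q. F q 0)"
    and "c \<in> \<A>" and "p \<in> fst c"
    and "normal_at f0 (snd c p) \<nu>" and "normal_at f0 (snd c p) \<xi>"
    and "orthonormal_at f0 (snd c p) e"
    and "C_endo f0 (snd c p) e \<nu> \<xi> \<noteq> (\<lambda>w. 0)"
  shows "\<forall>\<^sub>F t in at_right 0. \<not> flat_normal_bundle \<A> (\<lambda>q. F q t)"
proof -
  let ?\<Omega> = "chart_image c"
  define f where "f t = in_chart c (\<lambda>q. F q t)" for t
  have f0: "f0 = f 0" by (simp add: f0_def f_def)
  have fF: "f t x = F (inv_into (fst c) (snd c) x) t" for t x
    by (simp add: f_def in_chart_def)
  have x0: "snd c p \<in> ?\<Omega>" using assms by (simp add: chart_image_def)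
  have open\<Omega>: "open ?\<Omega>"
    using assms(2,6) by (force simp: smooth_manifold_def chart_on_def chart_image_def)
  \<comment> \<open>\<open>T\<close> may be infinite; a real bound below it is enough since only
    small times matter.\<close>
  obtain r where r: "0 < ereal r" "ereal r < T" using ereal_dense2[OF assms(3)] by blast
  have TI: "t \<in> time_interval T" if "0 \<le> t" "t < r" for t
    using that r less_trans[of "ereal t" "ereal r" T] by (auto simp: time_interval_def)
  have imm: "immersed ?\<Omega> (f t)" if "0 \<le> t" "t < r" for t
  proof -
    have "immersion \<A> (\<lambda>q. F q t)"
      using assms(4) TI[OF that] by (simp add: mean_curvature_flow_def)
    then show ?thesis
      using assms(6) open\<Omega> smooth_on_imp_Cinf_on[OF open\<Omega>] unfolding immersion_def immersed_def f_def by blast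
  qed
  have "smooth_on (?\<Omega> \<times> time_interval T) (\<lambda>(x, t). in_chart c F x t)"
    using assms(4,6) by (simp add: mean_curvature_flow_def)
  moreover have "(snd c p, 0) \<in> ?\<Omega> \<times> time_interval T" using x0 TI[of 0] r by simp
  ultimately obtain W0 G where W0: "open W0" "(snd c p, 0) \<in> W0" and G: "\<forall>k. Ck_on k W0 G"
    and GF: "\<forall>z\<in>W0 \<inter> ?\<Omega> \<times> time_interval T. G z = (case z of (x, t) \<Rightarrow> in_chart c F x t)"
    unfolding smooth_on_def by blast
  have evol: "((\<lambda>t. f t x) has_vector_derivative mean_curv (f 0) x) (at 0 within {0..<r})" if "x \<in> ?\<Omega>" for x
  proof -
    have q: "inv_into (fst c) (snd c) x \<in> fst c" "snd c (inv_into (fst c) (snd c) x) = x"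
      using that by (auto simp: chart_image_def inv_into_into f_inv_into_f)
    have "(F (inv_into (fst c) (snd c) x) has_vector_derivative mean_curv (f 0) x) (at 0 within time_interval T)"
      using assms(4,6) q TI[of 0] r unfolding mean_curvature_flow_def f_def by force
    moreover have "F (inv_into (fst c) (snd c) x) = (\<lambda>t. f t x)" by (simp add: fun_eq_iff fF)
    ultimately show ?thesis
      using TI by (auto intro: has_vector_derivative_within_subset)
  qed
  \<comment> \<open>Flatness of the bundle means flatness in every chart, so failure in the single
    chart \<open>c\<close> is enough.\<close>
  have flat_chart: "flat_normal_bundle \<A> (\<lambda>q. F q t) \<Longrightarrow> flat_normal_on ?\<Omega> (f t)" for t
    using assms(6) by (simp add: flat_normal_bundle_def f_def)
  interpret flow_chart ?\<Omega> r f W0 G "snd c p" e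
  proof (rule flow_chart.intro)
    show "G (x, t) = f t x" if "(x, t) \<in> W0" "x \<in> ?\<Omega>" "0 \<le> t" "t < r" for x t
      using GF that TI[of t] by (auto simp: fF in_chart_def)
  qed (use r W0 G x0 assms(10) imm evol flat_chart assms(5) in \<open>auto simp: f0 Cinf_on_def\<close>)
  have "\<forall>\<^sub>F t in at_right 0. \<not> flat_normal_on ?\<Omega> (f t)"
    using eventually_not_flat assms by (simp add: f0)
  then show ?thesis by (rule eventually_mono) (use flat_chart in blast)
qed

end
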